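(* Let $A$ generate a $C_0$-semigroup on the complex Hilbert space $H$, let $B\in\mathcal{L}(U,(\mathrm{dom}\,A^* )')$, and assume that for every $T>0$ the map $u\mapsto Lu$, $(Lu)(t)=\int_0^t e^{\mathcal{A}(t-s)}Bu(s)\,ds$, is linear and continuous from $L^2(0,T;U)$ into $L^2(0,T;H)$. Suppose that the system $\dot y=\mathcal{A}y+Bu$, $y(0)=y_0\in H$, is null controllable. Then there exists $P=P^*\in\mathcal{L}(H)$ such that for every $y_0\in H$ $$I(y_0)=\langle y_0,Py_0\rangle .$$ Furthermore, $P$ satisfies, for any $y_0\in H$ and $u\in L^2_{\rm loc}(0,+\infty;U)$, $$\langle Py(t;y_0,u),y(t;y_0,u)\rangle-\langle Py_0,y_0\rangle+\int_0^t|u(s)|^2\,ds\ge 0\qquad\text{for a.e. } t\ge 0 .$$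
   Context: Setting. $H$ is a complex Hilbert space with inner product $\langle\cdot,\cdot\rangle$ and norm $|\cdot|$; $A$ generates a $C_0$-semigroup $e^{At}$ on $H$; $A^*$ is its Hilbert space adjoint. The space $\mathrm{dom}\,A^*$ with the graph norm is a Hilbert space, not identified with its dual; $H$ is identified with its dual, so $\mathrm{dom}\,A^*\subset H=H'\subset(\mathrm{dom}\,A^* )'$ with continuous dense injections. $\mathcal{A}$ denotes the extension of $A$ to $(\mathrm{dom}\,A^* )'$ (the dual of $A^*\in\mathcal{L}(\mathrm{dom}\,A^*,H)$); its domain is $H$ and it generates a $C_0$-semigroup $e^{\mathcal{A}t}$ on $(\mathrm{dom}\,A^* )'$ extending $e^{At}$. $U$ is a Hilbert space. The solution of the system with initial state $y_0\in H$ and control $u\in L^2_{\rm loc}(0,+\infty;U)$ is $y(t;y_0,u)=e^{At}y_0+\int_0^t e^{\mathcal{A}(t-s)}Bu(s)\,ds$, which belongs to $L^2_{\rm loc}(0,+\infty;H)$ under the assumption on $L$. Definitions. $y_0\in H$ can be steered to the rest in time (at most) $T$ if there is a control $u\in L^2_{\rm loc}(0,+\infty;U)$ with support in $[0,T]$ such that $y(\cdot;y_0,u)$ has support in $[0,T]$ too. The system is null controllable if every $y_0\in H$ can be steered to the rest in a suitable time $T_{y_0}$ at most. The value function is $I(y_0)=\inf_{u\in\mathcal{U}(y_0)}\int_0^{+\infty}|u(s)|^2ds$, where $\mathcal{U}(y_0)=\{u\in L^2(0,+\infty;U): y(\cdot;y_0,u)\in L^2(0,+\infty;H)\}$. *)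

theory Defs
  imports "HOL-Analysis.Analysis" "HOL-Library.Function_Algebras"
begin

section \<open>Complex Hilbert spaces\<close>

class complex_vector = real_vector +
  fixes scaleC :: "complex \<Rightarrow> 'a \<Rightarrow> 'a"  (infixr \<open>*\<^sub>C\<close> 75)
  assumes scaleC_add_right: "c *\<^sub>C (x + y) = c *\<^sub>C x + c *\<^sub>C y"
    and scaleC_add_left: "(c + d) *\<^sub>C x = c *\<^sub>C x + d *\<^sub>C x"
    and scaleC_scaleC: "c *\<^sub>C d *\<^sub>C x = (c * d) *\<^sub>C x"
    and scaleC_of_real: "complex_of_real r *\<^sub>C x = r *\<^sub>R x"

text \<open>The inner product is linear in the first argument. The underlying real Hilbert space
  structure, and hence the norm, is the one given by its real part.\<close>

class complex_inner = complex_vector + real_inner +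
  fixes cinner :: "'a \<Rightarrow> 'a \<Rightarrow> complex"
  assumes cinner_commute: "cinner x y = cnj (cinner y x)"
    and cinner_add_left: "cinner (x + y) z = cinner x z + cinner y z"
    and cinner_scaleC_left: "cinner (c *\<^sub>C x) y = c * cinner x y"
    and inner_eq_Re_cinner: "inner x y = Re (cinner x y)"

class complex_hilbert = complex_inner + complete_space

lemma cinner_self: "cinner x x = complex_of_real ((norm x)\<^sup>2)"
  for x :: "'a::complex_inner"
proof (rule complex_eqI)
  show "Re (cinner x x) = Re (complex_of_real ((norm x)\<^sup>2))"
    by (simp add: power2_norm_eq_inner flip: inner_eq_Re_cinner)
  have "Im (cinner x x) = - Im (cinner x x)"
    using arg_cong[OF cinner_commute[of x x], of Im] by simp
  then show "Im (cinner x x) = Im (complex_of_real ((norm x)\<^sup>2))"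
    by simp
qed

instantiation complex :: complex_hilbert
begin
definition scaleC_complex :: "complex \<Rightarrow> complex \<Rightarrow> complex"
  where "scaleC_complex c x = c * x"
definition cinner_complex :: "complex \<Rightarrow> complex \<Rightarrow> complex"
  where "cinner_complex x y = x * cnj y"
instance
  by standard
    (auto simp: scaleC_complex_def cinner_complex_def inner_complex_def algebra_simps scaleR_conv_of_real)
end

text \<open>Pointwise vector space structure on functions; it is used for functionals.\<close>

instantiation "fun" :: (type, real_vector) real_vector
begin
definition scaleR_fun :: "real \<Rightarrow> ('a \<Rightarrow> 'b) \<Rightarrow> 'a \<Rightarrow> 'b"
  where "scaleR_fun r f = (\<lambda>x. r *\<^sub>R f x)"
instance
  by standard (auto simp: scaleR_fun_def fun_eq_iff algebra_simps)
end

instantiation "fun" :: (type, complex_vector) complex_vector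
begin
definition scaleC_fun :: "complex \<Rightarrow> ('a \<Rightarrow> 'b) \<Rightarrow> 'a \<Rightarrow> 'b"
  where "scaleC_fun c f = (\<lambda>x. c *\<^sub>C f x)"
instance
  by standard
    (auto simp: scaleC_fun_def scaleR_fun_def fun_eq_iff scaleC_add_right scaleC_add_left
      scaleC_scaleC scaleC_of_real)
end

section \<open>Operators and semigroups on a normed space given by carrier and norm\<close>

text \<open>The space \<open>(dom A\<^sup>*)'\<close> depends on the operator \<open>A\<close>, so it cannot be a type. The general
  notions below are therefore stated for a subspace \<open>V\<close> of a vector space with a norm \<open>nV\<close> on
  \<open>V\<close>; for a space that is a type they are used with \<open>V = UNIV\<close> and \<open>nV = norm\<close>.\<close>

definition bounded_clinear_on ::
  "'a::complex_vector set \<Rightarrow> ('a \<Rightarrow> real) \<Rightarrow> 'b::complex_vector set \<Rightarrow> ('b \<Rightarrow> real) \<Rightarrow> ('a \<Rightarrow> 'b) \<Rightarrow> bool"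
  where "bounded_clinear_on V nV W nW T \<longleftrightarrow>
    (\<forall>x\<in>V. T x \<in> W) \<and>
    (\<forall>x\<in>V. \<forall>y\<in>V. T (x + y) = T x + T y) \<and>
    (\<forall>c. \<forall>x\<in>V. T (c *\<^sub>C x) = c *\<^sub>C T x) \<and>
    (\<exists>M. \<forall>x\<in>V. nW (T x) \<le> M * nV x)"

definition C0_semigroup :: "'a::complex_vector set \<Rightarrow> ('a \<Rightarrow> real) \<Rightarrow> (real \<Rightarrow> 'a \<Rightarrow> 'a) \<Rightarrow> bool"
  where "C0_semigroup V nV S \<longleftrightarrow>
    (\<forall>t\<ge>0. bounded_clinear_on V nV V nV (S t)) \<and>
    (\<forall>x\<in>V. S 0 x = x) \<and>
    (\<forall>s\<ge>0. \<forall>t\<ge>0. \<forall>x\<in>V. S (s + t) x = S s (S t x)) \<and>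
    (\<forall>x\<in>V. ((\<lambda>t. nV (S t x - x)) \<longlongrightarrow> 0) (at_right 0))"

definition generator_at ::
  "('a::complex_vector \<Rightarrow> real) \<Rightarrow> (real \<Rightarrow> 'a \<Rightarrow> 'a) \<Rightarrow> 'a \<Rightarrow> 'a \<Rightarrow> bool"
  where "generator_at nV S x y \<longleftrightarrow>
    ((\<lambda>t. nV ((1 / t) *\<^sub>R (S t x - x) - y)) \<longlongrightarrow> 0) (at_right 0)"

text \<open>An unbounded operator is a domain \<open>D\<close> together with a function whose values outside \<open>D\<close>
  are irrelevant.\<close>

definition generates ::
  "'a::complex_vector set \<Rightarrow> ('a \<Rightarrow> real) \<Rightarrow> 'a set \<Rightarrow> ('a \<Rightarrow> 'a) \<Rightarrow> (real \<Rightarrow> 'a \<Rightarrow> 'a) \<Rightarrow> bool"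
  where "generates V nV D A S \<longleftrightarrow>
    C0_semigroup V nV S \<and>
    D = {x \<in> V. \<exists>y\<in>V. generator_at nV S x y} \<and>
    (\<forall>x\<in>D. A x \<in> V \<and> generator_at nV S x (A x))"

section \<open>Strong measurability, Bochner integral, square integrability\<close>

text \<open>The Bochner integral of the library is restricted to second countable (separable) spaces.
  The following is its definition, built on the same simple functions, without that restriction;
  Borel measurability becomes strong measurability.\<close>

definition strongly_measurable :: "'b set \<Rightarrow> ('b::real_vector \<Rightarrow> real) \<Rightarrow> 'a measure \<Rightarrow> ('a \<Rightarrow> 'b) \<Rightarrow> bool"
  where "strongly_measurable V nV M f \<longleftrightarrow>
    (\<forall>x\<in>space M. f x \<in> V) \<and>
    (\<exists>s :: nat \<Rightarrow> 'a \<Rightarrow> 'b. (\<forall>i. simple_function M (s i) \<and> (\<forall>x\<in>space M. s i x \<in> V)) \<and>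
      (AE x in M. (\<lambda>i. nV (f x - s i x)) \<longlonglongrightarrow> 0))"

definition has_bochner_integral_on ::
  "'b set \<Rightarrow> ('b::real_vector \<Rightarrow> real) \<Rightarrow> 'a measure \<Rightarrow> ('a \<Rightarrow> 'b) \<Rightarrow> 'b \<Rightarrow> bool"
  where "has_bochner_integral_on V nV M f I \<longleftrightarrow>
    strongly_measurable V nV M f \<and> I \<in> V \<and>
    (\<exists>s :: nat \<Rightarrow> 'a \<Rightarrow> 'b.
      (\<forall>i. Bochner_Integration.simple_bochner_integrable M (s i) \<and> (\<forall>x\<in>space M. s i x \<in> V)) \<and>
      (\<lambda>i. \<integral>\<^sup>+x. ennreal (nV (f x - s i x)) \<partial>M) \<longlonglongrightarrow> 0 \<and>
      (\<lambda>i. nV (Bochner_Integration.simple_bochner_integral M (s i) - I)) \<longlonglongrightarrow> 0)"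

definition bochner_integral_on ::
  "'b set \<Rightarrow> ('b::real_vector \<Rightarrow> real) \<Rightarrow> 'a measure \<Rightarrow> ('a \<Rightarrow> 'b) \<Rightarrow> 'b"
  where "bochner_integral_on V nV M f = (THE I. has_bochner_integral_on V nV M f I)"

lemma has_bochner_integral_on_iff:
  fixes f :: "'a \<Rightarrow> 'b::{banach, second_countable_topology}"
  assumes f: "f \<in> borel_measurable M"
  shows "has_bochner_integral_on UNIV norm M f I \<longleftrightarrow> has_bochner_integral M f I"
proof -
  obtain F where F: "\<And>i. simple_function M (F i)"
    and lim: "\<And>x. x \<in> space M \<Longrightarrow> (\<lambda>i. F i x) \<longlonglongrightarrow> f x"
    using borel_measurable_implies_sequence_metric[OF f, of 0] by blast
  have "(\<lambda>i. norm (f x - F i x)) \<longlonglongrightarrow> 0" if "x \<in> space M" for x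
    using tendsto_norm[OF tendsto_diff[OF tendsto_const[of "f x"] lim[OF that]]] by simp
  then have "strongly_measurable UNIV norm M f"
    unfolding strongly_measurable_def using F by auto
  then show ?thesis
    using f by (simp add: has_bochner_integral_on_def has_bochner_integral.simps tendsto_norm_zero_iff
        LIM_zero_iff)
qed

definition sq_integral :: "'a measure \<Rightarrow> ('a \<Rightarrow> 'b::real_normed_vector) \<Rightarrow> ennreal"
  where "sq_integral M f = (\<integral>\<^sup>+x. ennreal ((norm (f x))\<^sup>2) \<partial>M)"

definition L2 :: "'a measure \<Rightarrow> ('a \<Rightarrow> 'b::real_normed_vector) \<Rightarrow> bool"
  where "L2 M f \<longleftrightarrow> strongly_measurable UNIV norm M f \<and> sq_integral M f < \<infinity>"

definition L2_loc :: "(real \<Rightarrow> 'b::real_normed_vector) \<Rightarrow> bool"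
  where "L2_loc f \<longleftrightarrow> (\<forall>T>0. L2 (lebesgue_on {0<..<T}) f)"

section \<open>Adjoint and extrapolation space\<close>

definition adj_dom :: "'h::complex_hilbert set \<Rightarrow> ('h \<Rightarrow> 'h) \<Rightarrow> 'h set"
  where "adj_dom D A = {y. \<exists>z. \<forall>x\<in>D. cinner (A x) y = cinner x z}"

definition adj :: "'h::complex_hilbert set \<Rightarrow> ('h \<Rightarrow> 'h) \<Rightarrow> 'h \<Rightarrow> 'h"
  where "adj D A y = (THE z. \<forall>x\<in>D. cinner (A x) y = cinner x z)"

definition adj_graph_norm :: "'h::complex_hilbert set \<Rightarrow> ('h \<Rightarrow> 'h) \<Rightarrow> 'h \<Rightarrow> real"
  where "adj_graph_norm D A \<phi> = sqrt ((norm \<phi>)\<^sup>2 + (norm (adj D A \<phi>))\<^sup>2)"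

text \<open>The dual \<open>(dom A\<^sup>*)'\<close> consists of the continuous \<^emph>\<open>conjugate-linear\<close> functionals, so that
  the embedding \<open>x \<mapsto> \<langle>x, \<cdot>\<rangle>\<close> of \<open>H\<close> is linear. A functional on \<open>dom A\<^sup>*\<close> is represented by its
  extension by zero.\<close>

definition extrap_space :: "'h::complex_hilbert set \<Rightarrow> ('h \<Rightarrow> 'h) \<Rightarrow> ('h \<Rightarrow> complex) set"
  where "extrap_space D A = {f.
    (\<forall>\<phi>. \<phi> \<notin> adj_dom D A \<longrightarrow> f \<phi> = 0) \<and>
    (\<forall>\<phi>\<in>adj_dom D A. \<forall>\<psi>\<in>adj_dom D A. f (\<phi> + \<psi>) = f \<phi> + f \<psi>) \<and>
    (\<forall>c. \<forall>\<phi>\<in>adj_dom D A. f (c *\<^sub>C \<phi>) = cnj c * f \<phi>) \<and>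
    (\<exists>M. \<forall>\<phi>\<in>adj_dom D A. cmod (f \<phi>) \<le> M * adj_graph_norm D A \<phi>)}"

definition extrap_norm :: "'h::complex_hilbert set \<Rightarrow> ('h \<Rightarrow> 'h) \<Rightarrow> ('h \<Rightarrow> complex) \<Rightarrow> real"
  where "extrap_norm D A f = (SUP \<phi>\<in>{\<phi> \<in> adj_dom D A. adj_graph_norm D A \<phi> \<le> 1}. cmod (f \<phi>))"

definition embed_H :: "'h::complex_hilbert set \<Rightarrow> ('h \<Rightarrow> 'h) \<Rightarrow> 'h \<Rightarrow> ('h \<Rightarrow> complex)"
  where "embed_H D A x = (\<lambda>\<phi>. if \<phi> \<in> adj_dom D A then cinner x \<phi> else 0)"

text \<open>The extension of \<open>A\<close>, i.e. the dual of \<open>A\<^sup>* : dom A\<^sup>* \<rightarrow> H\<close>: its domain is the embedded \<open>H\<close>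
  and it sends \<open>x\<close> to \<open>\<phi> \<mapsto> \<langle>x, A\<^sup>* \<phi>\<rangle>\<close>.\<close>

definition extrap_op :: "'h::complex_hilbert set \<Rightarrow> ('h \<Rightarrow> 'h) \<Rightarrow> ('h \<Rightarrow> complex) \<Rightarrow> ('h \<Rightarrow> complex)"
  where "extrap_op D A f =
    (\<lambda>\<phi>. if \<phi> \<in> adj_dom D A then cinner (inv (embed_H D A) f) (adj D A \<phi>) else 0)"

section \<open>The control system\<close>

text \<open>\<open>S\<close> is the semigroup generated by \<open>A\<close> on \<open>H\<close> and \<open>SE\<close> the one generated by \<open>extrap_op D A\<close>
  on \<open>extrap_space D A\<close>. The integral is taken in the latter space.\<close>

definition input_map ::
  "'h::complex_hilbert set \<Rightarrow> ('h \<Rightarrow> 'h) \<Rightarrow> (real \<Rightarrow> ('h \<Rightarrow> complex) \<Rightarrow> ('h \<Rightarrow> complex)) \<Rightarrow>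
   ('u::complex_hilbert \<Rightarrow> ('h \<Rightarrow> complex)) \<Rightarrow> (real \<Rightarrow> 'u) \<Rightarrow> real \<Rightarrow> ('h \<Rightarrow> complex)"
  where "input_map D A SE B u t =
    bochner_integral_on (extrap_space D A) (extrap_norm D A) (lebesgue_on {0<..<t})
      (\<lambda>s. SE (t - s) (B (u s)))"

text \<open>\<open>L\<close> is linear and continuous from \<open>L\<^sup>2(0,T;U)\<close> into \<open>L\<^sup>2(0,T;H)\<close> for all \<open>T > 0\<close>. Values in
  \<open>H\<close> are only available almost everywhere.\<close>

definition input_map_continuous ::
  "'h::complex_hilbert set \<Rightarrow> ('h \<Rightarrow> 'h) \<Rightarrow> (real \<Rightarrow> ('h \<Rightarrow> complex) \<Rightarrow> ('h \<Rightarrow> complex)) \<Rightarrow>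
   ('u::complex_hilbert \<Rightarrow> ('h \<Rightarrow> complex)) \<Rightarrow> bool"
  where "input_map_continuous D A SE B \<longleftrightarrow> (\<forall>T>0.
    let M = lebesgue_on {0<..<T}; L = input_map D A SE B in
    (\<forall>u v. L2 M u \<longrightarrow> L2 M v \<longrightarrow> (AE t in M. L (\<lambda>s. u s + v s) t = L u t + L v t)) \<and>
    (\<forall>c u. L2 M u \<longrightarrow> (AE t in M. L (\<lambda>s. c *\<^sub>C u s) t = c *\<^sub>C L u t)) \<and>
    (\<exists>C. \<forall>u. L2 M u \<longrightarrow>
      (AE t in M. L u t \<in> range (embed_H D A)) \<and>
      L2 M (\<lambda>t. inv (embed_H D A) (L u t)) \<and>
      sq_integral M (\<lambda>t. inv (embed_H D A) (L u t)) \<le> ennreal (C\<^sup>2) * sq_integral M u))"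

text \<open>The \<open>H\<close>-valued solution; it is unspecified at those \<open>t\<close> (a null set, if
  \<^const>\<open>input_map_continuous\<close> holds and \<open>u\<close> is locally square integrable) where the right-hand
  side is not in \<open>H\<close>.\<close>

definition solution ::
  "'h::complex_hilbert set \<Rightarrow> ('h \<Rightarrow> 'h) \<Rightarrow> (real \<Rightarrow> 'h \<Rightarrow> 'h) \<Rightarrow>
   (real \<Rightarrow> ('h \<Rightarrow> complex) \<Rightarrow> ('h \<Rightarrow> complex)) \<Rightarrow> ('u::complex_hilbert \<Rightarrow> ('h \<Rightarrow> complex)) \<Rightarrow>
   'h \<Rightarrow> (real \<Rightarrow> 'u) \<Rightarrow> real \<Rightarrow> 'h"
  where "solution D A S SE B y0 u t =
    inv (embed_H D A) (embed_H D A (S t y0) + input_map D A SE B u t)"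

text \<open>Elements of \<open>L\<^sup>2\<^sub>l\<^sub>o\<^sub>c\<close> are supported in \<open>[0,T]\<close> if they vanish almost everywhere after \<open>T\<close>.\<close>

definition steered_to_rest ::
  "'h::complex_hilbert set \<Rightarrow> ('h \<Rightarrow> 'h) \<Rightarrow> (real \<Rightarrow> 'h \<Rightarrow> 'h) \<Rightarrow>
   (real \<Rightarrow> ('h \<Rightarrow> complex) \<Rightarrow> ('h \<Rightarrow> complex)) \<Rightarrow> ('u::complex_hilbert \<Rightarrow> ('h \<Rightarrow> complex)) \<Rightarrow>
   'h \<Rightarrow> real \<Rightarrow> bool"
  where "steered_to_rest D A S SE B y0 T \<longleftrightarrow>
    (\<exists>u. L2_loc u \<and> (AE t in lebesgue_on {T<..}. u t = 0) \<and>
      (AE t in lebesgue_on {T<..}. solution D A S SE B y0 u t = 0))"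

definition null_controllable ::
  "'h::complex_hilbert set \<Rightarrow> ('h \<Rightarrow> 'h) \<Rightarrow> (real \<Rightarrow> 'h \<Rightarrow> 'h) \<Rightarrow>
   (real \<Rightarrow> ('h \<Rightarrow> complex) \<Rightarrow> ('h \<Rightarrow> complex)) \<Rightarrow> ('u::complex_hilbert \<Rightarrow> ('h \<Rightarrow> complex)) \<Rightarrow> bool"
  where "null_controllable D A S SE B \<longleftrightarrow> (\<forall>y0. \<exists>T\<ge>0. steered_to_rest D A S SE B y0 T)"

definition controls ::
  "'h::complex_hilbert set \<Rightarrow> ('h \<Rightarrow> 'h) \<Rightarrow> (real \<Rightarrow> 'h \<Rightarrow> 'h) \<Rightarrow>
   (real \<Rightarrow> ('h \<Rightarrow> complex) \<Rightarrow> ('h \<Rightarrow> complex)) \<Rightarrow> ('u::complex_hilbert \<Rightarrow> ('h \<Rightarrow> complex)) \<Rightarrow>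
   'h \<Rightarrow> (real \<Rightarrow> 'u) set"
  where "controls D A S SE B y0 =
    {u. L2 (lebesgue_on {0<..}) u \<and> L2 (lebesgue_on {0<..}) (solution D A S SE B y0 u)}"

definition value_function ::
  "'h::complex_hilbert set \<Rightarrow> ('h \<Rightarrow> 'h) \<Rightarrow> (real \<Rightarrow> 'h \<Rightarrow> 'h) \<Rightarrow>
   (real \<Rightarrow> ('h \<Rightarrow> complex) \<Rightarrow> ('h \<Rightarrow> complex)) \<Rightarrow> ('u::complex_hilbert \<Rightarrow> ('h \<Rightarrow> complex)) \<Rightarrow>
   'h \<Rightarrow> ereal"
  where "value_function D A S SE B y0 =
    (INF u\<in>controls D A S SE B y0. enn2ereal (sq_integral (lebesgue_on {0<..}) u))"

end

theory Submission
  imports Defs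
begin

text \<open>Tested against \<open>\<phi> \<in> dom A\<^sup>*\<close>, the input map is the scalar integral
  \<open>(L u)(t) \<phi> = \<integral> (B u(s)) (S(t-s)\<^sup>* \<phi>) ds\<close>. This gives linearity and the concatenation of
  trajectories exactly, for every \<open>t\<close> at which the values lie in \<open>H\<close>. Let \<open>C\<^sub>n\<close> be the set of states that
  are steered to rest in time \<open>n\<close> with energy at most \<open>n\<^sup>2\<close>. By null controllability the \<open>C\<^sub>n\<close> cover \<open>H\<close>; they
  are convex, symmetric and closed under convex series, so by Baire some \<open>C\<^sub>n\<close> contains a ball around \<open>0\<close>,
  that is \<open>I(y) \<le> C |y|\<^sup>2\<close>. Since trajectories are linear in state and control, \<open>I\<close> inherits homogeneity and the
  parallelogram law from the energy, and a bounded form of this kind is \<open>\<langle>y, P y\<rangle>\<close> (Jordan--von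
  Neumann and Riesz). The dissipation inequality compares \<open>y\<close> with the controls obtained by following \<open>u\<close>
  up to time \<open>t\<close> and continuing with an arbitrary admissible control.\<close>

section \<open>Hilbert spaces, uniform boundedness and Riesz representation\<close>

text \<open>Neither \<open>H\<close> nor \<open>U\<close> is assumed separable, and the space
  \<open>E\<close> that carries the input map depends on the operator, so vector-valued statements
  are reduced to scalar ones by testing. This rests on the duality
  \<open>SE t f \<phi> = f (Sad t \<phi>)\<close>, for which it must first be derived that
  \<open>SE\<close> extends \<open>S\<close>: the hypotheses relate only the two generators. A state
  in \<open>H\<close> is available only at almost every time, so facts about trajectories are proved
  as identities in \<open>E\<close> at a single time and pulled back through the injective
  embedding. Null controllability supplies a steering time and an energy without any bound in terms
  of the state. One integer caps both, which makes the cover countable. The sets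
  \<open>C\<^sub>n\<close> are not known to be closed; Baire is applied to their closures, and
  convex series lead back to the sets themselves. The value function is an infimum that is not known
  to be attained, hence its quadratic character is obtained from inequalities between
  infima.\<close>

instance complex_hilbert \<subseteq> banach ..

lemma cinner_add_right: "cinner x (y + z) = cinner x y + cinner x z" for x :: "'a::complex_inner"
  using cinner_add_left[of y z x] cinner_commute[of x] by (metis complex_cnj_add)

lemma cinner_scaleC_right: "cinner x (c *\<^sub>C y) = cnj c * cinner x y" for x :: "'a::complex_inner"
  using cinner_scaleC_left[of c y x] cinner_commute[of x] by (metis complex_cnj_mult)

lemma cinner_scaleR_left: "cinner (r *\<^sub>R x) y = r *\<^sub>R cinner x y" for x :: "'a::complex_inner"
  using cinner_scaleC_left[of "complex_of_real r" x y] by (simp add: scaleC_of_real scaleR_conv_of_real)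

lemma cinner_scaleR_right: "cinner x (r *\<^sub>R y) = r *\<^sub>R cinner x y" for x :: "'a::complex_inner"
  using cinner_scaleC_right[of x "complex_of_real r" y] by (simp add: scaleC_of_real scaleR_conv_of_real)

lemma norm_scaleC: "norm (c *\<^sub>C x) = cmod c * norm x" for x :: "'a::complex_inner"
proof -
  have "complex_of_real ((norm (c *\<^sub>C x))\<^sup>2) = (c * cnj c) * complex_of_real ((norm x)\<^sup>2)"
    by (simp only: cinner_self[symmetric] cinner_scaleC_left cinner_scaleC_right ac_simps)
  also have "\<dots> = complex_of_real ((cmod c * norm x)\<^sup>2)"
    by (simp add: complex_norm_square[symmetric] power_mult_distrib)
  finally have "(norm (c *\<^sub>C x))\<^sup>2 = (cmod c * norm x)\<^sup>2"
    using of_real_eq_iff by blast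
  then show ?thesis
    by (simp add: power2_eq_iff_nonneg)
qed

lemma scaleC_minus1: "(- 1) *\<^sub>C x = - x" for x :: "'a::complex_vector"
  using scaleC_of_real[of "-1" x] by simp

lemma scaleC_zero_right: "c *\<^sub>C (0::'a::complex_vector) = 0"
  using scaleC_add_right[of c 0 "0::'a"] by simp

lemma scaleC_zero_left: "0 *\<^sub>C (x::'a::complex_vector) = 0"
  using scaleC_of_real[of 0 x] by simp

lemma scaleC_one: "1 *\<^sub>C (x::'a::complex_vector) = x"
  using scaleC_of_real[of 1 x] by simp

lemma norm_cinner_le: "cmod (cinner x y) \<le> norm x * norm y" for x :: "'a::complex_inner"
proof (cases "cinner x y = 0")
  case False
  \<comment> \<open>A unimodular factor that rotates \<open>cinner x y\<close> onto the positive
    real axis, so that the real Cauchy-Schwarz inequality applies.\<close>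
  define c where "c = cnj (cinner x y) / complex_of_real (cmod (cinner x y))"
  have c: "cmod c = 1" "c * cinner x y = complex_of_real (cmod (cinner x y))"
    using False by (auto simp: c_def norm_divide complex_norm_square[symmetric] power2_eq_square
        mult.commute[of "cnj _"])
  have "cmod (cinner x y) = inner (c *\<^sub>C x) y"
    by (simp add: inner_eq_Re_cinner cinner_scaleC_left c)
  also have "\<dots> \<le> norm (c *\<^sub>C x) * norm y"
    by (rule norm_cauchy_schwarz)
  finally show ?thesis by (simp add: norm_scaleC c)
qed auto

lemma bounded_bilinear_cinner: "bounded_bilinear (cinner :: 'a::complex_inner \<Rightarrow> 'a \<Rightarrow> complex)"
  by standard (auto simp: cinner_add_left cinner_add_right cinner_scaleR_left cinner_scaleR_right
      intro!: exI[of _ 1] norm_cinner_le)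

interpretation cinner: bounded_bilinear "cinner :: 'a::complex_inner \<Rightarrow> 'a \<Rightarrow> complex"
  by (rule bounded_bilinear_cinner)

lemma cinner_eqI: "x = y" if "\<And>z. cinner x z = cinner y z" for x :: "'a::complex_inner"
proof -
  have "inner (x - y) (x - y) = 0"
    using that[of "x - y"] by (simp add: inner_eq_Re_cinner cinner.diff_left)
  then show ?thesis by simp
qed

lemma cinner_eqI_right: "x = y" if "\<And>z. cinner z x = cinner z y" for x :: "'a::complex_inner"
  using that by (metis cinner_eqI cinner_commute)

lemma bounded_linear_scaleC: "bounded_linear (\<lambda>x::'a::complex_inner. c *\<^sub>C x)"
proof (rule bounded_linear_intro[where K = "cmod c"])
  show "c *\<^sub>C (r *\<^sub>R x) = r *\<^sub>R (c *\<^sub>C x)" for r and x :: 'a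
    by (metis scaleC_of_real scaleC_scaleC mult.commute)
qed (auto simp: scaleC_add_right norm_scaleC)

lemma eventually_at_right_0I:
  assumes "d > 0" "\<And>h. 0 < h \<Longrightarrow> h < d \<Longrightarrow> P h"
  shows "eventually P (at_right (0::real))"
  using assms by (auto simp: eventually_at_right_field)

text \<open>One-sided derivatives suffice; the generators below only provide these.\<close>

lemma right_derivative_zero_imp_eq:
  fixes g :: "real \<Rightarrow> 'a::real_normed_vector"
  assumes "a \<le> b" and cont: "continuous_on {a..b} g"
    and der: "\<And>s. a \<le> s \<Longrightarrow> s < b \<Longrightarrow> ((\<lambda>h. norm (g (s + h) - g s) / h) \<longlongrightarrow> 0) (at_right 0)"
  shows "g b = g a"
proof -
  have "norm (g b - g a) \<le> e * (b - a)" if e: "e > 0" for e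
  proof -
    \<comment> \<open>The largest point of \<open>T\<close> must be \<open>b\<close>: at an earlier
      point the vanishing right derivative would prolong the slope bound \<open>e\<close> a little
      further.\<close>
    define T where "T = {s \<in> {a..b}. norm (g s - g a) \<le> e * (s - a)}"
    have "closed T"
      unfolding T_def by (intro continuous_on_closed_Collect_le continuous_intros cont closed_real_atLeastAtMost)
    moreover have "bounded T"
      by (rule bounded_subset[of "{a..b}"]) (auto simp: T_def)
    moreover have "a \<in> T"
      using \<open>a \<le> b\<close> by (auto simp: T_def)
    ultimately obtain c where c: "c \<in> T" "\<And>s. s \<in> T \<Longrightarrow> s \<le> c"
      using compact_attains_sup[of T] by (auto simp: compact_eq_bounded_closed)
    have "c = b"
    proof (rule ccontr)
      assume "c \<noteq> b"
      then have "a \<le> c" "c < b" using c(1) by (auto simp: T_def)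
      have "eventually (\<lambda>h. norm (g (c + h) - g c) / h < e) (at_right 0)"
        using order_tendstoD(2)[OF der[OF \<open>a \<le> c\<close> \<open>c < b\<close>] e] .
      moreover have "eventually (\<lambda>h. 0 < h \<and> h < b - c) (at_right 0)"
        using \<open>c < b\<close> by (intro eventually_at_right_0I[of "b - c"]) auto
      ultimately have "eventually (\<lambda>h. norm (g (c + h) - g c) / h < e \<and> 0 < h \<and> h < b - c) (at_right 0)"
        by eventually_elim simp
      then obtain h where h: "norm (g (c + h) - g c) / h < e" "0 < h" "h < b - c"
        using eventually_happens'[OF trivial_limit_at_right_real] by blast
      have "norm (g (c + h) - g a) \<le> norm (g (c + h) - g c) + norm (g c - g a)"
        using norm_triangle_ineq[of "g (c + h) - g c" "g c - g a"] by simp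
      also have "\<dots> \<le> e * h + e * (c - a)"
        using c(1) h by (intro add_mono) (auto simp: T_def field_simps)
      finally have "c + h \<in> T"
        using h \<open>a \<le> c\<close> by (auto simp: T_def algebra_simps)
      then show False using c(2) h by fastforce
    qed
    then show ?thesis using c(1) by (simp add: T_def)
  qed
  then have "norm (g b - g a) \<le> 0 + e" if "e > 0" for e
    using \<open>a \<le> b\<close> that by (cases "a = b") (auto dest: meta_spec[of _ "e / (b - a)"])
  then show ?thesis
    using field_le_epsilon[of "norm (g b - g a)" 0] by simp
qed

text \<open>Baire category, in the form shared by uniform boundedness and the covering of
  \<open>H\<close> by steerable states.\<close>

lemma closed_cover_interior:
  fixes E :: "nat \<Rightarrow> 'a::{complete_space} set"
  assumes "\<And>n. closed (E n)" and "(\<Union>n. E n) = UNIV"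
  shows "\<exists>n. interior (E n) \<noteq> {}"
proof (rule ccontr)
  assume "\<not> ?thesis"
  then have "euclidean interior_of \<Union>(range E) = {}"
    using assms(1)
    by (intro Baire_category_alt) (auto simp: completely_metrizable_space_euclidean)
  then show False
    using assms(2) by simp
qed

text \<open>A family of seminorms replaces the family of operators, because the operators of
  interest take values in a carrier such as \<open>E\<close>, which is a set and not a type.\<close>

theorem uniform_boundedness:
  fixes p :: "'i \<Rightarrow> 'a::banach \<Rightarrow> real"
  assumes add: "\<And>k x y. p k (x + y) \<le> p k x + p k y"
    and scale: "\<And>k r x. p k (r *\<^sub>R x) = \<bar>r\<bar> * p k x"
    and bounded: "\<And>k. \<exists>C. \<forall>x. p k x \<le> C * norm x"
    and pointwise: "\<And>x. \<exists>M. \<forall>k. p k x \<le> M"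
  shows "\<exists>M. \<forall>k x. p k x \<le> M * norm x"
proof -
  have cont: "continuous_on UNIV (p k)" for k
  proof -
    obtain C where C: "p k x \<le> C * norm x" for x using bounded by blast
    have 1: "p k x - p k y \<le> \<bar>C\<bar> * norm (x - y)" for x y
    proof -
      have "p k x - p k y \<le> p k (x - y)"
        using add[of k "x - y" y] by simp
      also have "\<dots> \<le> C * norm (x - y)" by (rule C)
      also have "\<dots> \<le> \<bar>C\<bar> * norm (x - y)" by (intro mult_right_mono) auto
      finally show ?thesis .
    qed
    have "\<bar>C\<bar>-lipschitz_on UNIV (p k)"
    proof (rule lipschitz_onI)
      show "dist (p k x) (p k y) \<le> \<bar>C\<bar> * dist x y" for x y
        using 1[of x y] 1[of y x] by (auto simp: dist_norm norm_minus_commute)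
    qed auto
    then show ?thesis by (rule lipschitz_on_continuous_on)
  qed
  define E where "E = (\<lambda>n::nat. \<Inter>k. {x. p k x \<le> real n})"
  have "closed (E n)" for n
    unfolding E_def
    by (intro closed_INT ballI closed_Collect_le cont continuous_on_const)
  moreover have "(\<Union>n. E n) = UNIV"
  proof -
    have "\<exists>n. x \<in> E n" for x
    proof -
      obtain M where "\<forall>k. p k x \<le> M" using pointwise by blast
      moreover obtain n :: nat where "M \<le> real n" using real_arch_simple by blast
      ultimately have "x \<in> E n" by (auto simp: E_def intro: order_trans)
      then show ?thesis ..
    qed
    then show ?thesis by auto
  qed
  ultimately obtain n where "interior (E n) \<noteq> {}"
    using closed_cover_interior[of E] by blast
  then obtain a where "a \<in> interior (E n)" by blast
  then obtain e where e: "e > 0" "cball a e \<subseteq> E n"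
    by (meson mem_interior_cball)
  \<comment> \<open>A vector \<open>y\<close> of norm \<open>e\<close> is the difference of
    \<open>a + y\<close> and \<open>a\<close>, both in the ball on which every \<open>p k\<close> is
    at most \<open>n\<close>. This gives \<open>2 * n\<close> for \<open>y\<close>, and rescaling
    brings in the divisor \<open>e\<close>.\<close>
  have "p k x \<le> (2 * real n / e) * norm x" for k x
  proof (cases "x = 0")
    case True
    then show ?thesis using scale[of k 0 x] by simp
  next
    case False
    define y where "y = (e / norm x) *\<^sub>R x"
    have "norm y = e" using False e by (simp add: y_def)
    then have "p k (a + y) \<le> n" "p k a \<le> n"
      using e by (auto simp: E_def dist_norm subset_iff)
    moreover have "p k (- a) = p k a" using scale[of k "-1" a] by simp
    moreover have "p k y \<le> p k (a + y) + p k (- a)"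
      using add[of k "a + y" "- a"] by simp
    ultimately have "p k y \<le> 2 * real n" by simp
    then show ?thesis
      using False e by (simp add: y_def scale field_simps)
  qed
  then show ?thesis by blast
qed

text \<open>The representing vector minimises \<open>(norm x)\<^sup>2 - 2 * f x\<close> over
  \<open>V\<close>, and the Euler equation of this problem is the claim. A closed subspace is
  allowed because one application takes place on the graph of the adjoint.\<close>

theorem riesz_closed_subspace:
  fixes V :: "'a::{real_inner, complete_space} set" and f :: "'a \<Rightarrow> real"
  assumes V: "closed V" "subspace V"
    and add: "\<And>x y. x \<in> V \<Longrightarrow> y \<in> V \<Longrightarrow> f (x + y) = f x + f y"
    and scale: "\<And>r x. x \<in> V \<Longrightarrow> f (r *\<^sub>R x) = r * f x"
    and bound: "\<And>x. x \<in> V \<Longrightarrow> \<bar>f x\<bar> \<le> M * norm x"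
  shows "\<exists>v\<in>V. \<forall>x\<in>V. f x = inner x v"
proof -
  define J where "J = (\<lambda>x. (norm x)\<^sup>2 - 2 * f x)"
  have "0 \<in> V" using V(2) by (rule subspace_0)
  have lower: "- (M\<^sup>2) \<le> J x" if "x \<in> V" for x
  proof -
    have "0 \<le> (norm x - M)\<^sup>2" by simp
    then show ?thesis using bound[OF that] by (simp add: J_def power2_eq_square algebra_simps)
  qed
  then have bdd: "bdd_below (J ` V)" by (auto intro!: bdd_belowI2)
  define m where "m = (INF x\<in>V. J x)"
  have m_le: "m \<le> J x" if "x \<in> V" for x
    unfolding m_def using bdd that by (rule cINF_lower)
  have "\<exists>x\<in>V. J x < m + 1 / real (Suc n)" for n
    unfolding m_def using \<open>0 \<in> V\<close> bdd by (intro cINF_less_iff[THEN iffD1]) auto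
  then obtain X where X: "\<And>n. X n \<in> V" "\<And>n. J (X n) < m + 1 / real (Suc n)"
    by metis
  \<comment> \<open>The excess over \<open>m\<close> at \<open>x\<close> and \<open>y\<close>
    controls their distance, since the value at the midpoint cannot lie below \<open>m\<close>. So
    every minimising sequence is Cauchy.\<close>
  have par: "(norm (x - y))\<^sup>2 \<le> 2 * (J x - m) + 2 * (J y - m)" if "x \<in> V" "y \<in> V" for x y
  proof -
    have mid: "(1/2) *\<^sub>R (x + y) \<in> V"
      using that V(2) by (intro subspace_scale subspace_add)
    have "f ((1/2) *\<^sub>R (x + y)) = (f x + f y) / 2"
      using that V(2) by (simp add: scale subspace_add add)
    then have "J ((1/2) *\<^sub>R (x + y)) = (norm (x + y))\<^sup>2 / 4 - (f x + f y)"
      by (simp add: J_def power_mult_distrib power2_eq_square)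
    moreover have "(norm (x + y))\<^sup>2 + (norm (x - y))\<^sup>2 = 2 * (norm x)\<^sup>2 + 2 * (norm y)\<^sup>2"
      by (simp add: power2_norm_eq_inner inner_add inner_diff inner_commute algebra_simps)
    ultimately show ?thesis
      using m_le[OF mid] by (simp add: J_def)
  qed
  have "Cauchy X"
  proof (rule metric_CauchyI)
    fix e :: real assume "e > 0"
    obtain N :: nat where N: "4 / e\<^sup>2 < real N" using reals_Archimedean2 by blast
    have "dist (X i) (X j) < e" if "i \<ge> N" "j \<ge> N" for i j
    proof -
      have s: "1 / real (Suc k) < e\<^sup>2 / 4" if "k \<ge> N" for k
      proof -
        have "4 / e\<^sup>2 < real (Suc k)" using N that by simp
        then show ?thesis using \<open>e > 0\<close> by (simp add: field_simps)
      qed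
      have "(norm (X i - X j))\<^sup>2 \<le> 2 * (J (X i) - m) + 2 * (J (X j) - m)"
        using par X(1) by blast
      also have "\<dots> < 2 * (e\<^sup>2 / 4) + 2 * (e\<^sup>2 / 4)"
        using X(2)[of i] X(2)[of j] s[OF that(1)] s[OF that(2)] by simp
      finally show ?thesis
        using \<open>e > 0\<close> by (simp add: dist_norm power_less_imp_less_base)
    qed
    then show "\<exists>N. \<forall>i\<ge>N. \<forall>j\<ge>N. dist (X i) (X j) < e" by blast
  qed
  then obtain v where v: "X \<longlonglongrightarrow> v" using Cauchy_convergent convergent_def by blast
  then have vV: "v \<in> V" using V(1) X(1) closed_sequentially by blast
  have "(\<lambda>n. f (X n)) \<longlonglongrightarrow> f v"
  proof -
    have "norm (f (X n) - f v) \<le> \<bar>M\<bar> * norm (X n - v)" for n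
    proof -
      have "f (X n) - f v = f (X n - v)"
        using add[of "X n - v" v] subspace_diff[OF V(2) X(1)[of n] vV] vV by simp
      then have "\<bar>f (X n) - f v\<bar> \<le> M * norm (X n - v)"
        using bound[OF subspace_diff[OF V(2) X(1)[of n] vV]] by simp
      also have "\<dots> \<le> \<bar>M\<bar> * norm (X n - v)" by (intro mult_right_mono) auto
      finally show ?thesis by simp
    qed
    moreover have "(\<lambda>n. \<bar>M\<bar> * norm (X n - v)) \<longlonglongrightarrow> 0"
      using tendsto_mult[OF tendsto_const[of "\<bar>M\<bar>"] tendsto_norm[OF LIM_zero[OF v]]] by simp
    ultimately have "(\<lambda>n. f (X n) - f v) \<longlonglongrightarrow> 0"
      by (rule Lim_null_comparison[OF always_eventually, OF allI])
    then show ?thesis by (rule LIM_zero_cancel)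
  qed
  then have "(\<lambda>n. J (X n)) \<longlonglongrightarrow> J v"
    unfolding J_def using v by (intro tendsto_intros)
  moreover have "(\<lambda>n. m + 1 / real (Suc n)) \<longlonglongrightarrow> m + 0"
    by (rule tendsto_add[OF tendsto_const LIMSEQ_Suc[OF lim_1_over_n]])
  ultimately have Jv: "J v \<le> m"
    using LIMSEQ_le[of "\<lambda>n. J (X n)" "J v" "\<lambda>n. m + 1 / real (Suc n)" m] X(2)
    by (auto intro: less_imp_le)
  have "f x = inner x v" if x: "x \<in> V" for x
  proof (cases "x = 0")
    case True then show ?thesis using scale[of x 0] x by simp
  next
    case False
    define d where "d = f x - inner x v"
    have "0 \<le> t\<^sup>2 * (norm x)\<^sup>2 - 2 * t * d" for t
    proof -
      have "(norm (v + t *\<^sub>R x))\<^sup>2 = (norm v)\<^sup>2 + 2 * t * inner x v + t\<^sup>2 * (norm x)\<^sup>2"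
        unfolding power2_norm_eq_inner
        by (simp add: inner_add inner_commute[of v x] power2_eq_square algebra_simps)
      moreover have "f (v + t *\<^sub>R x) = f v + t * f x"
        using vV x V(2) by (simp add: add scale subspace_scale)
      ultimately have eq: "J (v + t *\<^sub>R x) = J v + (t\<^sup>2 * (norm x)\<^sup>2 - 2 * t * d)"
        by (simp add: J_def d_def algebra_simps)
      have "J v \<le> J (v + t *\<^sub>R x)"
        using Jv m_le[of "v + t *\<^sub>R x"] V(2) vV x by (simp add: subspace_add subspace_scale)
      then show ?thesis using eq by simp
    qed
    \<comment> \<open>The value of \<open>t\<close> at which the quadratic is smallest, namely
      \<open>- d\<^sup>2 / N\<close> with \<open>N = (norm x)\<^sup>2\<close>; nonnegativity then
      forces \<open>d = 0\<close>.\<close>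
    note this[of "d / (norm x)\<^sup>2"]
    also have "(d / N)\<^sup>2 * N - 2 * (d / N) * d = - (d\<^sup>2 / N)" if "N \<noteq> 0" for N :: real
      using that by (simp add: power2_eq_square divide_simps)
    then have "(d / (norm x)\<^sup>2)\<^sup>2 * (norm x)\<^sup>2 - 2 * (d / (norm x)\<^sup>2) * d = - (d\<^sup>2 / (norm x)\<^sup>2)"
      using False by simp
    finally have "d\<^sup>2 / (norm x)\<^sup>2 \<le> 0" by simp
    then have "d = 0" using False by (simp add: divide_le_0_iff)
    then show ?thesis by (simp add: d_def)
  qed
  then show ?thesis using vV by blast
qed

text \<open>A complex linear functional is determined by its real part: the imaginary part at
  \<open>x\<close> is the real part at \<open>- \<i> x\<close>. So the vector that represents the
  real part of \<open>f\<close> over the reals represents \<open>f\<close>.\<close>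

corollary riesz_complex:
  fixes f :: "'h::complex_hilbert \<Rightarrow> complex"
  assumes add: "\<And>x y. f (x + y) = f x + f y" and scale: "\<And>c x. f (c *\<^sub>C x) = c * f x"
    and bound: "\<And>x. cmod (f x) \<le> M * norm x"
  shows "\<exists>z. \<forall>x. f x = cinner x z"
proof -
  have "\<exists>z\<in>UNIV. \<forall>x\<in>UNIV. Re (f x) = inner x z"
  proof (rule riesz_closed_subspace[where M = M])
    show "Re (f (r *\<^sub>R x)) = r * Re (f x)" for r x
      by (simp add: scale flip: scaleC_of_real)
    show "\<bar>Re (f x)\<bar> \<le> M * norm x" for x
      using abs_Re_le_cmod bound order_trans by blast
  qed (auto simp: add)
  then obtain z where z: "\<And>x. Re (f x) = inner x z" by auto
  have "f x = cinner x z" for x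
  proof (rule complex_eqI)
    show "Im (f x) = Im (cinner x z)"
      using z[of "(- \<i>) *\<^sub>C x"] by (simp only: scale inner_eq_Re_cinner cinner_scaleC_left) simp
  qed (simp add: z inner_eq_Re_cinner)
  then show ?thesis by blast
qed

text \<open>The laws are restricted to \<open>V\<close> because the instance
  \<open>extrap_norm\<close> is a supremum, meaningful only for functionals bounded on the unit ball
  of the graph norm.\<close>

locale seminorm_on =
  fixes V :: "'a::real_vector set" and nV :: "'a \<Rightarrow> real"
  assumes V_subspace: "subspace V"
    and nV_triangle: "\<And>x y. x \<in> V \<Longrightarrow> y \<in> V \<Longrightarrow> nV (x + y) \<le> nV x + nV y"
    and nV_scaleR: "\<And>r x. x \<in> V \<Longrightarrow> nV (r *\<^sub>R x) = \<bar>r\<bar> * nV x"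
begin

lemma V_0: "0 \<in> V"
  using V_subspace by (rule subspace_0)

lemma V_diff: "x \<in> V \<Longrightarrow> y \<in> V \<Longrightarrow> x - y \<in> V"
  using V_subspace by (rule subspace_diff)

lemma nV_minus: "x \<in> V \<Longrightarrow> nV (- x) = nV x"
  using nV_scaleR[of x "-1"] by simp

lemma nV_zero: "nV 0 = 0"
  using nV_scaleR[of 0 0] V_0 by simp

lemma nV_nonneg: "x \<in> V \<Longrightarrow> 0 \<le> nV x"
  using nV_triangle[of x "- x"] nV_minus[of x] subspace_neg[OF V_subspace, of x] nV_zero by simp

lemma nV_minus_commute: "x \<in> V \<Longrightarrow> y \<in> V \<Longrightarrow> nV (x - y) = nV (y - x)"
  using nV_minus[of "x - y"] V_diff[of x y] by simp

lemma nV_triangle_diff: "x \<in> V \<Longrightarrow> y \<in> V \<Longrightarrow> z \<in> V \<Longrightarrow> nV (x - z) \<le> nV (x - y) + nV (y - z)"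
  using nV_triangle[of "x - y" "y - z"] V_diff by simp

lemma nV_diff_le: "x \<in> V \<Longrightarrow> y \<in> V \<Longrightarrow> \<bar>nV x - nV y\<bar> \<le> nV (x - y)"
  using nV_triangle_diff[of x y 0] nV_triangle_diff[of y x 0] nV_minus_commute[of x y] V_0 by simp

end

section \<open>Strongly continuous semigroups and the adjoint of the generator\<close>

text \<open>The normed space \<open>V\<close> is presented as the image of a Banach space that is a type, because uniform
  boundedness is available on types only. For \<open>H\<close> take \<open>J = id\<close>; for \<open>(dom A\<^sup>*)'\<close> see \<open>J\<close> below.\<close>

locale C0_semigroup_on_quotient = seminorm_on V nV
  for V :: "'a::complex_vector set" and nV :: "'a \<Rightarrow> real" +
  fixes S :: "real \<Rightarrow> 'a \<Rightarrow> 'a" and J :: "'b::banach \<Rightarrow> 'a" and K :: real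
  assumes C0: "C0_semigroup V nV S"
    and J_mem: "\<And>x. J x \<in> V"
    and J_add: "\<And>x y. J (x + y) = J x + J y"
    and J_scaleR: "\<And>r x. J (r *\<^sub>R x) = r *\<^sub>R J x"
    and J_le: "\<And>x. nV (J x) \<le> norm x"
    and J_onto: "\<And>f. f \<in> V \<Longrightarrow> \<exists>x. J x = f \<and> norm x \<le> K * nV f"
begin

lemma S_mem: "t \<ge> 0 \<Longrightarrow> x \<in> V \<Longrightarrow> S t x \<in> V"
  and S_add: "t \<ge> 0 \<Longrightarrow> x \<in> V \<Longrightarrow> y \<in> V \<Longrightarrow> S t (x + y) = S t x + S t y"
  and S_scaleC: "t \<ge> 0 \<Longrightarrow> x \<in> V \<Longrightarrow> S t (c *\<^sub>C x) = c *\<^sub>C S t x"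
  and S_bounded: "t \<ge> 0 \<Longrightarrow> \<exists>M. \<forall>x\<in>V. nV (S t x) \<le> M * nV x"
  and S_0: "x \<in> V \<Longrightarrow> S 0 x = x"
  and S_S: "s \<ge> 0 \<Longrightarrow> t \<ge> 0 \<Longrightarrow> x \<in> V \<Longrightarrow> S (s + t) x = S s (S t x)"
  and S_tendsto: "x \<in> V \<Longrightarrow> ((\<lambda>t. nV (S t x - x)) \<longlongrightarrow> 0) (at_right 0)"
  using C0 unfolding C0_semigroup_def bounded_clinear_on_def by auto

lemma S_scaleR: "t \<ge> 0 \<Longrightarrow> x \<in> V \<Longrightarrow> S t (r *\<^sub>R x) = r *\<^sub>R S t x"
  using S_scaleC[of t x "complex_of_real r"] by (simp add: scaleC_of_real)

lemma S_diff: "t \<ge> 0 \<Longrightarrow> x \<in> V \<Longrightarrow> y \<in> V \<Longrightarrow> S t (x - y) = S t x - S t y"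
  using S_add[of t "x - y" y] V_diff[of x y] by (simp add: algebra_simps)

text \<open>Otherwise there are times \<open>t n\<close> tending to \<open>0\<close> at which some
  vector is amplified by more than \<open>n\<close>. Strong continuity at \<open>0\<close> bounds
  each single orbit along these times, so uniform boundedness bounds the operators, a
  contradiction.\<close>

lemma S_bounded_near_0: "\<exists>d>0. \<exists>M. \<forall>t\<in>{0..d}. \<forall>f\<in>V. nV (S t f) \<le> M * nV f"
proof (rule ccontr)
  assume neg: "\<not> ?thesis"
  have "\<exists>t f. 0 \<le> t \<and> t \<le> 1 / real (Suc n) \<and> f \<in> V \<and> real n * nV f < nV (S t f)" for n
    using neg[simplified, rule_format, of "1 / real (Suc n)" "real n"] by (auto simp: not_le)
  then obtain t f where t: "\<And>n. 0 \<le> t n" "\<And>n. t n \<le> 1 / real (Suc n)"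
    and f: "\<And>n. f n \<in> V" "\<And>n. real n * nV (f n) < nV (S (t n) (f n))"
    by metis
  have "\<exists>M. \<forall>k x. nV (S (t k) (J x)) \<le> M * norm x"
  proof (rule uniform_boundedness)
    show "\<exists>C. \<forall>x. nV (S (t k) (J x)) \<le> C * norm x" for k
    proof -
      obtain M where M: "\<forall>x\<in>V. nV (S (t k) x) \<le> M * nV x"
        using S_bounded[OF t(1)] by blast
      have "nV (S (t k) (J x)) \<le> \<bar>M\<bar> * norm x" for x
      proof -
        have "nV (S (t k) (J x)) \<le> M * nV (J x)" using M J_mem by blast
        also have "\<dots> \<le> \<bar>M\<bar> * norm x"
          by (intro mult_mono J_le nV_nonneg J_mem) auto
        finally show ?thesis .
      qed
      then show ?thesis by blast
    qed
    show "\<exists>M. \<forall>k. nV (S (t k) (J x)) \<le> M" for x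
    proof -
      let ?f = "J x"
      have "eventually (\<lambda>t. nV (S t ?f - ?f) < 1) (at_right 0)"
        using order_tendstoD(2)[OF S_tendsto[OF J_mem[of x]], of 1] by simp
      then obtain d where d: "d > 0" "\<And>t. 0 < t \<Longrightarrow> t < d \<Longrightarrow> nV (S t ?f - ?f) < 1"
        by (auto simp: eventually_at_right_field)
      obtain N :: nat where N: "1 / d < real N" using reals_Archimedean2 by blast
      \<comment> \<open>From \<open>N\<close> on the times are so small that the orbit stays within
        \<open>1\<close> of \<open>?f\<close>; the finitely many earlier values are absorbed by
        their sum.\<close>
      have "nV (S (t k) ?f) \<le> nV ?f + 1 + (\<Sum>j<N. nV (S (t j) ?f))" for k
      proof (cases "k < N")
        case True
        then have "nV (S (t k) ?f) \<le> (\<Sum>j<N. nV (S (t j) ?f))"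
          by (intro member_le_sum nV_nonneg S_mem t J_mem) auto
        then show ?thesis using nV_nonneg[OF J_mem[of x]] by simp
      next
        case False
        have "t k < d"
        proof -
          have "1 / d < real (Suc k)" using N False by simp
          then have "1 / real (Suc k) < d" using d(1) by (simp add: field_simps)
          then show ?thesis using t(2)[of k] by simp
        qed
        then have "nV (S (t k) ?f - ?f) \<le> 1"
          using d(2)[of "t k"] t(1)[of k] by (cases "t k = 0") (auto simp: S_0 J_mem nV_zero)
        moreover have "nV (S (t k) ?f) \<le> nV (S (t k) ?f - ?f) + nV ?f"
          using nV_triangle[of "S (t k) ?f - ?f" ?f] V_diff[of "S (t k) ?f" ?f] S_mem[OF t(1)] J_mem by simp
        moreover have "0 \<le> (\<Sum>j<N. nV (S (t j) ?f))"
          by (intro sum_nonneg nV_nonneg S_mem t J_mem)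
        ultimately show ?thesis by simp
      qed
      then show ?thesis by blast
    qed
  qed (use t J_mem in \<open>simp_all add: J_add J_scaleR S_add S_scaleR nV_triangle nV_scaleR S_mem\<close>)
  then obtain M where M: "\<And>k x. nV (S (t k) (J x)) \<le> M * norm x" by blast
  \<comment> \<open>The bound was obtained for preimages under \<open>J\<close>. Choosing one of
    norm at most \<open>K * nV (f n)\<close> carries it over to \<open>f n\<close>, at the price of
    the factor \<open>K\<close>.\<close>
  obtain n :: nat where n: "\<bar>M\<bar> * \<bar>K\<bar> < real n" using reals_Archimedean2 by blast
  obtain x where x: "J x = f n" "norm x \<le> K * nV (f n)" using J_onto[OF f(1)] by blast
  have "nV (S (t n) (f n)) \<le> M * norm x" using M[of n x] x(1) by simp
  also have "\<dots> \<le> \<bar>M\<bar> * (\<bar>K\<bar> * nV (f n))"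
    by (intro mult_mono order_trans[OF x(2)] mult_right_mono nV_nonneg f) auto
  also have "\<dots> \<le> real n * nV (f n)"
    using mult_right_mono[OF less_imp_le[OF n] nV_nonneg[OF f(1)[of n]]] by (simp add: mult.assoc)
  finally show False using f(2)[of n] by simp
qed

text \<open>The bound near \<open>0\<close> is iterated by the semigroup law in steps of length
  \<open>d\<close>. Taking the constant at least \<open>1\<close> makes its powers increase, so that
  one power serves the whole interval.\<close>

lemma S_locally_bounded:
  obtains M where "M \<ge> 1" "\<And>t f. 0 \<le> t \<Longrightarrow> t \<le> T \<Longrightarrow> f \<in> V \<Longrightarrow> nV (S t f) \<le> M * nV f"
proof -
  obtain d M0 where d: "d > 0" and M0: "\<And>t f. 0 \<le> t \<Longrightarrow> t \<le> d \<Longrightarrow> f \<in> V \<Longrightarrow> nV (S t f) \<le> M0 * nV f"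
    using S_bounded_near_0 by (meson atLeastAtMost_iff)
  define M where "M = max M0 1"
  have M: "nV (S t f) \<le> M * nV f" if "0 \<le> t" "t \<le> d" "f \<in> V" for t f
    using M0[OF that] mult_right_mono[of M0 M "nV f"] nV_nonneg[OF that(3)] by (auto simp: M_def)
  have step: "nV (S t f) \<le> M ^ k * nV f" if "0 \<le> t" "t \<le> real k * d" "f \<in> V" for t f k
    using that(1,2)
  proof (induction k arbitrary: t)
    case 0
    then show ?case using that by (simp add: S_0)
  next
    case (Suc k)
    show ?case
    proof (cases "t \<le> d")
      case True
      have "nV (S t f) \<le> M * nV f" using M[OF Suc.prems(1) True that(3)] .
      also have "\<dots> \<le> M ^ Suc k * nV f"
        using self_le_power[of M "Suc k"] nV_nonneg[OF that(3)] by (intro mult_right_mono) (auto simp: M_def)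
      finally show ?thesis .
    next
      case False
      then have "S t f = S d (S (t - d) f)"
        using S_S[of d "t - d" f] d that(3) by simp
      also have "nV \<dots> \<le> M * nV (S (t - d) f)"
        using d False that(3) by (intro M S_mem) auto
      also have "\<dots> \<le> M * (M ^ k * nV f)"
        using Suc.IH[of "t - d"] Suc.prems False by (intro mult_left_mono) (auto simp: M_def algebra_simps)
      finally show ?thesis by (simp add: mult.assoc)
    qed
  qed
  obtain k :: nat where "T / d \<le> real k" using real_arch_simple by blast
  then have "T \<le> real k * d" using d by (simp add: field_simps)
  moreover have "M ^ k \<ge> 1" by (simp add: M_def one_le_power)
  ultimately show ?thesis using step that[of "M ^ k"] by fastforce
qed

text \<open>For \<open>t \<le> s\<close> the difference is \<open>S t\<close> applied to
  \<open>S (s - t) f - f\<close>, so right continuity at \<open>0\<close> and the local bound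
  suffice, also for approaching a time from the left.\<close>

lemma S_uniformly_continuous:
  assumes f: "f \<in> V" and e: "e > 0"
  obtains d where "d > 0"
    "\<And>s t. 0 \<le> s \<Longrightarrow> s \<le> T \<Longrightarrow> 0 \<le> t \<Longrightarrow> t \<le> T \<Longrightarrow> \<bar>s - t\<bar> < d \<Longrightarrow> nV (S s f - S t f) < e"
proof -
  obtain M where M: "M \<ge> 1" "\<And>t f. 0 \<le> t \<Longrightarrow> t \<le> T \<Longrightarrow> f \<in> V \<Longrightarrow> nV (S t f) \<le> M * nV f"
    using S_locally_bounded[where T = T] by blast
  have "eventually (\<lambda>t. nV (S t f - f) < e / M) (at_right 0)"
    using order_tendstoD(2)[OF S_tendsto[OF f], of "e / M"] e M by simp
  then obtain d where d: "d > 0" "\<And>t. 0 < t \<Longrightarrow> t < d \<Longrightarrow> nV (S t f - f) < e / M"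
    by (auto simp: eventually_at_right_field)
  have *: "nV (S s f - S t f) < e" if "0 \<le> s" "s \<le> T" "0 \<le> t" "t \<le> s" "\<bar>s - t\<bar> < d" for s t
  proof (cases "s = t")
    case False
    have "S s f - S t f = S t (S (s - t) f - f)"
      using that f S_S[of t "s - t" f] by (simp add: S_diff S_mem)
    then have "nV (S s f - S t f) \<le> M * nV (S (s - t) f - f)"
      using M(2)[of t "S (s - t) f - f"] that f by (simp add: V_diff S_mem)
    also have "\<dots> < M * (e / M)"
      using d(2)[of "s - t"] that False M(1) by (intro mult_strict_left_mono) auto
    finally show ?thesis using M(1) by simp
  qed (use e nV_zero in auto)
  show ?thesis
  proof (rule that[OF d(1)])
    show "nV (S s f - S t f) < e" if "0 \<le> s" "s \<le> T" "0 \<le> t" "t \<le> T" "\<bar>s - t\<bar> < d" for s t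
      using that *[of s t] *[of t s] nV_minus_commute[OF S_mem[of s f] S_mem[of t f]] f
      by (cases "t \<le> s") (auto simp: abs_minus_commute)
  qed
qed

end

lemma has_vector_derivative_imp_right_difference_quotient:
  fixes F :: "real \<Rightarrow> 'a::real_normed_vector"
  assumes F: "(F has_vector_derivative F') (at t within {a..b})" and t: "a \<le> t" "t < b"
  shows "((\<lambda>h. (1 / h) *\<^sub>R (F (t + h) - F t)) \<longlongrightarrow> F') (at_right 0)"
proof -
  have "((\<lambda>y. norm (F y - F t - (y - t) *\<^sub>R F') / norm (y - t)) \<longlongrightarrow> 0) (at t within {a..b})"
    using F by (simp add: has_vector_derivative_def has_derivative_iff_norm)
  moreover have "filterlim (\<lambda>h. t + h) (at t within {a..b}) (at_right 0)"
  proof -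
    have "((\<lambda>h. t + h) \<longlongrightarrow> t + 0) (at_right 0)" by (intro tendsto_intros)
    moreover have "eventually (\<lambda>h. t + h \<in> {a..b} \<and> t + h \<noteq> t) (at_right 0)"
      using t by (intro eventually_at_right_0I[of "b - t"]) auto
    ultimately show ?thesis by (simp add: filterlim_at)
  qed
  ultimately have "((\<lambda>h. norm (F (t + h) - F t - (t + h - t) *\<^sub>R F') / norm (t + h - t)) \<longlongrightarrow> 0) (at_right 0)"
    by (rule filterlim_compose)
  moreover have "eventually (\<lambda>h. norm (F (t + h) - F t - (t + h - t) *\<^sub>R F') / norm (t + h - t)
      = norm ((1 / h) *\<^sub>R (F (t + h) - F t) - F')) (at_right 0)"
  proof (rule eventually_at_right_0I[of 1])
    fix h :: real assume "0 < h"
    then have "(1 / h) *\<^sub>R (F (t + h) - F t) - F' = (1 / h) *\<^sub>R (F (t + h) - F t - h *\<^sub>R F')"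
      by (simp add: scaleR_diff_right)
    then show "norm (F (t + h) - F t - (t + h - t) *\<^sub>R F') / norm (t + h - t)
      = norm ((1 / h) *\<^sub>R (F (t + h) - F t) - F')"
      using \<open>0 < h\<close> by simp
  qed simp
  ultimately have "((\<lambda>h. norm ((1 / h) *\<^sub>R (F (t + h) - F t) - F')) \<longlongrightarrow> 0) (at_right 0)"
    by (rule Lim_transform_eventually)
  then show ?thesis
    by (rule LIM_zero_cancel[OF tendsto_norm_zero_cancel])
qed

locale hilbert_semigroup =
  fixes D :: "'h::complex_hilbert set" and A :: "'h \<Rightarrow> 'h" and S :: "real \<Rightarrow> 'h \<Rightarrow> 'h"
  assumes gen: "generates UNIV norm D A S"
begin

sublocale H: C0_semigroup_on_quotient UNIV norm S id 1
  using gen by unfold_locales (auto simp: generates_def intro: norm_triangle_ineq)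

lemma D_eq: "D = {x. \<exists>y. generator_at norm S x y}"
  and A_generator: "x \<in> D \<Longrightarrow> generator_at norm S x (A x)"
  using gen by (auto simp: generates_def)

lemma generator_iff: "generator_at norm S x y \<longleftrightarrow> ((\<lambda>h. (1 / h) *\<^sub>R (S h x - x)) \<longlongrightarrow> y) (at_right 0)"
  by (simp add: generator_at_def tendsto_norm_zero_iff LIM_zero_iff)

lemma A_unique: "generator_at norm S x y \<Longrightarrow> x \<in> D \<and> A x = y"
  using A_generator[of x] D_eq by (auto simp: generator_iff intro: tendsto_unique[OF trivial_limit_at_right_real])

lemma bounded_linear_S: assumes "t \<ge> 0" shows "bounded_linear (S t)"
proof -
  obtain M where "\<And>x. norm (S t x) \<le> M * norm x" using H.S_bounded[OF assms] by auto
  then show ?thesis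
    using assms by (intro bounded_linear_intro[where K = M]) (simp_all add: H.S_add H.S_scaleR mult.commute)
qed

lemma continuous_S: "continuous_on {0..T} (\<lambda>t. S t x)"
  unfolding continuous_on_iff
proof (intro ballI allI impI)
  fix t e :: real assume "t \<in> {0..T}" "0 < e"
  obtain d where "d > 0"
    "\<And>s t. 0 \<le> s \<Longrightarrow> s \<le> T \<Longrightarrow> 0 \<le> t \<Longrightarrow> t \<le> T \<Longrightarrow> \<bar>s - t\<bar> < d \<Longrightarrow> norm (S s x - S t x) < e"
    using H.S_uniformly_continuous[OF UNIV_I \<open>0 < e\<close>, of T x] by metis
  then show "\<exists>d>0. \<forall>x'\<in>{0..T}. dist x' t < d \<longrightarrow> dist (S x' x) (S t x) < e"
    using \<open>t \<in> {0..T}\<close> by (auto simp: dist_norm intro!: exI[of _ d])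
qed

section \<open>Integrated orbits and the density of the domain\<close>

definition orbit_int :: "real \<Rightarrow> 'h \<Rightarrow> 'h"
  where "orbit_int \<tau> x = integral {0..\<tau>} (\<lambda>s. S s x)"

lemma S_integrable: "0 \<le> a \<Longrightarrow> (\<lambda>s. S s x) integrable_on {a..b}"
  by (rule integrable_continuous_real, rule continuous_on_subset[OF continuous_S[of b]]) auto

lemma orbit_int_right_derivative:
  assumes "0 \<le> \<tau>"
  shows "((\<lambda>h. (1 / h) *\<^sub>R (orbit_int (\<tau> + h) x - orbit_int \<tau> x)) \<longlongrightarrow> S \<tau> x) (at_right 0)"
  unfolding orbit_int_def
  using assms integral_has_vector_derivative[OF continuous_S[of "\<tau> + 1" x], of \<tau>]
  by (intro has_vector_derivative_imp_right_difference_quotient[where a = 0 and b = "\<tau> + 1"]) auto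

lemma orbit_int_0: "orbit_int 0 x = 0"
  by (simp add: orbit_int_def)

text \<open>Applying \<open>S h\<close> merely shifts the interval of integration, so the increment
  of an integrated orbit reduces to two short integrals at its ends.\<close>

lemma S_orbit_int:
  assumes "0 \<le> h" "0 \<le> \<tau>"
  shows "S h (orbit_int \<tau> x) = orbit_int (\<tau> + h) x - orbit_int h x"
proof -
  have "S h (orbit_int \<tau> x) = integral {0..\<tau>} (S h \<circ> (\<lambda>s. S s x))"
    unfolding orbit_int_def using integral_linear[OF S_integrable bounded_linear_S, of 0 h] assms by simp
  also have "\<dots> = integral {0..\<tau>} ((\<lambda>s. S s x) \<circ> (+) h)"
    using assms by (intro integral_cong) (simp add: H.S_S)
  also have "\<dots> = integral {h..\<tau> + h} (\<lambda>s. S s x)"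
    by (simp add: integral_shift_Icc_real)
  also have "\<dots> = orbit_int (\<tau> + h) x - orbit_int h x"
    unfolding orbit_int_def
    using Henstock_Kurzweil_Integration.integral_combine[of 0 h "\<tau> + h" "\<lambda>s. S s x"] S_integrable[of 0] assms
    by (simp add: algebra_simps)
  finally show ?thesis .
qed

text \<open>The two short integrals, divided by \<open>h\<close>, tend to \<open>S \<tau> x\<close>
  and \<open>x\<close>; their difference is the value of the generator.\<close>

lemma orbit_int_in_D: assumes "0 \<le> \<tau>" shows "orbit_int \<tau> x \<in> D"
proof -
  have "((\<lambda>h. (1 / h) *\<^sub>R (orbit_int (\<tau> + h) x - orbit_int \<tau> x) - (1 / h) *\<^sub>R (orbit_int (0 + h) x - orbit_int 0 x)) \<longlongrightarrow> S \<tau> x - S 0 x) (at_right 0)"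
    using assms by (intro tendsto_diff orbit_int_right_derivative) auto
  moreover have "eventually (\<lambda>h. (1 / h) *\<^sub>R (orbit_int (\<tau> + h) x - orbit_int \<tau> x) - (1 / h) *\<^sub>R (orbit_int (0 + h) x - orbit_int 0 x)
     = (1 / h) *\<^sub>R (S h (orbit_int \<tau> x) - orbit_int \<tau> x)) (at_right 0)"
    using assms by (intro eventually_at_right_0I[of 1]) (auto simp: S_orbit_int orbit_int_0 algebra_simps)
  ultimately have "generator_at norm S (orbit_int \<tau> x) (S \<tau> x - S 0 x)"
    unfolding generator_iff by (rule Lim_transform_eventually)
  then show ?thesis using A_unique by blast
qed

lemma D_scaleR: assumes "x \<in> D" shows "r *\<^sub>R x \<in> D"
proof -
  have "((\<lambda>h. r *\<^sub>R ((1 / h) *\<^sub>R (S h x - x))) \<longlongrightarrow> r *\<^sub>R A x) (at_right 0)"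
    using A_generator[OF assms] unfolding generator_iff by (intro tendsto_intros)
  moreover have "eventually (\<lambda>h. r *\<^sub>R ((1 / h) *\<^sub>R (S h x - x)) = (1 / h) *\<^sub>R (S h (r *\<^sub>R x) - r *\<^sub>R x)) (at_right 0)"
    by (intro eventually_at_right_0I[of 1]) (auto simp: H.S_scaleR algebra_simps)
  ultimately have "generator_at norm S (r *\<^sub>R x) (r *\<^sub>R A x)"
    unfolding generator_iff by (rule Lim_transform_eventually)
  then show ?thesis using A_unique by blast
qed

lemma D_dense: "closure D = UNIV"
proof -
  have "x \<in> closure D" for x
  proof -
    have "((\<lambda>h. (1 / h) *\<^sub>R orbit_int h x) \<longlongrightarrow> x) (at_right 0)"
      using orbit_int_right_derivative[of 0 x] by (simp add: orbit_int_0 H.S_0)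
    moreover have "eventually (\<lambda>h. (1 / h) *\<^sub>R orbit_int h x \<in> closure D) (at_right 0)"
      by (intro eventually_at_right_0I[of 1] subsetD[OF closure_subset] D_scaleR orbit_int_in_D) auto
    ultimately show ?thesis
      by (intro Lim_in_closed_set[OF closed_closure _ trivial_limit_at_right_real])
  qed
  then show ?thesis by auto
qed

lemma A_S: assumes "x \<in> D" "0 \<le> t" shows "S t x \<in> D \<and> A (S t x) = S t (A x)"
proof -
  have "((\<lambda>h. S t ((1 / h) *\<^sub>R (S h x - x))) \<longlongrightarrow> S t (A x)) (at_right 0)"
    using A_generator[OF assms(1)] unfolding generator_iff
    by (rule bounded_linear.tendsto[OF bounded_linear_S[OF assms(2)]])
  moreover have "eventually (\<lambda>h. S t ((1 / h) *\<^sub>R (S h x - x)) = (1 / h) *\<^sub>R (S h (S t x) - S t x)) (at_right 0)"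
  proof (rule eventually_at_right_0I[of 1])
    fix h :: real assume "0 < h"
    then have "S t (S h x) = S h (S t x)"
      using H.S_S[of t h x] H.S_S[of h t x] assms(2) by (simp add: add.commute)
    then show "S t ((1 / h) *\<^sub>R (S h x - x)) = (1 / h) *\<^sub>R (S h (S t x) - S t x)"
      using assms(2) by (simp add: H.S_scaleR H.S_diff)
  qed simp
  ultimately have "generator_at norm S (S t x) (S t (A x))"
    unfolding generator_iff by (rule Lim_transform_eventually)
  then show ?thesis by (rule A_unique)
qed

lemma S_right_derivative:
  assumes "x \<in> D" "0 \<le> t"
  shows "((\<lambda>h. (1 / h) *\<^sub>R (S (t + h) x - S t x)) \<longlongrightarrow> S t (A x)) (at_right 0)"
proof (rule Lim_transform_eventually)
  show "((\<lambda>h. (1 / h) *\<^sub>R (S h (S t x) - S t x)) \<longlongrightarrow> S t (A x)) (at_right 0)"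
    using A_generator[of "S t x"] A_S[OF assms] by (simp add: generator_iff)
  show "eventually (\<lambda>h. (1 / h) *\<^sub>R (S h (S t x) - S t x) = (1 / h) *\<^sub>R (S (t + h) x - S t x)) (at_right 0)"
    using assms H.S_S[of _ t x] by (intro eventually_at_right_0I[of 1]) (auto simp: add.commute)
qed

text \<open>The difference of the two sides vanishes at time \<open>0\<close> and has right
  derivative zero, and a continuous function of this kind is constant.\<close>

lemma orbit_int_A: assumes "x \<in> D" "0 \<le> \<tau>" shows "orbit_int \<tau> (A x) = S \<tau> x - x"
proof -
  define g where "g = (\<lambda>t. S t x - orbit_int t (A x))"
  have "g \<tau> = g 0"
  proof (rule right_derivative_zero_imp_eq[OF assms(2)])
    show "continuous_on {0..\<tau>} g"
      unfolding g_def orbit_int_def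
      by (intro continuous_on_diff continuous_S indefinite_integral_continuous_1 S_integrable) simp
    show "((\<lambda>h. norm (g (s + h) - g s) / h) \<longlongrightarrow> 0) (at_right 0)" if "0 \<le> s" for s
    proof (rule Lim_transform_eventually)
      have "((\<lambda>h. (1 / h) *\<^sub>R (S (s + h) x - S s x) - (1 / h) *\<^sub>R (orbit_int (s + h) (A x) - orbit_int s (A x))) \<longlongrightarrow> S s (A x) - S s (A x)) (at_right 0)"
        by (intro tendsto_diff S_right_derivative orbit_int_right_derivative assms that)
      then show "((\<lambda>h. norm ((1 / h) *\<^sub>R (S (s + h) x - S s x) - (1 / h) *\<^sub>R (orbit_int (s + h) (A x) - orbit_int s (A x)))) \<longlongrightarrow> 0) (at_right 0)"
        by (simp add: tendsto_norm_zero)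
      show "eventually (\<lambda>h. norm ((1 / h) *\<^sub>R (S (s + h) x - S s x) - (1 / h) *\<^sub>R (orbit_int (s + h) (A x) - orbit_int s (A x)))
        = norm (g (s + h) - g s) / h) (at_right 0)"
      proof (rule eventually_at_right_0I[of 1])
        fix h :: real assume "0 < h"
        have "(1 / h) *\<^sub>R (S (s + h) x - S s x) - (1 / h) *\<^sub>R (orbit_int (s + h) (A x) - orbit_int s (A x)) = (1 / h) *\<^sub>R (g (s + h) - g s)"
          by (simp add: g_def algebra_simps)
        then show "norm ((1 / h) *\<^sub>R (S (s + h) x - S s x) - (1 / h) *\<^sub>R (orbit_int (s + h) (A x) - orbit_int s (A x))) = norm (g (s + h) - g s) / h"
          using \<open>0 < h\<close> by simp
      qed simp
    qed
  qed
  then show ?thesis by (simp add: g_def orbit_int_0 H.S_0 algebra_simps)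
qed

section \<open>The adjoint semigroup and the adjoint of the generator\<close>

definition Sad :: "real \<Rightarrow> 'h \<Rightarrow> 'h"
  where "Sad t y = (SOME z. \<forall>x. cinner (S t x) y = cinner x z)"

lemma cinner_Sad: assumes "0 \<le> t" shows "cinner (S t x) y = cinner x (Sad t y)"
proof -
  obtain M where M: "\<And>x. norm (S t x) \<le> M * norm x" using H.S_bounded[OF assms] by auto
  have "\<exists>z. \<forall>x. cinner (S t x) y = cinner x z"
  proof (rule riesz_complex[where M = "M * norm y"])
    show "cmod (cinner (S t x) y) \<le> M * norm y * norm x" for x
      using order_trans[OF norm_cinner_le mult_right_mono[OF M norm_ge_zero]] by (simp add: ac_simps)
  qed (use assms in \<open>simp_all add: H.S_add H.S_scaleC cinner_add_left cinner_scaleC_left\<close>)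
  from someI_ex[OF this] show ?thesis unfolding Sad_def by blast
qed

lemma Sad_eqI: "0 \<le> t \<Longrightarrow> (\<And>x. cinner (S t x) y = cinner x z) \<Longrightarrow> Sad t y = z"
  by (metis cinner_Sad cinner_eqI_right)

lemma Sad_Sad: "0 \<le> s \<Longrightarrow> 0 \<le> t \<Longrightarrow> Sad (s + t) y = Sad s (Sad t y)"
  by (rule Sad_eqI) (simp_all add: cinner_Sad[symmetric] H.S_S[symmetric] add.commute)

abbreviation "X \<equiv> adj_dom D A"
abbreviation "Ad \<equiv> adj D A"

lemma cinner_eqI_D: assumes "\<And>x. x \<in> D \<Longrightarrow> cinner x y = cinner x z" shows "y = z"
proof (rule cinner_eqI_right)
  fix x
  have "closed {x. cinner x y = cinner x z}"
    by (intro closed_Collect_eq cinner.continuous_on continuous_on_id continuous_on_const)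
  then have "closure D \<subseteq> {x. cinner x y = cinner x z}"
    using assms by (intro closure_minimal) auto
  then show "cinner x y = cinner x z" using D_dense by auto
qed

lemma Ad_eqI: assumes "\<And>x. x \<in> D \<Longrightarrow> cinner (A x) y = cinner x z" shows "y \<in> X \<and> Ad y = z"
proof
  show "y \<in> X" using assms by (auto simp: adj_dom_def)
  show "Ad y = z"
    unfolding adj_def using assms by (intro the_equality) (auto intro: cinner_eqI_D)
qed

lemma cinner_Ad: assumes "y \<in> X" "x \<in> D" shows "cinner (A x) y = cinner x (Ad y)"
proof -
  obtain z where z: "\<And>x. x \<in> D \<Longrightarrow> cinner (A x) y = cinner x z"
    using assms(1) by (auto simp: adj_dom_def)
  with Ad_eqI[OF z] assms show ?thesis by simp
qed

lemma X_add: "y \<in> X \<Longrightarrow> z \<in> X \<Longrightarrow> y + z \<in> X \<and> Ad (y + z) = Ad y + Ad z"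
  by (rule Ad_eqI) (simp add: cinner_add_right cinner_Ad)

lemma X_scaleC: "y \<in> X \<Longrightarrow> c *\<^sub>C y \<in> X \<and> Ad (c *\<^sub>C y) = c *\<^sub>C Ad y"
  by (rule Ad_eqI) (simp add: cinner_scaleC_right cinner_Ad)

lemma X_scaleR: "y \<in> X \<Longrightarrow> c *\<^sub>R y \<in> X \<and> Ad (c *\<^sub>R y) = c *\<^sub>R Ad y"
  by (rule Ad_eqI) (simp add: cinner_scaleR_right cinner_Ad)

lemma X_0: "0 \<in> X \<and> Ad 0 = 0"
  by (rule Ad_eqI) (simp add: cinner.zero_right)

text \<open>Dual to the invariance of \<open>D\<close> under \<open>S t\<close>. It keeps
  \<open>Sad t \<phi>\<close> among the vectors on which elements of \<open>E\<close> act as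
  functionals, so that the semigroup can be moved onto test vectors.\<close>

lemma X_Sad: "y \<in> X \<Longrightarrow> 0 \<le> t \<Longrightarrow> Sad t y \<in> X \<and> Ad (Sad t y) = Sad t (Ad y)"
  by (rule Ad_eqI) (use A_S cinner_Ad in \<open>metis cinner_Sad\<close>)

text \<open>The functionals \<open>x \<mapsto> \<langle>\<integral>\<^sub>0\<^sup>\<tau> S(s) x ds, y\<rangle>\<close> are represented by elements of \<open>dom A\<^sup>*\<close>, since
  \<open>\<integral>\<^sub>0\<^sup>\<tau> S(s) A x ds = S(\<tau>) x - x\<close>. This makes the embedding of \<open>H\<close> injective.\<close>

lemma X_separating: assumes "\<And>y. y \<in> X \<Longrightarrow> cinner x y = 0" shows "x = 0"
proof -
  have "orbit_int \<tau> x = 0" if "0 \<le> \<tau>" for \<tau>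
  proof (rule cinner_eqI)
    fix y
    obtain M where M: "M \<ge> 1" "\<And>t f. 0 \<le> t \<Longrightarrow> t \<le> \<tau> \<Longrightarrow> norm (S t f) \<le> M * norm f"
      using H.S_locally_bounded[where T = \<tau>] by auto
    have bound: "norm (orbit_int \<tau> x) \<le> \<tau> * M * norm x" for x
    proof -
      have "norm (integral {0..\<tau>} (\<lambda>s. S s x)) \<le> (M * norm x) * (\<tau> - 0)"
        using that M by (intro integral_bound continuous_S) auto
      then show ?thesis by (simp add: orbit_int_def ac_simps)
    qed
    have "\<exists>z. \<forall>x. cinner (orbit_int \<tau> x) y = cinner x z"
    proof (rule riesz_complex[where M = "\<tau> * M * norm y"])
      show "cinner (orbit_int \<tau> (u + v)) y = cinner (orbit_int \<tau> u) y + cinner (orbit_int \<tau> v) y" for u v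
      proof -
        have "orbit_int \<tau> (u + v) = integral {0..\<tau>} (\<lambda>s. S s u + S s v)"
          unfolding orbit_int_def by (intro integral_cong) (simp add: H.S_add)
        also have "\<dots> = orbit_int \<tau> u + orbit_int \<tau> v"
          unfolding orbit_int_def by (intro integral_add S_integrable) auto
        finally show ?thesis by (simp add: cinner_add_left)
      qed
      show "cinner (orbit_int \<tau> (c *\<^sub>C u)) y = c * cinner (orbit_int \<tau> u) y" for c u
      proof -
        have "orbit_int \<tau> (c *\<^sub>C u) = integral {0..\<tau>} ((\<lambda>v. c *\<^sub>C v) \<circ> (\<lambda>s. S s u))"
          unfolding orbit_int_def by (intro integral_cong) (simp add: H.S_scaleC)
        also have "\<dots> = c *\<^sub>C orbit_int \<tau> u"
          unfolding orbit_int_def by (intro integral_linear S_integrable bounded_linear_scaleC) auto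
        finally show ?thesis by (simp add: cinner_scaleC_left)
      qed
      show "cmod (cinner (orbit_int \<tau> u) y) \<le> \<tau> * M * norm y * norm u" for u
        using order_trans[OF norm_cinner_le mult_right_mono[OF bound norm_ge_zero]] by (simp add: ac_simps)
    qed
    then obtain z where z: "\<And>x. cinner (orbit_int \<tau> x) y = cinner x z" by blast
    have "z \<in> X \<and> Ad z = Sad \<tau> y - y"
      using that by (intro Ad_eqI)
        (simp add: z[symmetric] orbit_int_A cinner.diff_left cinner.diff_right cinner_Sad)
    then show "cinner (orbit_int \<tau> x) y = cinner 0 y"
      using assms z by (simp add: cinner.zero_left)
  qed
  \<comment> \<open>Differentiating the vanishing integrals at time \<open>0\<close> recovers
    \<open>x\<close>.\<close>
  then have "eventually (\<lambda>h. 0 = (1 / h) *\<^sub>R (orbit_int (0 + h) x - orbit_int 0 x)) (at_right 0)"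
    by (intro eventually_at_right_0I[of 1]) auto
  from Lim_transform_eventually[OF tendsto_const this]
  have "((\<lambda>h. (1 / h) *\<^sub>R (orbit_int (0 + h) x - orbit_int 0 x)) \<longlongrightarrow> 0) (at_right 0)" .
  from tendsto_unique[OF trivial_limit_at_right_real this orbit_int_right_derivative[of 0 x]]
  show ?thesis by (simp add: H.S_0)
qed

end

section \<open>The extrapolation space\<close>

context hilbert_semigroup
begin

abbreviation "E \<equiv> extrap_space D A"
abbreviation "nE \<equiv> extrap_norm D A"
abbreviation "emb \<equiv> embed_H D A"
abbreviation "gn \<equiv> adj_graph_norm D A"

lemma gn_eq: "gn \<phi> = norm (\<phi>, Ad \<phi>)"
  by (simp add: adj_graph_norm_def norm_Pair)

lemma gn_nonneg: "0 \<le> gn \<phi>"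
  by (simp add: gn_eq)

lemma gn_scaleR: "\<phi> \<in> X \<Longrightarrow> gn (r *\<^sub>R \<phi>) = \<bar>r\<bar> * gn \<phi>"
  using norm_scaleR[of r "(\<phi>, Ad \<phi>)"] by (simp add: gn_eq X_scaleR scaleR_Pair)

lemma E_outside: "f \<in> E \<Longrightarrow> \<phi> \<notin> X \<Longrightarrow> f \<phi> = 0"
  and E_add: "f \<in> E \<Longrightarrow> \<phi> \<in> X \<Longrightarrow> \<psi> \<in> X \<Longrightarrow> f (\<phi> + \<psi>) = f \<phi> + f \<psi>"
  and E_scaleC: "f \<in> E \<Longrightarrow> \<phi> \<in> X \<Longrightarrow> f (c *\<^sub>C \<phi>) = cnj c * f \<phi>"
  and E_bounded: "f \<in> E \<Longrightarrow> \<exists>M. \<forall>\<phi>\<in>X. cmod (f \<phi>) \<le> M * gn \<phi>"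
  by (auto simp: extrap_space_def)

lemma E_I:
  assumes "\<And>\<phi>. \<phi> \<notin> X \<Longrightarrow> f \<phi> = 0"
    and "\<And>\<phi> \<psi>. \<phi> \<in> X \<Longrightarrow> \<psi> \<in> X \<Longrightarrow> f (\<phi> + \<psi>) = f \<phi> + f \<psi>"
    and "\<And>c \<phi>. \<phi> \<in> X \<Longrightarrow> f (c *\<^sub>C \<phi>) = cnj c * f \<phi>"
    and "\<And>\<phi>. \<phi> \<in> X \<Longrightarrow> cmod (f \<phi>) \<le> M * gn \<phi>"
  shows "f \<in> E"
  using assms unfolding extrap_space_def by blast

lemma E_scaleR: "f \<in> E \<Longrightarrow> \<phi> \<in> X \<Longrightarrow> f (r *\<^sub>R \<phi>) = r *\<^sub>R f \<phi>"
  using E_scaleC[of f \<phi> "complex_of_real r"] by (simp add: scaleC_of_real scaleR_conv_of_real)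

lemma bdd_above_cmod: assumes "f \<in> E" shows "bdd_above ((\<lambda>\<phi>. cmod (f \<phi>)) ` {\<phi> \<in> X. gn \<phi> \<le> 1})"
proof -
  obtain M where M: "\<And>\<phi>. \<phi> \<in> X \<Longrightarrow> cmod (f \<phi>) \<le> M * gn \<phi>" using E_bounded[OF assms] by blast
  show ?thesis
  proof (rule bdd_aboveI2)
    fix \<phi> assume \<phi>: "\<phi> \<in> {\<phi> \<in> X. gn \<phi> \<le> 1}"
    then have "M * gn \<phi> \<le> \<bar>M\<bar> * 1" by (intro mult_mono gn_nonneg) auto
    then show "cmod (f \<phi>) \<le> \<bar>M\<bar>" using M[of \<phi>] \<phi> by simp
  qed
qed

lemma nE_bound: assumes f: "f \<in> E" and \<phi>: "\<phi> \<in> X" shows "cmod (f \<phi>) \<le> nE f * gn \<phi>"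
proof (cases "gn \<phi> = 0")
  case True
  obtain M where "\<forall>\<phi>\<in>X. cmod (f \<phi>) \<le> M * gn \<phi>" using E_bounded[OF f] by blast
  then show ?thesis using True \<phi> by auto
next
  case False
  then have pos: "gn \<phi> > 0" using gn_nonneg[of \<phi>] by simp
  let ?\<psi> = "(1 / gn \<phi>) *\<^sub>R \<phi>"
  have \<psi>: "?\<psi> \<in> X" "gn ?\<psi> = 1"
    using \<phi> pos by (auto simp: X_scaleR gn_scaleR)
  have "cmod (f ?\<psi>) \<le> nE f"
    unfolding extrap_norm_def using \<psi> bdd_above_cmod[OF f] by (intro cSUP_upper) auto
  then show ?thesis
    using pos by (simp add: E_scaleR[OF f \<phi>] field_simps)
qed

lemma nE_least: assumes "0 \<le> c" and "\<And>\<phi>. \<phi> \<in> X \<Longrightarrow> cmod (f \<phi>) \<le> c * gn \<phi>" shows "nE f \<le> c"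
  unfolding extrap_norm_def
proof (rule cSUP_least)
  have "0 \<in> {\<phi> \<in> X. gn \<phi> \<le> 1}" using X_0 by (auto simp: gn_eq)
  then show "{\<phi> \<in> X. gn \<phi> \<le> 1} \<noteq> {}" by blast
  show "cmod (f \<phi>) \<le> c" if "\<phi> \<in> {\<phi> \<in> X. gn \<phi> \<le> 1}" for \<phi>
    using assms(2)[of \<phi>] mult_left_mono[of "gn \<phi>" 1 c] assms(1) that by auto
qed

lemma nE_nonneg: assumes "f \<in> E" shows "0 \<le> nE f"
proof -
  have "cmod (f 0) \<le> nE f"
    unfolding extrap_norm_def using X_0 bdd_above_cmod[OF assms] by (intro cSUP_upper) (auto simp: gn_eq)
  then show ?thesis by (rule order_trans[OF norm_ge_zero])
qed

lemma E_plus: "f \<in> E \<Longrightarrow> g \<in> E \<Longrightarrow> f + g \<in> E"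
proof (rule E_I[where M = "nE f + nE g"])
  fix \<phi> assume "f \<in> E" "g \<in> E" "\<phi> \<in> X"
  then show "cmod ((f + g) \<phi>) \<le> (nE f + nE g) * gn \<phi>"
    using norm_triangle_ineq[of "f \<phi>" "g \<phi>"] nE_bound[of f \<phi>] nE_bound[of g \<phi>]
    by (simp add: algebra_simps)
qed (simp_all add: E_outside E_add E_scaleC algebra_simps)

lemma E_scaleC_mem: assumes f: "f \<in> E" shows "c *\<^sub>C f \<in> E"
proof (rule E_I[where M = "cmod c * nE f"])
  show "cmod ((c *\<^sub>C f) \<phi>) \<le> cmod c * nE f * gn \<phi>" if "\<phi> \<in> X" for \<phi>
    using mult_left_mono[OF nE_bound[OF f that], of "cmod c"]
    by (simp add: scaleC_fun_def scaleC_complex_def norm_mult mult.assoc)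
qed (simp_all add: f E_outside E_add E_scaleC scaleC_fun_def scaleC_complex_def algebra_simps)

lemma E_0: "0 \<in> E"
  by (rule E_I[where M = 0]) auto

lemma subspace_E: "subspace E"
  unfolding subspace_def
  using E_0 E_plus E_scaleC_mem[of _ "complex_of_real _"] by (auto simp: scaleC_of_real)

lemma E_diff: "f \<in> E \<Longrightarrow> g \<in> E \<Longrightarrow> f - g \<in> E"
  using subspace_E by (rule subspace_diff)

lemma E_eqI: assumes "f \<in> E" "g \<in> E" "\<And>\<phi>. \<phi> \<in> X \<Longrightarrow> f \<phi> = g \<phi>" shows "f = g"
  using assms E_outside by (metis ext)

lemma emb_apply: "\<phi> \<in> X \<Longrightarrow> emb x \<phi> = cinner x \<phi>"
  by (simp add: embed_H_def)

text \<open>\<open>J (x, y)\<close> is \<open>x\<close> plus the extended generator applied to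
  \<open>y\<close>. It presents \<open>E\<close> as a quotient of the Hilbert space
  \<open>H \<times> H\<close>, which is a type and hence open to uniform boundedness.\<close>

definition J :: "'h \<times> 'h \<Rightarrow> 'h \<Rightarrow> complex"
  where "J p = (\<lambda>\<phi>. if \<phi> \<in> X then cinner (fst p) \<phi> + cinner (snd p) (Ad \<phi>) else 0)"

lemma cmod_J_le: assumes "\<phi> \<in> X" shows "cmod (J p \<phi>) \<le> norm p * gn \<phi>"
proof -
  have "cmod (J p \<phi>) \<le> norm (fst p) * norm \<phi> + norm (snd p) * norm (Ad \<phi>)"
    using assms order_trans[OF norm_triangle_ineq add_mono[OF norm_cinner_le norm_cinner_le]]
    by (simp add: J_def)
  also have "\<dots> = inner (norm (fst p), norm (snd p)) (norm \<phi>, norm (Ad \<phi>))"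
    by simp
  also have "\<dots> \<le> norm (norm (fst p), norm (snd p)) * norm (norm \<phi>, norm (Ad \<phi>))"
    by (rule norm_cauchy_schwarz)
  also have "\<dots> = norm p * gn \<phi>"
    by (simp add: gn_eq norm_Pair norm_prod_def)
  finally show ?thesis .
qed

lemma J_in_E: "J p \<in> E"
proof (rule E_I[where M = "norm p"])
qed (simp_all add: cmod_J_le, simp_all add: J_def X_add X_scaleC cinner_add_right cinner_scaleC_right algebra_simps)

lemma nE_J_le: "nE (J p) \<le> norm p"
  by (rule nE_least) (simp_all add: cmod_J_le)

lemma J_add: "J (p + q) = J p + J q"
  by (auto simp: J_def cinner_add_left algebra_simps)

lemma J_scaleR: "J (r *\<^sub>R p) = r *\<^sub>R J p"
  by (auto simp: J_def cinner_scaleR_left scaleR_fun_def algebra_simps)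

lemma emb_eq_J: "emb x = J (x, 0)"
  by (auto simp: J_def embed_H_def cinner.zero_left)

lemma emb_add: "emb (x + y) = emb x + emb y"
  using J_add[of "(x, 0)" "(y, 0)"] by (simp add: emb_eq_J)

lemma emb_scaleR: "emb (r *\<^sub>R x) = r *\<^sub>R emb x"
  using J_scaleR[of r "(x, 0)"] by (simp add: emb_eq_J)

lemma emb_scaleC: "emb (c *\<^sub>C x) = c *\<^sub>C emb x"
  by (auto simp: embed_H_def scaleC_fun_def cinner_scaleC_left scaleC_complex_def)

lemma emb_diff: "emb (x - y) = emb x - emb y"
  using emb_add[of "x - y" y] by simp

lemma emb_0: "emb 0 = 0"
  using emb_diff[of 0 0] by simp

lemma emb_in_E: "emb x \<in> E"
  by (simp add: emb_eq_J J_in_E)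

lemma nE_emb_le: "nE (emb x) \<le> norm x"
  using nE_J_le[of "(x, 0)"] by (simp add: emb_eq_J norm_Pair)

lemma inj_emb: "inj emb"
proof (rule injI)
  fix x y assume "emb x = emb y"
  then have "cinner (x - y) \<phi> = 0" if "\<phi> \<in> X" for \<phi>
    using fun_cong[of "emb x" "emb y" \<phi>] emb_apply[OF that, of x] emb_apply[OF that, of y]
    by (simp add: cinner.diff_left)
  then show "x = y" using X_separating[of "x - y"] by simp
qed

lemma inv_emb: "inv emb (emb x) = x"
  using inj_emb by (rule inv_f_f)

text \<open>For each \<open>x\<close> in \<open>D\<close> the adjoint relation is a closed condition
  on the pair, and the graph is the set of pairs that meet all of them.\<close>

lemma adjoint_graph_closed_subspace:
  "closed ((\<lambda>\<phi>. (\<phi>, Ad \<phi>)) ` X) \<and> subspace ((\<lambda>\<phi>. (\<phi>, Ad \<phi>)) ` X)"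
proof
  have "(\<lambda>\<phi>. (\<phi>, Ad \<phi>)) ` X = (\<Inter>x\<in>D. {p. cinner (A x) (fst p) = cinner x (snd p)})"
  proof (intro set_eqI iffI)
    fix p assume "p \<in> (\<Inter>x\<in>D. {p. cinner (A x) (fst p) = cinner x (snd p)})"
    then have "fst p \<in> X \<and> Ad (fst p) = snd p" by (intro Ad_eqI) auto
    then show "p \<in> (\<lambda>\<phi>. (\<phi>, Ad \<phi>)) ` X" by (intro image_eqI[of _ _ "fst p"]) auto
  qed (auto simp: cinner_Ad)
  also have "closed \<dots>"
    by (intro closed_INT ballI closed_Collect_eq cinner.continuous_on continuous_intros)
  finally show "closed ((\<lambda>\<phi>. (\<phi>, Ad \<phi>)) ` X)" .
  show "subspace ((\<lambda>\<phi>. (\<phi>, Ad \<phi>)) ` X)"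
    unfolding subspace_def
  proof (intro conjI ballI allI)
    show "0 \<in> (\<lambda>\<phi>. (\<phi>, Ad \<phi>)) ` X" using X_0 by (intro image_eqI[of _ _ 0]) (auto simp: zero_prod_def)
    fix p q assume "p \<in> (\<lambda>\<phi>. (\<phi>, Ad \<phi>)) ` X" "q \<in> (\<lambda>\<phi>. (\<phi>, Ad \<phi>)) ` X"
    then show "p + q \<in> (\<lambda>\<phi>. (\<phi>, Ad \<phi>)) ` X"
      by (intro image_eqI[of _ _ "fst p + fst q"]) (auto simp: X_add)
  next
    fix r p assume "p \<in> (\<lambda>\<phi>. (\<phi>, Ad \<phi>)) ` X"
    then show "r *\<^sub>R p \<in> (\<lambda>\<phi>. (\<phi>, Ad \<phi>)) ` X"
      by (intro image_eqI[of _ _ "r *\<^sub>R fst p"]) (auto simp: X_scaleR)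
  qed
qed

text \<open>Riesz representation on the graph of \<open>A\<^sup>*\<close>, a closed subspace of \<open>H \<times> H\<close>.\<close>

lemma J_onto: assumes f: "f \<in> E" shows "\<exists>p. J p = f \<and> norm p \<le> 1 * nE f"
proof -
  let ?V = "(\<lambda>\<phi>. (\<phi>, Ad \<phi>)) ` X"
  have "\<exists>p\<in>?V. \<forall>q\<in>?V. Re (f (fst q)) = inner q p"
  proof (rule riesz_closed_subspace[where M = "nE f"])
    show "\<bar>Re (f (fst q))\<bar> \<le> nE f * norm q" if "q \<in> ?V" for q
      using that order_trans[OF abs_Re_le_cmod nE_bound[OF f]] by (auto simp: gn_eq)
  qed (use adjoint_graph_closed_subspace in \<open>auto simp: E_add[OF f] E_scaleR[OF f]\<close>)
  then obtain a where a: "a \<in> X" and *: "\<And>\<phi>. \<phi> \<in> X \<Longrightarrow> Re (f \<phi>) = inner (\<phi>, Ad \<phi>) (a, Ad a)"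
    by auto
  have Re: "Re (f \<phi>) = Re (J (a, Ad a) \<phi>)" if "\<phi> \<in> X" for \<phi>
    using *[OF that] that by (simp add: J_def inner_eq_Re_cinner[symmetric] inner_commute)
  have "f \<phi> = J (a, Ad a) \<phi>" if "\<phi> \<in> X" for \<phi>
  proof (rule complex_eqI[OF Re[OF that]])
    \<comment> \<open>Both functionals are conjugate linear, so their real parts at
      \<open>\<i> \<phi>\<close> are their imaginary parts at \<open>\<phi>\<close>.\<close>
    show "Im (f \<phi>) = Im (J (a, Ad a) \<phi>)"
      using Re[of "\<i> *\<^sub>C \<phi>"] X_scaleC[OF that, of \<i>]
      by (simp add: E_scaleC f J_in_E that)
  qed
  then have J: "J (a, Ad a) = f" using f by (intro E_eqI J_in_E) auto
  \<comment> \<open>The functional evaluated at its own representing vector gives the square of the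
    norm, hence the bound by \<open>nE f\<close>.\<close>
  have "(norm (a, Ad a))\<^sup>2 = Re (f a)"
    using *[OF a] by (simp only: power2_norm_eq_inner)
  also have "\<dots> \<le> nE f * norm (a, Ad a)"
    using order_trans[OF complex_Re_le_cmod nE_bound[OF f a]] by (simp add: gn_eq)
  finally have "norm (a, Ad a) \<le> nE f"
    using nE_nonneg[OF f] by (cases "norm (a, Ad a) = 0") (simp_all only: power2_eq_square mult_le_cancel_right, auto)
  then show ?thesis using J by auto
qed

lemma nE_triangle: "f \<in> E \<Longrightarrow> g \<in> E \<Longrightarrow> nE (f + g) \<le> nE f + nE g"
  using norm_triangle_ineq[of "f _" "g _"] nE_bound[of f] nE_bound[of g]
  by (intro nE_least) (auto simp: nE_nonneg algebra_simps intro: order_trans[OF norm_triangle_ineq add_mono])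

lemma nE_scaleR: assumes f: "f \<in> E" shows "nE (r *\<^sub>R f) = \<bar>r\<bar> * nE f"
proof (cases "r = 0")
  case True
  then show ?thesis using nE_least[of 0 0] nE_nonneg[OF E_0] by (simp add: zero_fun_def)
next
  case False
  have *: "nE (r *\<^sub>R f) \<le> \<bar>r\<bar> * nE f" if f: "f \<in> E" for r f
    using nE_bound[OF f] nE_nonneg[OF f]
    by (intro nE_least) (auto simp: scaleR_fun_def mult.assoc intro!: mult_left_mono)
  have "nE f \<le> \<bar>1 / r\<bar> * nE (r *\<^sub>R f)"
    using *[of "r *\<^sub>R f" "1 / r"] subspace_scale[OF subspace_E f, of r] False by simp
  then show ?thesis using *[OF f, of r] False by (simp add: field_simps)
qed

end

section \<open>Agreement and duality of the two semigroups\<close>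

locale extended_semigroup = hilbert_semigroup D A S
  for D :: "'h::complex_hilbert set" and A S +
  fixes SE :: "real \<Rightarrow> ('h \<Rightarrow> complex) \<Rightarrow> ('h \<Rightarrow> complex)"
  assumes genE: "generates (extrap_space D A) (extrap_norm D A) (range (embed_H D A)) (extrap_op D A) SE"
begin

sublocale E: C0_semigroup_on_quotient E nE SE J 1
  using genE
  by unfold_locales (auto simp: generates_def subspace_E nE_triangle nE_scaleR J_in_E J_add J_scaleR nE_J_le
      simp del: split_paired_Ex dest!: J_onto)

text \<open>The extended generator acts on the embedded \<open>x\<close> as the embedded
  \<open>A x\<close>, so the two semigroups have the same first-order behaviour at
  \<open>0\<close>.\<close>

lemma SE_emb_difference:
  "x \<in> D \<Longrightarrow> ((\<lambda>h. nE ((1 / h) *\<^sub>R (emb (S h x) - SE h (emb x)))) \<longlongrightarrow> 0) (at_right 0)"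
proof -
  assume x: "x \<in> D"
  have op: "extrap_op D A (emb x) = emb (A x)"
    using x by (auto simp: extrap_op_def embed_H_def[of D A "A x"] inv_emb cinner_Ad)
  have 1: "((\<lambda>h. nE ((1 / h) *\<^sub>R (SE h (emb x) - emb x) - emb (A x))) \<longlongrightarrow> 0) (at_right 0)"
    using genE by (simp add: generates_def generator_at_def flip: op)
  have 2: "((\<lambda>h. norm ((1 / h) *\<^sub>R (S h x - x) - A x)) \<longlongrightarrow> 0) (at_right 0)"
    using A_generator[OF x] by (simp add: generator_at_def)
  show ?thesis
  proof (rule tendsto_sandwich[OF _ _ tendsto_const])
    show "((\<lambda>h. norm ((1 / h) *\<^sub>R (S h x - x) - A x) + nE ((1 / h) *\<^sub>R (SE h (emb x) - emb x) - emb (A x))) \<longlongrightarrow> 0) (at_right 0)"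
      using tendsto_add[OF 2 1] by simp
    show "eventually (\<lambda>h. 0 \<le> nE ((1 / h) *\<^sub>R (emb (S h x) - SE h (emb x)))) (at_right 0)"
      by (intro eventually_at_right_0I[of 1] nE_nonneg subspace_scale[OF subspace_E] E_diff emb_in_E E.S_mem) auto
    show "eventually (\<lambda>h. nE ((1 / h) *\<^sub>R (emb (S h x) - SE h (emb x)))
      \<le> norm ((1 / h) *\<^sub>R (S h x - x) - A x) + nE ((1 / h) *\<^sub>R (SE h (emb x) - emb x) - emb (A x))) (at_right 0)"
    proof (rule eventually_at_right_0I[of 1])
      fix h :: real assume h: "0 < h"
      let ?u = "(1 / h) *\<^sub>R (S h x - x) - A x" and ?v = "(1 / h) *\<^sub>R (SE h (emb x) - emb x) - emb (A x)"
      have v: "?v \<in> E"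
        using h by (intro E_diff subspace_scale[OF subspace_E] emb_in_E E.S_mem) auto
      have eq: "(1 / h) *\<^sub>R (emb (S h x) - SE h (emb x)) = emb ?u + (- ?v)"
        by (simp add: emb_diff emb_add emb_scaleR algebra_simps)
      show "nE ((1 / h) *\<^sub>R (emb (S h x) - SE h (emb x))) \<le> norm ?u + nE ?v"
        unfolding eq
        using nE_triangle[OF emb_in_E subspace_neg[OF subspace_E v], of ?u] nE_emb_le[of ?u] E.nV_minus[OF v]
        by linarith
    qed simp
  qed
qed

text \<open>\<open>s \<mapsto> SE (t - s) (S(s) x)\<close> has right derivative zero, because both semigroups have the same generator on \<open>D\<close>.\<close>

lemma SE_emb_D: assumes x: "x \<in> D" and t: "0 \<le> t" shows "SE t (emb x) = emb (S t x)"
proof (rule E_eqI)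
  fix \<phi> assume \<phi>: "\<phi> \<in> X"
  obtain M where M: "M \<ge> 1" "\<And>s f. 0 \<le> s \<Longrightarrow> s \<le> t \<Longrightarrow> f \<in> E \<Longrightarrow> nE (SE s f) \<le> M * nE f"
    using E.S_locally_bounded[where T = t] by blast
  define g where "g = (\<lambda>s. SE (t - s) (emb (S s x)) \<phi>)"
  have "g t = g 0"
  proof (rule right_derivative_zero_imp_eq[OF t])
    show "continuous_on {0..t} g"
      unfolding continuous_on_def
    proof
      fix s0 assume s0: "s0 \<in> {0..t}"
      let ?f = "emb (S s0 x)"
      have 1: "((\<lambda>s. nE (SE (t - s) ?f - SE (t - s0) ?f)) \<longlongrightarrow> 0) (at s0 within {0..t})"
      proof (rule tendstoI)
        fix e :: real assume e: "0 < e"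
        obtain d where "d > 0"
          and d: "\<And>s t'. 0 \<le> s \<Longrightarrow> s \<le> t \<Longrightarrow> 0 \<le> t' \<Longrightarrow> t' \<le> t \<Longrightarrow> \<bar>s - t'\<bar> < d \<Longrightarrow> nE (SE s ?f - SE t' ?f) < e"
          using E.S_uniformly_continuous[OF emb_in_E e, where T = t] by metis
        show "eventually (\<lambda>s. dist (nE (SE (t - s) ?f - SE (t - s0) ?f)) 0 < e) (at s0 within {0..t})"
          unfolding eventually_at
        proof (intro exI[of _ d] conjI ballI impI \<open>d > 0\<close>)
          fix s assume "s \<in> {0..t}" "s \<noteq> s0 \<and> dist s s0 < d"
          then show "dist (nE (SE (t - s) ?f - SE (t - s0) ?f)) 0 < e"
            using d[of "t - s" "t - s0"] s0 nE_nonneg[of "SE (t - s) ?f - SE (t - s0) ?f"]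
            by (auto simp: dist_real_def E_diff E.S_mem emb_in_E abs_minus_commute)
        qed
      qed
      have 2: "((\<lambda>s. norm (S s x - S s0 x)) \<longlongrightarrow> 0) (at s0 within {0..t})"
        using continuous_S[of t x] s0 by (simp add: continuous_on_def tendsto_norm_zero_iff LIM_zero_iff)
      have "((\<lambda>s. g s - g s0) \<longlongrightarrow> 0) (at s0 within {0..t})"
      proof (rule Lim_null_comparison)
        show "((\<lambda>s. (nE (SE (t - s) ?f - SE (t - s0) ?f) + M * norm (S s x - S s0 x)) * gn \<phi>) \<longlongrightarrow> 0) (at s0 within {0..t})"
          using tendsto_mult[OF tendsto_add[OF 1 tendsto_mult[OF tendsto_const[of M] 2]] tendsto_const[of "gn \<phi>"]] by simp
        show "eventually (\<lambda>s. norm (g s - g s0) \<le> (nE (SE (t - s) ?f - SE (t - s0) ?f) + M * norm (S s x - S s0 x)) * gn \<phi>) (at s0 within {0..t})"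
          unfolding eventually_at
        proof (intro exI[of _ 1] conjI ballI impI zero_less_one)
          fix s assume s: "s \<in> {0..t}"
          \<comment> \<open>The increment splits into the same vector at two times, governed by
            strong continuity, and the change of the vector at one time, governed by the local
            bound.\<close>
          let ?a = "SE (t - s) ?f - SE (t - s0) ?f" and ?b = "SE (t - s) (emb (S s x - S s0 x))"
          have E: "?a \<in> E" "?b \<in> E" using s s0 by (auto intro!: E_diff E.S_mem emb_in_E)
          have "nE ?b \<le> M * norm (S s x - S s0 x)"
            using M(2)[of "t - s" "emb (S s x - S s0 x)"] s M(1) emb_in_E
              order_trans[OF _ mult_left_mono[OF nE_emb_le, of M]] by force
          then have "nE (?a + ?b) \<le> nE ?a + M * norm (S s x - S s0 x)"
            using nE_triangle[OF E] by simp
          then have "nE (?a + ?b) * gn \<phi> \<le> (nE ?a + M * norm (S s x - S s0 x)) * gn \<phi>"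
            by (intro mult_right_mono gn_nonneg)
          moreover have "g s - g s0 = (?a + ?b) \<phi>"
            using s s0 by (simp add: g_def emb_diff E.S_diff emb_in_E)
          ultimately show "norm (g s - g s0) \<le> (nE ?a + M * norm (S s x - S s0 x)) * gn \<phi>"
            using nE_bound[OF E_plus[OF E] \<phi>] by simp
        qed
      qed
      then show "(g \<longlongrightarrow> g s0) (at s0 within {0..t})"
        by (rule LIM_zero_cancel)
    qed
    fix s assume s: "0 \<le> s" "s < t"
    let ?y = "S s x"
    let ?r = "\<lambda>h. (1 / h) *\<^sub>R (emb (S h ?y) - SE h (emb ?y))"
    show "((\<lambda>h. norm (g (s + h) - g s) / h) \<longlongrightarrow> 0) (at_right 0)"
    proof (rule tendsto_sandwich[OF _ _ tendsto_const])
      show "((\<lambda>h. M * nE (?r h) * gn \<phi>) \<longlongrightarrow> 0) (at_right 0)"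
        using tendsto_mult[OF tendsto_mult[OF tendsto_const[of M] SE_emb_difference[of ?y]] tendsto_const[of "gn \<phi>"]]
          A_S[OF x s(1)] by simp
      show "eventually (\<lambda>h. 0 \<le> norm (g (s + h) - g s) / h) (at_right 0)"
        by (intro eventually_at_right_0I[of 1]) auto
      show "eventually (\<lambda>h. norm (g (s + h) - g s) / h \<le> M * nE (?r h) * gn \<phi>) (at_right 0)"
      proof (rule eventually_at_right_0I[of "t - s"])
        fix h assume h: "0 < h" "h < t - s"
        have E: "?r h \<in> E" "emb (S h ?y) - SE h (emb ?y) \<in> E"
          using h by (auto intro!: subspace_scale[OF subspace_E] E_diff E.S_mem emb_in_E)
        \<comment> \<open>Splitting off the common factor \<open>SE (t - s - h)\<close> leaves the
          first-order defect of the two semigroups at \<open>S s x\<close>, a point that is still in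
          \<open>D\<close>.\<close>
        have "SE (t - s) (emb ?y) = SE (t - s - h) (SE h (emb ?y))"
          using E.S_S[of "t - s - h" h "emb ?y"] h by (simp add: emb_in_E)
        moreover have "S (s + h) x = S h ?y"
          using H.S_S[of h s x] h s by (simp add: add.commute)
        ultimately have "g (s + h) - g s = (SE (t - s - h) (emb (S h ?y) - SE h (emb ?y))) \<phi>"
          using h by (simp add: g_def E.S_diff emb_in_E E.S_mem diff_diff_add)
        then have "(1 / h) *\<^sub>R (g (s + h) - g s) = (SE (t - s - h) (?r h)) \<phi>"
          using h E(2) E.S_scaleR[of "t - s - h" "emb (S h ?y) - SE h (emb ?y)" "1 / h"]
            fun_cong[of "SE (t - s - h) (?r h)" _ \<phi>] by (simp only: scaleR_fun_def)
        then have "norm ((1 / h) *\<^sub>R (g (s + h) - g s)) = cmod ((SE (t - s - h) (?r h)) \<phi>)"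
          by (rule arg_cong)
        then have "norm (g (s + h) - g s) / h = cmod ((SE (t - s - h) (?r h)) \<phi>)"
          using h unfolding norm_scaleR by simp
        also have "\<dots> \<le> nE (SE (t - s - h) (?r h)) * gn \<phi>"
          using h E by (intro nE_bound E.S_mem \<phi>) auto
        also have "\<dots> \<le> M * nE (?r h) * gn \<phi>"
          using h s E by (intro mult_right_mono M gn_nonneg) auto
        finally show "norm (g (s + h) - g s) / h \<le> M * nE (?r h) * gn \<phi>" .
      qed (use s in simp)
    qed
  qed
  then show "SE t (emb x) \<phi> = emb (S t x) \<phi>"
    by (simp add: g_def H.S_0 E.S_0 emb_in_E)
qed (use t in \<open>simp_all add: E.S_mem emb_in_E\<close>)

lemma D_approx: assumes "e > 0" obtains d where "d \<in> D" "norm (x - d) < e"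
  using assms D_dense closure_approachable[of x D] by (auto simp: dist_norm norm_minus_commute)

text \<open>Both sides depend continuously on \<open>x\<close>, and \<open>D\<close> is
  dense.\<close>

lemma SE_emb: assumes t: "0 \<le> t" shows "SE t (emb x) = emb (S t x)"
proof (rule E_eqI)
  fix \<phi> assume \<phi>: "\<phi> \<in> X"
  obtain M where M: "M \<ge> 1" "\<And>s f. 0 \<le> s \<Longrightarrow> s \<le> t \<Longrightarrow> f \<in> E \<Longrightarrow> nE (SE s f) \<le> M * nE f"
    using E.S_locally_bounded[where T = t] by blast
  obtain N where N: "N \<ge> 1" "\<And>s f. 0 \<le> s \<Longrightarrow> s \<le> t \<Longrightarrow> norm (S s f) \<le> N * norm f"
    using H.S_locally_bounded[where T = t] by auto
  define C where "C = (M + N) * gn \<phi>"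
  have "C \<ge> 0" using M N gn_nonneg by (simp add: C_def)
  have "cmod (SE t (emb x) \<phi> - emb (S t x) \<phi>) \<le> 0 + e" if e: "e > 0" for e
  proof -
    obtain d where d: "d \<in> D" "norm (x - d) < e / (C + 1)"
      using D_approx[of "e / (C + 1)" x] e \<open>C \<ge> 0\<close> by auto
    let ?a = "SE t (emb (x - d))" and ?b = "emb (S t (x - d))"
    have E: "?a \<in> E" "?b \<in> E" using t by (auto intro: E.S_mem emb_in_E)
    have "SE t (emb x) \<phi> - emb (S t x) \<phi> = ?a \<phi> - ?b \<phi>"
      using SE_emb_D[OF d(1) t] t by (simp add: emb_diff E.S_diff H.S_diff emb_in_E)
    also have "cmod \<dots> \<le> cmod (?a \<phi>) + cmod (?b \<phi>)" by (rule norm_triangle_ineq4)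
    also have "\<dots> \<le> nE ?a * gn \<phi> + nE ?b * gn \<phi>"
      by (intro add_mono nE_bound E \<phi>)
    also have "\<dots> \<le> (M * norm (x - d)) * gn \<phi> + (N * norm (x - d)) * gn \<phi>"
    proof (intro add_mono mult_right_mono gn_nonneg)
      show "nE ?a \<le> M * norm (x - d)"
        using M(2)[of t, OF t order_refl emb_in_E[of "x - d"]] mult_left_mono[OF nE_emb_le[of "x - d"], of M] M(1) by linarith
      show "nE ?b \<le> N * norm (x - d)"
        using order_trans[OF nE_emb_le N(2)[OF t order_refl]] .
    qed
    also have "\<dots> = C * norm (x - d)" by (simp add: C_def algebra_simps)
    also have "\<dots> \<le> C * (e / (C + 1))" using d \<open>C \<ge> 0\<close> by (intro mult_left_mono) auto
    also have "\<dots> \<le> e" using \<open>C \<ge> 0\<close> e by (simp add: field_simps)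
    finally show ?thesis by simp
  qed
  then show "SE t (emb x) \<phi> = emb (S t x) \<phi>"
    using field_le_epsilon[of "cmod (SE t (emb x) \<phi> - emb (S t x) \<phi>)" 0] by simp
qed (use t in \<open>simp_all add: E.S_mem emb_in_E\<close>)

text \<open>By density: on \<open>J (a, d)\<close> with \<open>d \<in> D\<close>, which is the embedding of \<open>a + A d\<close>, the claim is \<open>SE_emb\<close>.\<close>

theorem SE_apply: assumes t: "0 \<le> t" and f: "f \<in> E" and \<phi>: "\<phi> \<in> X" shows "SE t f \<phi> = f (Sad t \<phi>)"
proof -
  obtain a b where ab: "f = J (a, b)" using J_onto[OF f] by (metis surj_pair)
  obtain M where M: "M \<ge> 1" "\<And>s f. 0 \<le> s \<Longrightarrow> s \<le> t \<Longrightarrow> f \<in> E \<Longrightarrow> nE (SE s f) \<le> M * nE f"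
    using E.S_locally_bounded[where T = t] by blast
  define C where "C = M * gn \<phi> + gn (Sad t \<phi>)"
  have "C \<ge> 0" using M gn_nonneg by (simp add: C_def)
  have "cmod (SE t f \<phi> - f (Sad t \<phi>)) \<le> 0 + e" if e: "e > 0" for e
  proof -
    obtain d where d: "d \<in> D" "norm (b - d) < e / (C + 1)"
      using D_approx[of "e / (C + 1)" b] e \<open>C \<ge> 0\<close> by auto
    \<comment> \<open>The part of \<open>f\<close> that remains after splitting off an embedded
      vector. It is at most \<open>norm (b - d)\<close> in \<open>nE\<close>, and both sides of the
      identity are continuous in \<open>nE\<close>.\<close>
    let ?g = "J (0, b - d)"
    have Jd: "J (a, d) = emb (a + A d)"
      using d(1) by (auto simp: J_def embed_H_def cinner_Ad cinner_add_left)
    have "f = emb (a + A d) + ?g"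
      unfolding ab Jd[symmetric] J_add[symmetric] by simp
    then have "SE t f \<phi> - f (Sad t \<phi>) = SE t ?g \<phi> - ?g (Sad t \<phi>)"
      using t \<phi> X_Sad[OF \<phi> t] by (simp add: E.S_add emb_in_E J_in_E SE_emb emb_apply cinner_Sad)
    also have "cmod \<dots> \<le> cmod (SE t ?g \<phi>) + cmod (?g (Sad t \<phi>))" by (rule norm_triangle_ineq4)
    also have "\<dots> \<le> nE (SE t ?g) * gn \<phi> + nE ?g * gn (Sad t \<phi>)"
      using t X_Sad[OF \<phi> t] by (intro add_mono nE_bound E.S_mem J_in_E \<phi>) auto
    also have "\<dots> \<le> (M * norm (b - d)) * gn \<phi> + norm (b - d) * gn (Sad t \<phi>)"
    proof (intro add_mono mult_right_mono gn_nonneg)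
      have *: "nE ?g \<le> norm (b - d)" using nE_J_le[of "(0, b - d)"] by (simp add: norm_Pair)
      show "nE (SE t ?g) \<le> M * norm (b - d)"
        using M(2)[of t, OF t order_refl J_in_E[of "(0, b - d)"]] mult_left_mono[OF *, of M] M(1) by linarith
      show "nE ?g \<le> norm (b - d)" by (rule *)
    qed
    also have "\<dots> = C * norm (b - d)" by (simp add: C_def algebra_simps)
    also have "\<dots> \<le> C * (e / (C + 1))" using d \<open>C \<ge> 0\<close> by (intro mult_left_mono) auto
    also have "\<dots> \<le> e" using \<open>C \<ge> 0\<close> e by (simp add: field_simps)
    finally show ?thesis by simp
  qed
  then show ?thesis
    using field_le_epsilon[of "cmod (SE t f \<phi> - f (Sad t \<phi>))" 0] by simp
qed

end

section \<open>Strong measurability and Bochner integrals\<close>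

lemma (in complete_measure) borel_measurable_AE_eq:
  fixes f :: "'a \<Rightarrow> 'b::topological_space"
  assumes f: "f \<in> borel_measurable M" and eq: "AE x in M. f x = g x"
  shows "g \<in> borel_measurable M"
proof (rule measurableI)
  fix B :: "'b set" assume B: "B \<in> sets borel"
  show "g -` B \<inter> space M \<in> sets M"
  proof (rule in_sets_AE)
    show "AE x in M. x \<in> f -` B \<inter> space M \<longleftrightarrow> x \<in> g -` B \<inter> space M"
      using eq by eventually_elim auto
    show "f -` B \<inter> space M \<in> sets M" using f B by (rule measurable_sets)
  qed auto
qed simp

lemma (in complete_measure) borel_measurable_AE_limit:
  fixes f :: "nat \<Rightarrow> 'a \<Rightarrow> 'b::{banach, second_countable_topology}"
  assumes f: "\<And>i. f i \<in> borel_measurable M" and lim: "AE x in M. (\<lambda>i. f i x) \<longlonglongrightarrow> g x"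
  shows "g \<in> borel_measurable M"
proof (rule borel_measurable_AE_eq)
  show "(\<lambda>x. lim (\<lambda>i. f i x)) \<in> borel_measurable M"
    using f by (rule borel_measurable_lim_metric)
  show "AE x in M. lim (\<lambda>i. f i x) = g x"
    using lim by eventually_elim (rule limI)
qed

lemma complete_measure_lebesgue_on:
  assumes "S \<in> sets lebesgue" shows "complete_measure (lebesgue_on S)"
proof
  fix A B assume "B \<subseteq> A" "A \<in> null_sets (lebesgue_on S)"
  then have "B \<subseteq> S" "B \<in> null_sets lebesgue"
    using assms completion.complete2[of B A] by (auto simp: null_sets_restrict_space)
  then show "B \<in> sets (lebesgue_on S)"
    using assms by (auto simp: sets_restrict_space_iff null_sets_def)
qed

locale strong_measurability = complete_measure M + seminorm_on V nV
  for M :: "'a measure" and V :: "'b::real_vector set" and nV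
begin

abbreviation "sm \<equiv> strongly_measurable V nV M"

lemma sm_mem: "sm f \<Longrightarrow> x \<in> space M \<Longrightarrow> f x \<in> V"
  by (simp add: strongly_measurable_def)

lemma sm_obtain:
  assumes "sm f"
  obtains s where "\<And>i::nat. simple_function M (s i)" "\<And>i x. x \<in> space M \<Longrightarrow> s i x \<in> V"
    "AE x in M. (\<lambda>i. nV (f x - s i x)) \<longlonglongrightarrow> 0"
  using assms unfolding strongly_measurable_def by blast

lemma sm_intro:
  assumes "\<And>x. x \<in> space M \<Longrightarrow> f x \<in> V"
    "\<And>i::nat. simple_function M (s i)" "\<And>i x. x \<in> space M \<Longrightarrow> s i x \<in> V"
    "AE x in M. (\<lambda>i. nV (f x - s i x)) \<longlonglongrightarrow> 0"
  shows "sm f"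
  using assms unfolding strongly_measurable_def by blast

lemma sm_AE_eq:
  assumes "sm f" "AE x in M. f x = g x" "\<And>x. x \<in> space M \<Longrightarrow> g x \<in> V"
  shows "sm g"
proof -
  obtain s where s: "\<And>i::nat. simple_function M (s i)" "\<And>i x. x \<in> space M \<Longrightarrow> s i x \<in> V"
    and lim: "AE x in M. (\<lambda>i. nV (f x - s i x)) \<longlonglongrightarrow> 0"
    using sm_obtain[OF assms(1)] by blast
  have "AE x in M. (\<lambda>i. nV (g x - s i x)) \<longlonglongrightarrow> 0"
    using lim assms(2) by eventually_elim simp
  with s assms(3) show ?thesis by (intro sm_intro)
qed

lemma sm_simple:
  assumes "simple_function M s" "\<And>x. x \<in> space M \<Longrightarrow> s x \<in> V" shows "sm s"
  using assms by (intro sm_intro[where s = "\<lambda>_. s"]) (auto simp: nV_zero)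

text \<open>A Lipschitz map turns strong approximation by simple functions into convergence of Borel
  functions. It is applied to the norm and to functionals such as evaluation at a test
  vector.\<close>

lemma sm_borel_measurable:
  fixes q :: "'b \<Rightarrow> 'c::{banach, second_countable_topology}"
  assumes f: "sm f" and q: "\<And>x y. x \<in> V \<Longrightarrow> y \<in> V \<Longrightarrow> norm (q x - q y) \<le> C * nV (x - y)"
  shows "(\<lambda>x. q (f x)) \<in> borel_measurable M"
proof -
  obtain s where s: "\<And>i::nat. simple_function M (s i)" "\<And>i x. x \<in> space M \<Longrightarrow> s i x \<in> V"
    and lim: "AE x in M. (\<lambda>i. nV (f x - s i x)) \<longlonglongrightarrow> 0"
    using sm_obtain[OF f] by blast
  show ?thesis
  proof (rule borel_measurable_AE_limit)
    show "(\<lambda>x. q (s i x)) \<in> borel_measurable M" for i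
      by (rule borel_measurable_simple_function[OF simple_function_compose1[OF s(1)]])
    show "AE x in M. (\<lambda>i. q (s i x)) \<longlonglongrightarrow> q (f x)"
      using lim AE_space
    proof eventually_elim
      fix x assume x: "(\<lambda>i. nV (f x - s i x)) \<longlonglongrightarrow> 0" "x \<in> space M"
      have "(\<lambda>i. C * nV (f x - s i x)) \<longlonglongrightarrow> 0"
        using tendsto_mult[OF tendsto_const[of C] x(1)] by simp
      then have "(\<lambda>i. q (f x) - q (s i x)) \<longlonglongrightarrow> 0"
        by (rule Lim_null_comparison[rotated]) (use q[OF sm_mem[OF f x(2)] s(2)[OF x(2)]] in auto)
      from tendsto_minus[OF this] show "(\<lambda>i. q (s i x)) \<longlonglongrightarrow> q (f x)"
        by (intro LIM_zero_cancel[of _ "q (f x)"]) simp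
    qed
  qed
qed

lemma sm_norm_measurable: "sm f \<Longrightarrow> (\<lambda>x. nV (f x)) \<in> borel_measurable M"
  using nV_diff_le by (intro sm_borel_measurable[where C = 1]) auto

lemma sm_add:
  assumes f: "sm f" and g: "sm g" shows "sm (\<lambda>x. f x + g x)"
proof -
  obtain s where s: "\<And>i::nat. simple_function M (s i)" "\<And>i x. x \<in> space M \<Longrightarrow> s i x \<in> V"
    and lims: "AE x in M. (\<lambda>i. nV (f x - s i x)) \<longlonglongrightarrow> 0"
    using sm_obtain[OF f] by blast
  obtain r where r: "\<And>i::nat. simple_function M (r i)" "\<And>i x. x \<in> space M \<Longrightarrow> r i x \<in> V"
    and limr: "AE x in M. (\<lambda>i. nV (g x - r i x)) \<longlonglongrightarrow> 0"
    using sm_obtain[OF g] by blast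
  show ?thesis
  proof (rule sm_intro)
    show "AE x in M. (\<lambda>i. nV (f x + g x - (s i x + r i x))) \<longlonglongrightarrow> 0"
      using lims limr AE_space
    proof eventually_elim
      fix x assume x: "(\<lambda>i. nV (f x - s i x)) \<longlonglongrightarrow> 0" "(\<lambda>i. nV (g x - r i x)) \<longlonglongrightarrow> 0" "x \<in> space M"
      have mem: "f x - s i x \<in> V" "g x - r i x \<in> V" for i
        using sm_mem[OF f x(3)] sm_mem[OF g x(3)] s(2)[OF x(3)] r(2)[OF x(3)] V_diff by auto
      have eq: "f x + g x - (s i x + r i x) = (f x - s i x) + (g x - r i x)" for i by simp
      show "(\<lambda>i. nV (f x + g x - (s i x + r i x))) \<longlonglongrightarrow> 0"
      proof (rule tendsto_sandwich[OF _ _ tendsto_const])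
        show "(\<lambda>i. nV (f x - s i x) + nV (g x - r i x)) \<longlonglongrightarrow> 0"
          using tendsto_add[OF x(1,2)] by simp
      qed (unfold eq, auto intro!: always_eventually nV_triangle nV_nonneg subspace_add[OF V_subspace] mem)
    qed
    show "f x + g x \<in> V" if "x \<in> space M" for x
      using sm_mem[OF f that] sm_mem[OF g that] by (rule subspace_add[OF V_subspace])
    show "s i x + r i x \<in> V" if "x \<in> space M" for i x
      using s(2)[OF that] r(2)[OF that] by (rule subspace_add[OF V_subspace])
  qed (intro simple_function_add s r)
qed

lemma sm_scaleR:
  assumes f: "sm f" shows "sm (\<lambda>x. c *\<^sub>R f x)"
proof -
  obtain s where s: "\<And>i::nat. simple_function M (s i)" "\<And>i x. x \<in> space M \<Longrightarrow> s i x \<in> V"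
    and lim: "AE x in M. (\<lambda>i. nV (f x - s i x)) \<longlonglongrightarrow> 0"
    using sm_obtain[OF f] by blast
  show ?thesis
  proof (rule sm_intro)
    show "AE x in M. (\<lambda>i. nV (c *\<^sub>R f x - c *\<^sub>R s i x)) \<longlonglongrightarrow> 0"
      using lim AE_space
    proof eventually_elim
      fix x assume x: "(\<lambda>i. nV (f x - s i x)) \<longlonglongrightarrow> 0" "x \<in> space M"
      show "(\<lambda>i. nV (c *\<^sub>R f x - c *\<^sub>R s i x)) \<longlonglongrightarrow> 0"
        using tendsto_mult[OF tendsto_const[of "\<bar>c\<bar>"] x(1)] sm_mem[OF f x(2)] s(2)[OF x(2)]
        by (simp add: nV_scaleR V_diff flip: scaleR_diff_right)
    qed
    show "c *\<^sub>R f x \<in> V" if "x \<in> space M" for x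
      using sm_mem[OF f that] by (rule subspace_scale[OF V_subspace])
    show "c *\<^sub>R s i x \<in> V" if "x \<in> space M" for i x
      using s(2)[OF that] by (rule subspace_scale[OF V_subspace])
  qed (rule simple_function_compose1[OF s(1)])
qed

lemma sm_diff: "sm f \<Longrightarrow> sm g \<Longrightarrow> sm (\<lambda>x. f x - g x)"
  using sm_add[of f "\<lambda>x. -1 *\<^sub>R g x"] sm_scaleR[of g "-1"] by simp

text \<open>Replacing \<open>s i\<close> by zero where it exceeds \<open>2 * nV (f x)\<close> yields
  a majorant. Where \<open>nV (f x)\<close> is positive this truncation is inactive from some index
  on, and where it vanishes every truncated value is at distance \<open>0\<close> from
  \<open>f x\<close>.\<close>

lemma sm_bounded_approximation:
  assumes f: "sm f"
  obtains s where "\<And>i::nat. simple_function M (s i)" "\<And>i x. x \<in> space M \<Longrightarrow> s i x \<in> V"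
    "AE x in M. (\<lambda>i. nV (f x - s i x)) \<longlonglongrightarrow> 0"
    "\<And>i x. x \<in> space M \<Longrightarrow> nV (s i x) \<le> 2 * nV (f x)"
proof -
  obtain s where s: "\<And>i::nat. simple_function M (s i)" "\<And>i x. x \<in> space M \<Longrightarrow> s i x \<in> V"
    and lim: "AE x in M. (\<lambda>i. nV (f x - s i x)) \<longlonglongrightarrow> 0"
    using sm_obtain[OF f] by blast
  define r where "r = (\<lambda>i x. if nV (s i x) \<le> 2 * nV (f x) then s i x else 0)"
  show ?thesis
  proof (rule that)
    show "simple_function M (r i)" for i
      unfolding r_def
    proof (intro simple_function_If s simple_function_const)
      show "{x \<in> space M. nV (s i x) \<le> 2 * nV (f x)} \<in> sets M"
        using sm_norm_measurable[OF f] sm_norm_measurable[OF sm_simple[OF s]] by measurable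
    qed
    show "r i x \<in> V" if "x \<in> space M" for i x
      using s(2)[OF that] V_0 by (auto simp: r_def)
    show "nV (r i x) \<le> 2 * nV (f x)" if "x \<in> space M" for i x
      using nV_nonneg[OF sm_mem[OF f that]] by (auto simp: r_def nV_zero)
    show "AE x in M. (\<lambda>i. nV (f x - r i x)) \<longlonglongrightarrow> 0"
      using lim AE_space
    proof eventually_elim
      fix x assume x: "(\<lambda>i. nV (f x - s i x)) \<longlonglongrightarrow> 0" "x \<in> space M"
      note mem = sm_mem[OF f x(2)] s(2)[OF x(2)]
      show "(\<lambda>i. nV (f x - r i x)) \<longlonglongrightarrow> 0"
      proof (cases "nV (f x) = 0")
        case True
        have "nV (f x - r i x) \<le> 0" for i
          using True nV_triangle_diff[of "f x" 0 "r i x"] nV_minus[of "r i x"] mem V_0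
          by (auto simp: r_def)
        moreover have "nV (f x - r i x) \<ge> 0" for i
          using mem V_0 by (intro nV_nonneg V_diff) (auto simp: r_def)
        ultimately have "nV (f x - r i x) = 0" for i by (rule antisym)
        then show ?thesis by simp
      next
        case False
        then have "nV (f x) > 0" using nV_nonneg[OF mem(1)] by simp
        then have "eventually (\<lambda>i. nV (f x - s i x) < nV (f x)) sequentially"
          using order_tendstoD(2)[OF x(1)] by blast
        then have "eventually (\<lambda>i. nV (f x - s i x) = nV (f x - r i x)) sequentially"
        proof eventually_elim
          fix i assume "nV (f x - s i x) < nV (f x)"
          then have "nV (s i x) \<le> 2 * nV (f x)"
            using nV_diff_le[OF mem, of i] by linarith
          then show "nV (f x - s i x) = nV (f x - r i x)" by (simp add: r_def)
        qed
        then show ?thesis by (rule Lim_transform_eventually[OF x(1)])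
      qed
    qed
  qed
qed

lemma sm_L1_approximation:
  assumes f: "sm f" and fin: "(\<integral>\<^sup>+x. ennreal (nV (f x)) \<partial>M) < \<infinity>"
  obtains s where "\<And>i::nat. simple_function M (s i)" "\<And>i x. x \<in> space M \<Longrightarrow> s i x \<in> V"
    "(\<lambda>i. \<integral>\<^sup>+x. ennreal (nV (f x - s i x)) \<partial>M) \<longlonglongrightarrow> 0"
proof -
  obtain s where s: "\<And>i::nat. simple_function M (s i)" "\<And>i x. x \<in> space M \<Longrightarrow> s i x \<in> V"
    and lim: "AE x in M. (\<lambda>i. nV (f x - s i x)) \<longlonglongrightarrow> 0"
    and le: "\<And>i x. x \<in> space M \<Longrightarrow> nV (s i x) \<le> 2 * nV (f x)"
    using sm_bounded_approximation[OF f] by blast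
  have meas: "(\<lambda>x. nV (f x - s i x)) \<in> borel_measurable M" for i
    by (intro sm_norm_measurable sm_diff f sm_simple s)
  have "(\<lambda>i. \<integral>\<^sup>+x. ennreal (nV (f x - s i x)) \<partial>M) \<longlonglongrightarrow> (\<integral>\<^sup>+x. 0 \<partial>M)"
  \<comment> \<open>One \<open>nV (f x)\<close> comes from \<open>f\<close> itself and two from the
    bounded approximation.\<close>
  proof (rule nn_integral_dominated_convergence[where w = "\<lambda>x. 3 * ennreal (nV (f x))"])
    show "AE x in M. ennreal (nV (f x - s i x)) \<le> 3 * ennreal (nV (f x))" for i
      using AE_space
    proof eventually_elim
      fix x assume x: "x \<in> space M"
      have "nV (f x - s i x) \<le> nV (f x) + nV (s i x)"
        using nV_triangle_diff[of "f x" 0 "s i x"] nV_minus[of "s i x"] sm_mem[OF f x] s(2)[OF x] V_0 by simp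
      then have "nV (f x - s i x) \<le> 3 * nV (f x)" using le[OF x, of i] by simp
      then have "ennreal (nV (f x - s i x)) \<le> ennreal (3 * nV (f x))" by (rule ennreal_leI)
      then show "ennreal (nV (f x - s i x)) \<le> 3 * ennreal (nV (f x))"
        using nV_nonneg[OF sm_mem[OF f x]] by (simp add: ennreal_mult)
    qed
    show "(\<integral>\<^sup>+x. 3 * ennreal (nV (f x)) \<partial>M) < \<infinity>"
      using fin sm_norm_measurable[OF f] by (subst nn_integral_cmult) (auto simp: ennreal_mult_less_top)
    show "AE x in M. (\<lambda>i. ennreal (nV (f x - s i x))) \<longlonglongrightarrow> 0"
      using lim by eventually_elim (drule tendsto_ennrealI, simp)
  qed (use meas sm_norm_measurable[OF f] in measurable)
  then show ?thesis using s by (intro that) auto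
qed

text \<open>Simple functions \<open>s n\<close> with \<open>\<integral> min 1 (nV (f n - s n)) < 2\<^sup>-\<^sup>n\<close> have \<open>nV (f n - s n) \<rightarrow> 0\<close> almost everywhere.\<close>

lemma sm_limit:
  assumes "finite_measure M" and f: "\<And>n::nat. sm (f n)"
    and lim: "AE x in M. (\<lambda>n. nV (g x - f n x)) \<longlonglongrightarrow> 0" and g: "\<And>x. x \<in> space M \<Longrightarrow> g x \<in> V"
  shows "sm g"
proof -
  interpret finite_measure M by fact
  have "\<exists>s. simple_function M s \<and> (\<forall>x\<in>space M. s x \<in> V) \<and>
      (\<integral>\<^sup>+x. ennreal (min 1 (nV (f n x - s x))) \<partial>M) < ennreal ((1/2)^n)" for n
  proof -
    obtain s where s: "\<And>i::nat. simple_function M (s i)" "\<And>i x. x \<in> space M \<Longrightarrow> s i x \<in> V"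
      and lim: "AE x in M. (\<lambda>i. nV (f n x - s i x)) \<longlonglongrightarrow> 0"
      using sm_obtain[OF f[of n]] by blast
    have meas: "(\<lambda>x. nV (f n x - s i x)) \<in> borel_measurable M" for i
      by (intro sm_norm_measurable sm_diff f sm_simple s)
    have "(\<lambda>i. \<integral>\<^sup>+x. ennreal (min 1 (nV (f n x - s i x))) \<partial>M) \<longlonglongrightarrow> (\<integral>\<^sup>+x. 0 \<partial>M)"
    \<comment> \<open>Cutting off at \<open>1\<close> gives an integrable majorant on a finite
      measure space although \<open>f n\<close> need not be integrable.\<close>
    proof (rule nn_integral_dominated_convergence[where w = "\<lambda>_. 1"])
      show "AE x in M. (\<lambda>i. ennreal (min 1 (nV (f n x - s i x)))) \<longlonglongrightarrow> 0"
        using lim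
      proof eventually_elim
        fix x assume "(\<lambda>i. nV (f n x - s i x)) \<longlonglongrightarrow> 0"
        from tendsto_ennrealI[OF tendsto_min[OF tendsto_const[of 1] this]]
        show "(\<lambda>i. ennreal (min 1 (nV (f n x - s i x)))) \<longlonglongrightarrow> 0"
          by simp
      qed
      show "(\<integral>\<^sup>+x. 1 \<partial>M) < \<infinity>"
        using emeasure_finite[of "space M"] by (simp add: less_top[symmetric])
      show "AE x in M. ennreal (min 1 (nV (f n x - s i x))) \<le> 1" for i
        by (intro AE_I2) (metis ennreal_1 ennreal_leI min.cobounded1)
    qed (use meas in measurable)
    then have "eventually (\<lambda>i. (\<integral>\<^sup>+x. ennreal (min 1 (nV (f n x - s i x))) \<partial>M) < ennreal ((1/2)^n)) sequentially"
      by (intro order_tendstoD(2)) auto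
    then obtain i where "(\<integral>\<^sup>+x. ennreal (min 1 (nV (f n x - s i x))) \<partial>M) < ennreal ((1/2)^n)"
      using eventually_happens'[OF sequentially_bot] by blast
    then show ?thesis using s by blast
  qed
  then obtain s where s: "\<And>n. simple_function M (s n)" "\<And>n x. x \<in> space M \<Longrightarrow> s n x \<in> V"
    and small: "\<And>n. (\<integral>\<^sup>+x. ennreal (min 1 (nV (f n x - s n x))) \<partial>M) < ennreal ((1/2)^n)"
    by metis
  have [measurable]: "(\<lambda>x. nV (f n x - s n x)) \<in> borel_measurable M" for n
    by (intro sm_norm_measurable sm_diff f sm_simple s)
  have meas: "(\<lambda>x. ennreal (min 1 (nV (f n x - s n x)))) \<in> borel_measurable M" for n
    by measurable
  have "(\<integral>\<^sup>+x. (\<Sum>n. ennreal (min 1 (nV (f n x - s n x)))) \<partial>M)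
      = (\<Sum>n. \<integral>\<^sup>+x. ennreal (min 1 (nV (f n x - s n x))) \<partial>M)"
    by (intro nn_integral_suminf meas)
  also have "\<dots> \<le> (\<Sum>n. ennreal ((1/2)^n))"
    using small by (intro suminf_le) (auto intro: less_imp_le)
  also have "\<dots> < \<infinity>"
    by (subst suminf_ennreal2) (auto simp: summable_geometric)
  finally have "(\<integral>\<^sup>+x. (\<Sum>n. ennreal (min 1 (nV (f n x - s n x)))) \<partial>M) \<noteq> \<infinity>"
    by simp
  then have "AE x in M. (\<Sum>n. ennreal (min 1 (nV (f n x - s n x)))) \<noteq> \<infinity>"
    by (intro nn_integral_noteq_infinite borel_measurable_suminf_order meas)
  then have "AE x in M. (\<lambda>n. nV (g x - s n x)) \<longlonglongrightarrow> 0"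
    using lim AE_space
  proof eventually_elim
    fix x assume fin: "(\<Sum>n. ennreal (min 1 (nV (f n x - s n x)))) \<noteq> \<infinity>"
      and lim: "(\<lambda>n. nV (g x - f n x)) \<longlonglongrightarrow> 0" and x: "x \<in> space M"
    note mem = sm_mem[OF f x] s(2)[OF x] g[OF x]
    have nonneg: "0 \<le> nV (f n x - s n x)" for n
      by (intro nV_nonneg V_diff mem)
    have "summable (\<lambda>n. min 1 (nV (f n x - s n x)))"
      using fin nonneg by (intro summable_suminf_not_top) (auto simp: less_top)
    then have m0: "(\<lambda>n. min 1 (nV (f n x - s n x))) \<longlonglongrightarrow> 0" by (rule summable_LIMSEQ_zero)
    \<comment> \<open>Once the minimum is below \<open>1\<close> it equals the norm, so the cut-off
      does no harm to convergence.\<close>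
    then have "eventually (\<lambda>n. min 1 (nV (f n x - s n x)) < 1) sequentially"
      by (rule order_tendstoD(2)) simp
    then have "eventually (\<lambda>n. min 1 (nV (f n x - s n x)) = nV (f n x - s n x)) sequentially"
      by eventually_elim auto
    from Lim_transform_eventually[OF m0 this]
    have "(\<lambda>n. nV (f n x - s n x)) \<longlonglongrightarrow> 0" .
    from tendsto_add[OF lim this] have "(\<lambda>n. nV (g x - f n x) + nV (f n x - s n x)) \<longlonglongrightarrow> 0"
      by simp
    then show "(\<lambda>n. nV (g x - s n x)) \<longlonglongrightarrow> 0"
      by (rule tendsto_sandwich[OF _ _ tendsto_const, rotated 2])
        (auto intro!: always_eventually nV_triangle_diff nV_nonneg V_diff mem)
  qed
  with g s show ?thesis by (intro sm_intro)
qed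

text \<open>A bounded functional acts term by term on simple integrals and preserves their
  convergence. Testing in this way makes the integral in \<open>E\<close> unique.\<close>

lemma has_bochner_integral_functional:
  fixes q :: "'b \<Rightarrow> 'c::{banach, second_countable_topology}"
  assumes f: "has_bochner_integral_on V nV M f I" and q: "linear q"
    and bound: "\<And>x. x \<in> V \<Longrightarrow> norm (q x) \<le> C * nV x" and C: "0 \<le> C"
  shows "has_bochner_integral M (\<lambda>x. q (f x)) (q I)"
proof -
  interpret q: linear q by fact
  from f obtain s where sm: "sm f" and I: "I \<in> V"
    and s: "\<And>i. Bochner_Integration.simple_bochner_integrable M (s i)"
    and sV: "\<And>i x. x \<in> space M \<Longrightarrow> s i x \<in> V"
    and lim: "(\<lambda>i. \<integral>\<^sup>+x. ennreal (nV (f x - s i x)) \<partial>M) \<longlonglongrightarrow> 0"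
    and lim2: "(\<lambda>i. nV (Bochner_Integration.simple_bochner_integral M (s i) - I)) \<longlonglongrightarrow> 0"
    unfolding has_bochner_integral_on_def by blast
  have simple: "simple_function M (s i)" for i
    using s[of i] by (auto elim: Bochner_Integration.simple_bochner_integrable.cases)
  have lip: "norm (q x - q y) \<le> C * nV (x - y)" if "x \<in> V" "y \<in> V" for x y
    using bound[OF V_diff[OF that]] by (simp add: q.diff)
  have intV: "Bochner_Integration.simple_bochner_integral M (s i) \<in> V" for i
    unfolding Bochner_Integration.simple_bochner_integral_def
    using sV by (intro subspace_sum[OF V_subspace] subspace_scale[OF V_subspace]) auto
  show ?thesis
  proof (rule has_bochner_integral.intros)
    show "(\<lambda>x. q (f x)) \<in> borel_measurable M"
      using sm lip by (rule sm_borel_measurable)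
    show "Bochner_Integration.simple_bochner_integrable M (\<lambda>x. q (s i x))" for i
      using simple_bochner_integrable_compose2[of "\<lambda>x y. q x", OF _ s[of i] s[of i]] by (simp add: q.zero)
    show "(\<lambda>i. \<integral>\<^sup>+x. ennreal (norm (q (f x) - q (s i x))) \<partial>M) \<longlonglongrightarrow> 0"
    proof (rule tendsto_sandwich[OF _ _ tendsto_const])
      show "(\<lambda>i. ennreal C * (\<integral>\<^sup>+x. ennreal (nV (f x - s i x)) \<partial>M)) \<longlonglongrightarrow> 0"
        using ennreal_tendsto_cmult[OF _ lim, of "ennreal C"] by simp
      have "(\<integral>\<^sup>+x. ennreal (norm (q (f x) - q (s i x))) \<partial>M) \<le> (\<integral>\<^sup>+x. ennreal C * ennreal (nV (f x - s i x)) \<partial>M)" for i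
        using C lip[OF sm_mem[OF sm] sV] by (intro nn_integral_mono) (auto simp flip: ennreal_mult' intro!: ennreal_leI)
      also have "\<dots> i = ennreal C * (\<integral>\<^sup>+x. ennreal (nV (f x - s i x)) \<partial>M)" for i
        using sm_norm_measurable[OF sm_diff[OF sm sm_simple[OF simple sV]]]
        by (intro nn_integral_cmult) measurable
      finally show "eventually (\<lambda>i. (\<integral>\<^sup>+x. ennreal (norm (q (f x) - q (s i x))) \<partial>M)
          \<le> ennreal C * (\<integral>\<^sup>+x. ennreal (nV (f x - s i x)) \<partial>M)) sequentially"
        by simp
    qed simp
    have "(\<lambda>i. C * nV (Bochner_Integration.simple_bochner_integral M (s i) - I)) \<longlonglongrightarrow> 0"
      using tendsto_mult[OF tendsto_const[of C] lim2] by simp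
    then have "(\<lambda>i. q (Bochner_Integration.simple_bochner_integral M (s i)) - q I) \<longlonglongrightarrow> 0"
      by (rule Lim_null_comparison[rotated]) (use lip[OF intV I] in auto)
    then show "(\<lambda>i. Bochner_Integration.simple_bochner_integral M (\<lambda>x. q (s i x))) \<longlonglongrightarrow> q I"
      unfolding simple_bochner_integral_linear[OF q s] by (rule LIM_zero_cancel)
  qed
qed

end

section \<open>Square integrable functions on the line\<close>

lemma norm_integral_le:
  fixes f :: "'a \<Rightarrow> 'b::{banach, second_countable_topology}"
  assumes "integrable M f" "integrable M g" "\<And>x. x \<in> space M \<Longrightarrow> norm (f x) \<le> g x"
  shows "norm (\<integral>x. f x \<partial>M) \<le> (\<integral>x. g x \<partial>M)"
  using integral_norm_bound by (rule order_trans) (intro integral_mono integrable_norm assms)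

lemma seminorm_on_norm: "seminorm_on UNIV (norm :: 'b::real_normed_vector \<Rightarrow> real)"
  by unfold_locales (auto intro: norm_triangle_ineq)

lemma strong_measurability_norm:
  "complete_measure M \<Longrightarrow> strong_measurability M UNIV (norm :: 'b::real_normed_vector \<Rightarrow> real)"
  by (intro strong_measurability.intro seminorm_on_norm)

lemma strongly_measurable_normI:
  assumes "\<And>i::nat. simple_function M (s i)" "AE x in M. (\<lambda>i. norm (f x - s i x)) \<longlonglongrightarrow> 0"
  shows "strongly_measurable UNIV norm M f"
  unfolding strongly_measurable_def
  by (intro conjI exI[of _ s]) (use assms in simp_all)

lemma strongly_measurable_restrict:
  fixes f :: "real \<Rightarrow> 'b::real_normed_vector"
  assumes S: "S \<in> sets lebesgue"
  shows "strongly_measurable UNIV norm (lebesgue_on S) f \<longleftrightarrow>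
    strongly_measurable UNIV norm lebesgue (\<lambda>x. indicator S x *\<^sub>R f x)"
proof
  have S': "S \<inter> space lebesgue \<in> sets lebesgue" using S by simp
  assume "strongly_measurable UNIV norm (lebesgue_on S) f"
  then obtain s where s: "\<And>i::nat. simple_function (lebesgue_on S) (s i)"
    and lim: "AE x in lebesgue_on S. (\<lambda>i. norm (f x - s i x)) \<longlonglongrightarrow> 0"
    unfolding strongly_measurable_def by blast
  have "simple_function lebesgue (\<lambda>x. indicator S x *\<^sub>R s i x)" for i
    using s simple_function_restrict_space[OF S'] by blast
  moreover have "AE x in lebesgue. (\<lambda>i. norm (indicator S x *\<^sub>R f x - indicator S x *\<^sub>R s i x)) \<longlonglongrightarrow> 0"
    using lim unfolding AE_restrict_space_iff[OF S']
    by eventually_elim (auto simp: indicator_def)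
  ultimately show "strongly_measurable UNIV norm lebesgue (\<lambda>x. indicator S x *\<^sub>R f x)"
    by (rule strongly_measurable_normI)
next
  have S': "S \<inter> space lebesgue \<in> sets lebesgue" using S by simp
  assume "strongly_measurable UNIV norm lebesgue (\<lambda>x. indicator S x *\<^sub>R f x)"
  then obtain s where s: "\<And>i::nat. simple_function lebesgue (s i)"
    and lim: "AE x in lebesgue. (\<lambda>i. norm (indicator S x *\<^sub>R f x - s i x)) \<longlonglongrightarrow> 0"
    unfolding strongly_measurable_def by blast
  have "simple_function (lebesgue_on S) (s i)" for i
    unfolding simple_function_restrict_space[OF S']
    by (rule simple_function_compose2[OF simple_function_indicator s]) (use S in simp)
  moreover have "AE x in lebesgue_on S. (\<lambda>i. norm (f x - s i x)) \<longlonglongrightarrow> 0"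
    using lim unfolding AE_restrict_space_iff[OF S']
    by eventually_elim (auto simp: indicator_def)
  ultimately show "strongly_measurable UNIV norm (lebesgue_on S) f"
    by (rule strongly_measurable_normI)
qed

lemma sq_integral_restrict:
  fixes f :: "real \<Rightarrow> 'b::real_normed_vector"
  assumes S: "S \<in> sets lebesgue"
  shows "sq_integral (lebesgue_on S) f = sq_integral lebesgue (\<lambda>x. indicator S x *\<^sub>R f x)"
  unfolding sq_integral_def using S
  by (subst nn_integral_restrict_space) (auto intro!: nn_integral_cong simp: indicator_def)

text \<open>Extension by zero puts functions on different intervals into one measure space, where
  they can be shifted, added and compared.\<close>

lemma L2_restrict:
  fixes f :: "real \<Rightarrow> 'b::real_normed_vector"
  assumes S: "S \<in> sets lebesgue"
  shows "L2 (lebesgue_on S) f \<longleftrightarrow> L2 lebesgue (\<lambda>x. indicator S x *\<^sub>R f x)"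
  unfolding L2_def strongly_measurable_restrict[OF S] sq_integral_restrict[OF S] ..

lemma sq_integral_cong_AE: "AE x in M. f x = g x \<Longrightarrow> sq_integral M f = sq_integral M g"
  unfolding sq_integral_def by (intro nn_integral_cong_AE) (auto elim: eventually_mono)

context complete_measure
begin

interpretation N: strong_measurability M UNIV "norm :: 'b::real_normed_vector \<Rightarrow> real"
  by (rule strong_measurability_norm) unfold_locales

lemma L2_sm: "L2 M f \<Longrightarrow> strongly_measurable UNIV norm M f"
  by (simp add: L2_def)

lemma L2_AE_eq:
  fixes f g :: "'a \<Rightarrow> 'b::real_normed_vector"
  assumes f: "L2 M f" and eq: "AE x in M. f x = g x" shows "L2 M g"
  using f N.sm_AE_eq[OF _ eq] sq_integral_cong_AE[OF eq] by (simp add: L2_def)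

lemma sq_measurable:
  fixes f :: "'a \<Rightarrow> 'b::real_normed_vector"
  assumes "strongly_measurable UNIV norm M f"
  shows "(\<lambda>x. ennreal ((norm (f x))\<^sup>2)) \<in> borel_measurable M"
  using N.sm_norm_measurable[OF assms] by measurable

lemma sq_integral_scale:
  fixes f :: "'a \<Rightarrow> 'b::real_normed_vector"
  assumes f: "strongly_measurable UNIV norm M f" and g: "\<And>x. norm (g x) = c * norm (f x)" "0 \<le> c"
  shows "sq_integral M g = ennreal (c\<^sup>2) * sq_integral M f"
  unfolding sq_integral_def using sq_measurable[OF f]
  by (subst nn_integral_cmult[symmetric]) (auto simp: g power_mult_distrib ennreal_mult intro!: nn_integral_cong)

lemma L2_add:
  fixes f g :: "'a \<Rightarrow> 'b::real_normed_vector"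
  assumes f: "L2 M f" and g: "L2 M g" shows "L2 M (\<lambda>x. f x + g x)"
proof -
  note m = sq_measurable[OF L2_sm[OF f]] sq_measurable[OF L2_sm[OF g]]
  have cm: "(\<lambda>x. 2 * F x) \<in> borel_measurable M" if "F \<in> borel_measurable M" for F :: "'a \<Rightarrow> ennreal"
    using that by measurable
  have "sq_integral M (\<lambda>x. f x + g x) \<le> (\<integral>\<^sup>+x. 2 * ennreal ((norm (f x))\<^sup>2) + 2 * ennreal ((norm (g x))\<^sup>2) \<partial>M)"
    unfolding sq_integral_def
  proof (rule nn_integral_mono)
    fix x
    have "(norm (f x + g x))\<^sup>2 \<le> (norm (f x) + norm (g x))\<^sup>2"
      by (intro power_mono norm_triangle_ineq) simp
    also have "\<dots> \<le> 2 * (norm (f x))\<^sup>2 + 2 * (norm (g x))\<^sup>2"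
      using sum_squares_bound[of "norm (f x)" "norm (g x)"] by (simp add: power2_sum)
    finally show "ennreal ((norm (f x + g x))\<^sup>2) \<le> 2 * ennreal ((norm (f x))\<^sup>2) + 2 * ennreal ((norm (g x))\<^sup>2)"
      using ennreal_leI by (fastforce simp: ennreal_mult)
  qed
  also have "\<dots> = 2 * sq_integral M f + 2 * sq_integral M g"
    unfolding sq_integral_def
    by (simp only: nn_integral_add[OF cm[OF m(1)]
          cm[OF m(2)]] nn_integral_cmult[OF m(1)] nn_integral_cmult[OF m(2)])
  also have "\<dots> < \<infinity>"
    using f g by (simp add: L2_def ennreal_mult_less_top)
  finally show ?thesis
    using N.sm_add[of f g] f g by (simp add: L2_def)
qed

lemma L2_scaleC:
  fixes f :: "'a \<Rightarrow> 'b::complex_inner"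
  assumes f: "L2 M f"
  shows "L2 M (\<lambda>x. c *\<^sub>C f x)" "sq_integral M (\<lambda>x. c *\<^sub>C f x) = ennreal ((cmod c)\<^sup>2) * sq_integral M f"
proof -
  show eq: "sq_integral M (\<lambda>x. c *\<^sub>C f x) = ennreal ((cmod c)\<^sup>2) * sq_integral M f"
    using f by (intro sq_integral_scale) (auto simp: L2_def norm_scaleC)
  obtain s where s: "\<And>i::nat. simple_function M (s i)" and lim: "AE x in M. (\<lambda>i. norm (f x - s i x)) \<longlonglongrightarrow> 0"
    using f unfolding L2_def strongly_measurable_def by blast
  have "strongly_measurable UNIV norm M (\<lambda>x. c *\<^sub>C f x)"
  proof (rule N.sm_intro)
    show "simple_function M (\<lambda>x. c *\<^sub>C s i x)" for i by (rule simple_function_compose1[OF s])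
    show "AE x in M. (\<lambda>i. norm (c *\<^sub>C f x - c *\<^sub>C s i x)) \<longlonglongrightarrow> 0"
      using lim
    proof eventually_elim
      fix x assume "(\<lambda>i. norm (f x - s i x)) \<longlonglongrightarrow> 0"
      from tendsto_mult[OF tendsto_const[of "cmod c"] this]
      show "(\<lambda>i. norm (c *\<^sub>C f x - c *\<^sub>C s i x)) \<longlonglongrightarrow> 0"
        by (simp add: norm_scaleC flip: linear_diff[OF bounded_linear.linear[OF bounded_linear_scaleC]])
    qed
  qed auto
  with eq f show "L2 M (\<lambda>x. c *\<^sub>C f x)"
    by (simp add: L2_def ennreal_mult_less_top)
qed

lemma sq_integral_parallelogram:
  fixes f g :: "'a \<Rightarrow> 'b::real_inner"
  assumes f: "strongly_measurable UNIV norm M f" and g: "strongly_measurable UNIV norm M g"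
  shows "sq_integral M (\<lambda>x. f x + g x) + sq_integral M (\<lambda>x. f x - g x) = 2 * sq_integral M f + 2 * sq_integral M g"
proof -
  note m = sq_measurable[OF f] sq_measurable[OF g] sq_measurable[OF N.sm_add[OF f g]] sq_measurable[OF N.sm_diff[OF f g]]
  have cm: "(\<lambda>x. 2 * F x) \<in> borel_measurable M" if "F \<in> borel_measurable M" for F :: "'a \<Rightarrow> ennreal"
    using that by measurable
  have par: "(norm (x + y))\<^sup>2 + (norm (x - y))\<^sup>2 = 2 * (norm x)\<^sup>2 + 2 * (norm y)\<^sup>2" for x y :: 'b
    by (simp add: power2_norm_eq_inner inner_add inner_diff inner_commute algebra_simps)
  have "ennreal ((norm (x + y))\<^sup>2) + ennreal ((norm (x - y))\<^sup>2) = 2 * ennreal ((norm x)\<^sup>2) + 2 * ennreal ((norm y)\<^sup>2)" for x y :: 'b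
    using arg_cong[OF par[of x y], of ennreal] by (simp add: ennreal_mult)
  then have "(\<integral>\<^sup>+x. ennreal ((norm (f x + g x))\<^sup>2) + ennreal ((norm (f x - g x))\<^sup>2) \<partial>M)
      = (\<integral>\<^sup>+x. 2 * ennreal ((norm (f x))\<^sup>2) + 2 * ennreal ((norm (g x))\<^sup>2) \<partial>M)"
    by (simp only:)
  then show ?thesis
    unfolding sq_integral_def
    by (simp only: nn_integral_add[OF cm[OF m(1)]
          cm[OF m(2)]] nn_integral_add[OF m(3,4)]
        nn_integral_cmult[OF m(1)] nn_integral_cmult[OF m(2)])
qed

text \<open>From \<open>a \<le> 1 + a\<^sup>2\<close>, integrated over a space of finite
  measure.\<close>

lemma L2_imp_L1:
  fixes f :: "'a \<Rightarrow> 'b::real_normed_vector"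
  assumes f: "L2 M f" and fin: "emeasure M (space M) < \<infinity>"
  shows "(\<integral>\<^sup>+x. ennreal (norm (f x)) \<partial>M) < \<infinity>"
proof -
  note m = sq_measurable[OF L2_sm[OF f]]
  have "(\<integral>\<^sup>+x. ennreal (norm (f x)) \<partial>M) \<le> (\<integral>\<^sup>+x. 1 + ennreal ((norm (f x))\<^sup>2) \<partial>M)"
  proof (rule nn_integral_mono)
    fix x
    have "norm (f x) \<le> 1 + (norm (f x))\<^sup>2"
      using sum_squares_bound[of "norm (f x)" 1] norm_ge_zero[of "f x"] by (simp, linarith)
    then show "ennreal (norm (f x)) \<le> 1 + ennreal ((norm (f x))\<^sup>2)"
      using ennreal_leI by (fastforce simp flip: ennreal_1)
  qed
  also have "\<dots> = emeasure M (space M) + sq_integral M f"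
    unfolding sq_integral_def by (simp add: nn_integral_add[OF borel_measurable_const m])
  also have "\<dots> < \<infinity>" using f fin by (simp add: L2_def)
  finally show ?thesis .
qed

end

lemma L2_subset:
  fixes f :: "real \<Rightarrow> 'b::real_normed_vector"
  assumes S: "S \<in> sets lebesgue" and T: "T \<in> sets lebesgue" and "S \<subseteq> T" and f: "L2 (lebesgue_on T) f"
  shows "L2 (lebesgue_on S) f"
proof -
  obtain s where s: "\<And>i::nat. simple_function lebesgue (s i)"
    and lim: "AE x in lebesgue. (\<lambda>i. norm (indicator T x *\<^sub>R f x - s i x)) \<longlonglongrightarrow> 0"
    using completion.L2_sm[OF f[unfolded L2_restrict[OF T]]] unfolding strongly_measurable_def by blast
  have "strongly_measurable UNIV norm lebesgue (\<lambda>x. indicator S x *\<^sub>R f x)"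
    unfolding strongly_measurable_def
  proof (intro conjI exI allI)
    show "simple_function lebesgue (\<lambda>x. indicator S x *\<^sub>R s i x)" for i
      by (rule simple_function_compose2[OF simple_function_indicator s]) (use S in simp)
    show "AE x in lebesgue. (\<lambda>i. norm (indicator S x *\<^sub>R f x - indicator S x *\<^sub>R s i x)) \<longlonglongrightarrow> 0"
      using lim \<open>S \<subseteq> T\<close> by (auto elim!: eventually_mono simp: indicator_def)
  qed auto
  moreover have "sq_integral lebesgue (\<lambda>x. indicator S x *\<^sub>R f x) \<le> sq_integral lebesgue (\<lambda>x. indicator T x *\<^sub>R f x)"
    unfolding sq_integral_def using \<open>S \<subseteq> T\<close>
    by (intro nn_integral_mono) (auto simp: indicator_def)
  ultimately show ?thesis
    using f[unfolded L2_restrict[OF T]] unfolding L2_restrict[OF S] by (auto simp: L2_def)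
qed

section \<open>Invariance under translations of the line\<close>

lemma lebesgue_distr_shift: "(\<lambda>x. x - a) \<in> lebesgue \<rightarrow>\<^sub>M lebesgue" "distr lebesgue lebesgue (\<lambda>x. x - a) = lebesgue"
  for a :: real
  using lebesgue_affine_measurable[of "\<lambda>_. 1" "- a"] lebesgue_real_affine[of 1 "- a"]
  by (simp_all add: density_1)

lemma AE_lebesgue_shift:
  fixes a :: real
  assumes "AE x in lebesgue. P x" shows "AE x in lebesgue. P (x - a)"
proof -
  have "(\<lambda>x. x - a) -` {x. \<not> P x} \<inter> space lebesgue \<in> null_sets lebesgue"
  proof -
    have "{x. \<not> P x} \<in> null_sets (distr lebesgue lebesgue (\<lambda>x. x - a))"
      using assms by (simp add: completion.AE_iff_null_sets lebesgue_distr_shift)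
    then show ?thesis
      using null_sets_distr_iff[OF lebesgue_distr_shift(1)] by blast
  qed
  then show ?thesis by (simp add: completion.AE_iff_null_sets vimage_def)
qed

lemma L2_shift:
  fixes f :: "real \<Rightarrow> 'b::real_normed_vector" and a :: real
  assumes f: "L2 lebesgue f"
  shows "L2 lebesgue (\<lambda>x. f (x - a))" "sq_integral lebesgue (\<lambda>x. f (x - a)) = sq_integral lebesgue f"
proof -
  have meas: "(\<lambda>x. ennreal ((norm (f x))\<^sup>2)) \<in> borel_measurable lebesgue"
    using f by (intro completion.sq_measurable) (auto simp: L2_def)
  have "sq_integral lebesgue f = (\<integral>\<^sup>+x. ennreal ((norm (f x))\<^sup>2) \<partial>distr lebesgue lebesgue (\<lambda>x. x - a))"
    by (simp add: sq_integral_def lebesgue_distr_shift)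
  also have "\<dots> = sq_integral lebesgue (\<lambda>x. f (x - a))"
    unfolding sq_integral_def by (intro nn_integral_distr lebesgue_distr_shift) (use meas in simp)
  finally show eq: "sq_integral lebesgue (\<lambda>x. f (x - a)) = sq_integral lebesgue f" ..
  obtain s where s: "\<And>i::nat. simple_function lebesgue (s i)"
    and lim: "AE x in lebesgue. (\<lambda>i. norm (f x - s i x)) \<longlonglongrightarrow> 0"
    using f unfolding L2_def strongly_measurable_def by blast
  have "simple_function lebesgue (\<lambda>x. s i (x - a))" for i
    unfolding simple_function_eq_measurable
  proof
    show "finite ((\<lambda>x. s i (x - a)) ` space lebesgue)"
      using simple_functionD(1)[OF s[of i]] by (rule finite_subset[rotated]) auto
    show "(\<lambda>x. s i (x - a)) \<in> lebesgue \<rightarrow>\<^sub>M count_space UNIV"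
      by (rule measurable_compose[OF lebesgue_distr_shift(1) measurable_simple_function[OF s]])
  qed
  then have "strongly_measurable UNIV norm lebesgue (\<lambda>x. f (x - a))"
    using AE_lebesgue_shift[OF lim, of a] by (rule strongly_measurable_normI)
  with eq f show "L2 lebesgue (\<lambda>x. f (x - a))" by (simp add: L2_def)
qed

lemma integral_lebesgue_shift:
  fixes f :: "real \<Rightarrow> 'c::{banach, second_countable_topology}"
  assumes "f \<in> borel_measurable lebesgue"
  shows "(\<integral>x. f (x - a) \<partial>lebesgue) = (\<integral>x. f x \<partial>lebesgue)"
  using integral_distr[OF lebesgue_distr_shift(1) assms] by (simp add: lebesgue_distr_shift)

section \<open>Bochner integrals with values in the extrapolation space\<close>

context hilbert_semigroup
begin

lemma seminorm_on_E: "seminorm_on E nE"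
  by unfold_locales (auto simp: subspace_E nE_triangle nE_scaleR)

lemma linear_eval: "linear (\<lambda>f::'h \<Rightarrow> complex. f \<phi>)"
  by (rule linearI) (auto simp: scaleR_fun_def)

text \<open>The integral is constructed by duality: its value at \<open>\<phi>\<close> is declared
  to be the scalar integral, which defines an element of \<open>E\<close>. So the limit is known in
  advance, and simple integrals only have to be shown to converge to it.\<close>

lemma bochner_integral_on_E:
  assumes M: "complete_measure M" "finite_measure M"
    and f: "strongly_measurable E nE M f" and fin: "(\<integral>\<^sup>+x. ennreal (nE (f x)) \<partial>M) < \<infinity>"
  shows "bochner_integral_on E nE M f \<in> E"
    and "\<phi> \<in> X \<Longrightarrow> integrable M (\<lambda>x. f x \<phi>)"
    and "\<phi> \<in> X \<Longrightarrow> bochner_integral_on E nE M f \<phi> = (\<integral>x. f x \<phi> \<partial>M)"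
proof -
  interpret strong_measurability M E nE
    by (intro strong_measurability.intro M seminorm_on_E)
  interpret finite_measure M by fact
  have memf: "x \<in> space M \<Longrightarrow> f x \<in> E" for x using f by (rule sm_mem)
  have nE_int: "integrable M (\<lambda>x. nE (f x))"
    using sm_norm_measurable[OF f] fin nV_nonneg[OF memf] nn_integral_cong[of M "\<lambda>x. ennreal (nE (f x))" "\<lambda>x. ennreal (norm (nE (f x)))"]
    by (intro integrableI_bounded) auto
  have eval_meas: "(\<lambda>x. f x \<phi>) \<in> borel_measurable M" if "\<phi> \<in> X" for \<phi>
  proof (rule sm_borel_measurable[OF f])
    show "norm (g \<phi> - h \<phi>) \<le> gn \<phi> * nE (g - h)" if "g \<in> E" "h \<in> E" for g h
      using nE_bound[OF E_diff[OF that] \<open>\<phi> \<in> X\<close>] by (simp add: mult.commute)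
  qed
  have eval_int: "integrable M (\<lambda>x. f x \<phi>)" if "\<phi> \<in> X" for \<phi>
  proof (rule Bochner_Integration.integrable_bound)
    show "integrable M (\<lambda>x. nE (f x) * gn \<phi>)" using nE_int by simp
    show "AE x in M. norm (f x \<phi>) \<le> norm (nE (f x) * gn \<phi>)"
      using nE_bound[OF memf that] by (intro AE_I2) (force simp: abs_of_nonneg nE_nonneg[OF memf] gn_nonneg)
  qed (rule eval_meas[OF that])
  define I where "I = (\<lambda>\<phi>. if \<phi> \<in> X then (\<integral>x. f x \<phi> \<partial>M) else 0)"
  have I_E: "I \<in> E"
  proof (rule E_I[where M = "\<integral>x. nE (f x) \<partial>M"])
    show "I (\<phi> + \<psi>) = I \<phi> + I \<psi>" if "\<phi> \<in> X" "\<psi> \<in> X" for \<phi> \<psi>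
    proof -
      have "(\<integral>x. f x (\<phi> + \<psi>) \<partial>M) = (\<integral>x. f x \<phi> + f x \<psi> \<partial>M)"
        using that by (intro Bochner_Integration.integral_cong) (auto simp: E_add memf)
      then show ?thesis using that by (simp add: I_def X_add eval_int)
    qed
    show "I (c *\<^sub>C \<phi>) = cnj c * I \<phi>" if "\<phi> \<in> X" for c \<phi>
    proof -
      have "(\<integral>x. f x (c *\<^sub>C \<phi>) \<partial>M) = (\<integral>x. cnj c * f x \<phi> \<partial>M)"
        using that by (intro Bochner_Integration.integral_cong) (auto simp: E_scaleC memf)
      then show ?thesis using that by (simp add: I_def X_scaleC)
    qed
    show "cmod (I \<phi>) \<le> (\<integral>x. nE (f x) \<partial>M) * gn \<phi>" if "\<phi> \<in> X" for \<phi>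
    proof -
      have "cmod (\<integral>x. f x \<phi> \<partial>M) \<le> (\<integral>x. nE (f x) * gn \<phi> \<partial>M)"
      proof (rule norm_integral_le)
        show "norm (f x \<phi>) \<le> nE (f x) * gn \<phi>" if "x \<in> space M" for x
          using nE_bound[OF memf[OF that] \<open>\<phi> \<in> X\<close>] .
      qed (use eval_int[OF that] nE_int in auto)
      then show ?thesis using that by (simp add: I_def)
    qed
  qed (simp add: I_def)
  obtain s where s: "\<And>i::nat. simple_function M (s i)" and sE: "\<And>i x. x \<in> space M \<Longrightarrow> s i x \<in> E"
    and lim: "(\<lambda>i. \<integral>\<^sup>+x. ennreal (nE (f x - s i x)) \<partial>M) \<longlonglongrightarrow> 0"
    using sm_L1_approximation[OF f fin] by blast
  have sint: "Bochner_Integration.simple_bochner_integrable M (s i)" for i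
    using emeasure_finite s by (intro Bochner_Integration.simple_bochner_integrable.intros) auto
  have meas: "(\<lambda>x. nE (f x - s i x)) \<in> borel_measurable M" for i
    by (intro sm_norm_measurable sm_diff f sm_simple s sE)
  have dE: "x \<in> space M \<Longrightarrow> f x - s i x \<in> E" for i x
    by (intro E_diff memf sE)
  \<comment> \<open>The norm \<open>nE\<close> is tested on single vectors, and for each
    \<open>\<phi>\<close> the error is a scalar integral bounded by the integral of
    \<open>nE (f x - s i x)\<close> times \<open>gn \<phi>\<close>.\<close>
  have est: "ennreal (nE (Bochner_Integration.simple_bochner_integral M (s i) - I)) \<le> (\<integral>\<^sup>+x. ennreal (nE (f x - s i x)) \<partial>M)" for i
  proof (cases "(\<integral>\<^sup>+x. ennreal (nE (f x - s i x)) \<partial>M) < \<infinity>")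
    case True
    have int: "integrable M (\<lambda>x. nE (f x - s i x))"
      using meas[of i] True nV_nonneg[OF dE]
        nn_integral_cong[of M "\<lambda>x. ennreal (nE (f x - s i x))" "\<lambda>x. ennreal (norm (nE (f x - s i x)))"]
      by (intro integrableI_bounded) auto
    have "nE (Bochner_Integration.simple_bochner_integral M (s i) - I) \<le> (\<integral>x. nE (f x - s i x) \<partial>M)"
    proof (rule nE_least)
      show "0 \<le> (\<integral>x. nE (f x - s i x) \<partial>M)"
        using nE_nonneg[OF dE] by (intro Bochner_Integration.integral_nonneg) auto
      fix \<phi> assume \<phi>: "\<phi> \<in> X"
      have sint': "Bochner_Integration.simple_bochner_integrable M (\<lambda>x. s i x \<phi>)"
        using simple_bochner_integrable_compose2[of "\<lambda>f g. f \<phi>", OF _ sint[of i] sint[of i]] by simp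
      have "Bochner_Integration.simple_bochner_integral M (s i) \<phi> = Bochner_Integration.simple_bochner_integral M (\<lambda>x. s i x \<phi>)"
        using simple_bochner_integral_linear[OF linear_eval[of \<phi>] sint[of i]] by simp
      also have "\<dots> = (\<integral>x. s i x \<phi> \<partial>M)"
        by (rule simple_bochner_integrable_eq_integral[OF sint'])
      finally have "(Bochner_Integration.simple_bochner_integral M (s i) - I) \<phi> = - (\<integral>x. f x \<phi> - s i x \<phi> \<partial>M)"
        using \<phi> eval_int[OF \<phi>] integrableI_simple_bochner_integrable[OF sint']
        by (simp add: I_def)
      also have "cmod \<dots> \<le> (\<integral>x. nE (f x - s i x) * gn \<phi> \<partial>M)"
        unfolding norm_minus_cancel
      proof (rule norm_integral_le)
        show "norm (f x \<phi> - s i x \<phi>) \<le> nE (f x - s i x) * gn \<phi>" if "x \<in> space M" for x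
          using nE_bound[OF dE[OF that] \<phi>, of i] by simp
      qed (use eval_int[OF \<phi>] integrableI_simple_bochner_integrable[OF sint'] int in auto)
      finally show "cmod ((Bochner_Integration.simple_bochner_integral M (s i) - I) \<phi>) \<le> (\<integral>x. nE (f x - s i x) \<partial>M) * gn \<phi>"
        by (simp only: integral_mult_left_zero)
    qed
    then have "ennreal (nE (Bochner_Integration.simple_bochner_integral M (s i) - I)) \<le> ennreal (\<integral>x. nE (f x - s i x) \<partial>M)"
      by (rule ennreal_leI)
    also have "\<dots> = (\<integral>\<^sup>+x. ennreal (nE (f x - s i x)) \<partial>M)"
      using nE_nonneg[OF dE] by (intro nn_integral_eq_integral[symmetric] int) auto
    finally show ?thesis .
  qed (simp add: not_less top_unique)
  have intE: "Bochner_Integration.simple_bochner_integral M (s i) - I \<in> E" for i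
    unfolding Bochner_Integration.simple_bochner_integral_def
    using sE by (intro E_diff I_E subspace_sum[OF subspace_E] subspace_scale[OF subspace_E]) auto
  have "(\<lambda>i. ennreal (nE (Bochner_Integration.simple_bochner_integral M (s i) - I))) \<longlonglongrightarrow> 0"
    by (rule tendsto_sandwich[OF _ _ tendsto_const lim]) (use est in auto)
  then have "(\<lambda>i. nE (Bochner_Integration.simple_bochner_integral M (s i) - I)) \<longlonglongrightarrow> 0"
    by (intro tendsto_ennrealD[where x = 0]) (simp_all add: nE_nonneg intE)
  then have hbi: "has_bochner_integral_on E nE M f I"
    unfolding has_bochner_integral_on_def using f I_E sint sE lim by blast
  \<comment> \<open>Evaluations separate the elements of \<open>E\<close>, and each evaluation of an
    integral is a scalar integral; this justifies the definite description.\<close>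
  have unique: "I' = I" if "has_bochner_integral_on E nE M f I'" for I'
  proof (rule E_eqI)
    fix \<phi> assume \<phi>: "\<phi> \<in> X"
    have "has_bochner_integral M (\<lambda>x. f x \<phi>) (I' \<phi>)"
      by (rule has_bochner_integral_functional[OF that linear_eval, where C = "gn \<phi>"])
        (use nE_bound[OF _ \<phi>] gn_nonneg in \<open>auto simp: mult.commute\<close>)
    then show "I' \<phi> = I \<phi>"
      using \<phi> by (simp add: I_def has_bochner_integral_integral_eq)
  qed (use that I_E in \<open>auto simp: has_bochner_integral_on_def\<close>)
  have "bochner_integral_on E nE M f = I"
    unfolding bochner_integral_on_def using hbi unique by (intro the_equality)
  then show "bochner_integral_on E nE M f \<in> E"
    and "\<phi> \<in> X \<Longrightarrow> integrable M (\<lambda>x. f x \<phi>)"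
    and "\<phi> \<in> X \<Longrightarrow> bochner_integral_on E nE M f \<phi> = (\<integral>x. f x \<phi> \<partial>M)"
    using I_E eval_int by (auto simp: I_def)
qed

end

section \<open>The control system\<close>

lemma L2_empty: "L2 (lebesgue_on {}) f" for f :: "real \<Rightarrow> 'b::real_normed_vector"
  unfolding L2_restrict[OF sets.empty_sets]
  by (auto simp: L2_def sq_integral_def intro!: strongly_measurable_normI[where s = "\<lambda>_ _. 0"])

lemma complete_measure_halfline: "complete_measure (lebesgue_on {0::real<..})"
  by (intro complete_measure_lebesgue_on) auto

locale control_system = extended_semigroup D A S SE
  for D :: "'h::complex_hilbert set" and A S SE +
  fixes B :: "'u::complex_hilbert \<Rightarrow> ('h \<Rightarrow> complex)"
  assumes B: "bounded_clinear_on UNIV norm (extrap_space D A) (extrap_norm D A) B"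
    and input_continuous: "input_map_continuous D A SE B"
begin

abbreviation "L \<equiv> input_map D A SE B"
abbreviation "sol \<equiv> solution D A S SE B"
abbreviation "lebs t \<equiv> lebesgue_on {0<..<t::real}"

lemma B_mem: "B x \<in> E"
  and B_add: "B (x + y) = B x + B y"
  and B_scaleC: "B (c *\<^sub>C x) = c *\<^sub>C B x"
  using B by (auto simp: bounded_clinear_on_def)

lemma B_diff: "B (x - y) = B x - B y"
  using B_add[of "x - y" y] by simp

definition CB :: real
  where "CB = (SOME C. 0 \<le> C \<and> (\<forall>x. nE (B x) \<le> C * norm x))"

lemma CB: "0 \<le> CB" "nE (B x) \<le> CB * norm x"
proof -
  obtain C where C: "\<And>x. nE (B x) \<le> C * norm x"
    using B by (auto simp: bounded_clinear_on_def)
  have "nE (B x) \<le> \<bar>C\<bar> * norm x" for x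
    using order_trans[OF C mult_right_mono[OF abs_ge_self norm_ge_zero]] .
  then have "\<exists>C. 0 \<le> C \<and> (\<forall>x. nE (B x) \<le> C * norm x)" by (intro exI[of _ "\<bar>C\<bar>"]) auto
  from someI_ex[OF this] show "0 \<le> CB" "nE (B x) \<le> CB * norm x"
    unfolding CB_def by blast+
qed

lemma complete_measure_lebs: "complete_measure (lebs t)"
  by (intro complete_measure_lebesgue_on) auto

lemma finite_measure_lebs: "finite_measure (lebs t)"
  by (intro finite_measure_lebesgue_on) (auto intro: bounded_set_imp_lmeasurable)

lemma emeasure_lebs: "emeasure (lebs t) (space (lebs t)) < \<infinity>"
  using finite_measure.emeasure_finite[OF finite_measure_lebs] by (simp add: less_top[symmetric])

text \<open>Rounding down to multiples of \<open>1 / (i + 1)\<close> takes finitely many values on a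
  bounded interval, and for times in \<open>(0, t)\<close> it keeps both the rounded time and its
  distance to \<open>t\<close> within \<open>[0, t]\<close>.\<close>

definition grid :: "nat \<Rightarrow> real \<Rightarrow> real"
  where "grid i x = of_int \<lfloor>real (Suc i) * x\<rfloor> / real (Suc i)"

lemma grid_bounds: "x - 1 / real (Suc i) \<le> grid i x" "grid i x \<le> x" "0 \<le> x \<Longrightarrow> 0 \<le> grid i x"
proof -
  define n where "n = real (Suc i)"
  have n: "n > 0" by (simp add: n_def)
  have "n * x - 1 \<le> of_int \<lfloor>n * x\<rfloor>" "of_int \<lfloor>n * x\<rfloor> \<le> n * x"
    by linarith+
  then have "(n * x - 1) / n \<le> of_int \<lfloor>n * x\<rfloor> / n" "of_int \<lfloor>n * x\<rfloor> / n \<le> n * x / n"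
    using n by (simp_all only: divide_right_mono less_imp_le)
  then show "x - 1 / real (Suc i) \<le> grid i x" "grid i x \<le> x"
    unfolding grid_def n_def[symmetric] using n by (simp_all add: diff_divide_distrib)
  show "0 \<le> grid i x" if "0 \<le> x" using that by (auto simp: grid_def)
qed

lemma grid_tendsto: "(\<lambda>i. grid i x) \<longlonglongrightarrow> x"
proof (rule tendsto_sandwich)
  show "(\<lambda>i. x - 1 / real (Suc i)) \<longlonglongrightarrow> x"
    using tendsto_diff[OF tendsto_const[of x] LIMSEQ_Suc[OF lim_1_over_n]] by simp
qed (use grid_bounds in auto)

lemma grid_simple: "simple_function (lebs t) (grid i)"
proof (rule simple_function_borel_measurable)
  have "(\<lambda>x::real. x) \<in> borel_measurable (lebs t)"
    using id_borel_measurable_lebesgue_on[of "{0<..<t}"] by (simp add: id_def)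
  then show "grid i \<in> borel_measurable (lebs t)"
    unfolding grid_def
    by (intro borel_measurable_divide measurable_compose[OF _ borel_measurable_real_floor]
        borel_measurable_times borel_measurable_const)
  have "grid i ` space (lebs t) \<subseteq> (\<lambda>k. of_int k / real (Suc i)) ` {0..\<lfloor>real (Suc i) * t\<rfloor>}"
  proof
    fix y assume "y \<in> grid i ` space (lebs t)"
    then obtain x where x: "0 < x" "x < t" "y = grid i x" by auto
    then have "real (Suc i) * x \<le> real (Suc i) * t" by (intro mult_left_mono) auto
    then have "\<lfloor>real (Suc i) * x\<rfloor> \<in> {0..\<lfloor>real (Suc i) * t\<rfloor>}" using x by (auto intro: floor_mono simp del: of_nat_Suc)
    then show "y \<in> (\<lambda>k. of_int k / real (Suc i)) ` {0..\<lfloor>real (Suc i) * t\<rfloor>}"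
      using x by (auto simp: grid_def)
  qed
  then show "finite (grid i ` space (lebs t))" by (rule finite_subset) auto
qed

lemma SE_tendsto_grid:
  assumes f: "f \<in> E" and x: "0 < x" "x < t"
  shows "(\<lambda>i. nE (SE (t - x) f - SE (t - grid i x) f)) \<longlonglongrightarrow> 0"
proof (rule tendstoI)
  fix e :: real assume e: "0 < e"
  obtain d where "d > 0"
    and d: "\<And>s r. 0 \<le> s \<Longrightarrow> s \<le> t \<Longrightarrow> 0 \<le> r \<Longrightarrow> r \<le> t \<Longrightarrow> \<bar>s - r\<bar> < d \<Longrightarrow> nE (SE s f - SE r f) < e"
    using E.S_uniformly_continuous[OF f e, where T = t] by metis
  have "eventually (\<lambda>i. dist (grid i x) x < d) sequentially"
    using tendstoD[OF grid_tendsto \<open>d > 0\<close>] .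
  then show "eventually (\<lambda>i. dist (nE (SE (t - x) f - SE (t - grid i x) f)) 0 < e) sequentially"
  proof eventually_elim
    fix i assume "dist (grid i x) x < d"
    then have "nE (SE (t - x) f - SE (t - grid i x) f) < e"
      using x grid_bounds(2)[where i = i and x = x] grid_bounds(3)[where i = i and x = x] by (intro d) (auto simp: dist_real_def)
    moreover have "0 \<le> nE (SE (t - x) f - SE (t - grid i x) f)"
      using x f grid_bounds(2)[where i = i and x = x] by (intro nE_nonneg E_diff E.S_mem) auto
    ultimately show "dist (nE (SE (t - x) f - SE (t - grid i x) f)) 0 < e" by (simp add: dist_real_def)
  qed
qed

text \<open>Simple approximants come from rounding the time in the semigroup and approximating the
  control at once. The first error is small by strong continuity in \<open>E\<close>, the second by
  the local bound on the semigroup.\<close>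

lemma integrand_strongly_measurable:
  assumes u: "strongly_measurable UNIV norm (lebs t) u"
  shows "strongly_measurable E nE (lebs t) (\<lambda>s. SE (t - s) (B (u s)))"
proof -
  interpret strong_measurability "lebs t" E nE
    by (intro strong_measurability.intro complete_measure_lebs seminorm_on_E)
  obtain M where M: "M \<ge> 1" "\<And>s f. 0 \<le> s \<Longrightarrow> s \<le> t \<Longrightarrow> f \<in> E \<Longrightarrow> nE (SE s f) \<le> M * nE f"
    using E.S_locally_bounded[where T = t] by blast
  obtain s where s: "\<And>i::nat. simple_function (lebs t) (s i)"
    and lim: "AE x in lebs t. (\<lambda>i. norm (u x - s i x)) \<longlonglongrightarrow> 0"
    using u unfolding strongly_measurable_def by blast
  show ?thesis
  proof (rule sm_intro)
    show "SE (t - x) (B (u x)) \<in> E" if "x \<in> space (lebs t)" for x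
      using that by (intro E.S_mem B_mem) auto
    show "simple_function (lebs t) (\<lambda>x. SE (t - grid i x) (B (s i x)))" for i
      by (rule simple_function_compose2[OF grid_simple s])
    show "SE (t - grid i x) (B (s i x)) \<in> E" if "x \<in> space (lebs t)" for i x
      using that grid_bounds(2)[where i = i and x = x] by (intro E.S_mem B_mem) auto
    show "AE x in lebs t. (\<lambda>i. nE (SE (t - x) (B (u x)) - SE (t - grid i x) (B (s i x)))) \<longlonglongrightarrow> 0"
      using lim AE_space
    proof eventually_elim
      fix x assume lim: "(\<lambda>i. norm (u x - s i x)) \<longlonglongrightarrow> 0" and "x \<in> space (lebs t)"
      then have x: "0 < x" "x < t" by auto
      have g: "0 \<le> t - grid i x" "t - grid i x \<le> t" for i
        using grid_bounds(2)[where i = i and x = x] grid_bounds(3)[where i = i and x = x] x by auto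
      have mem: "SE (t - x) (B (u x)) \<in> E" "SE (t - grid i x) (B v) \<in> E" for i v
        using x g by (auto intro!: E.S_mem B_mem)
      show "(\<lambda>i. nE (SE (t - x) (B (u x)) - SE (t - grid i x) (B (s i x)))) \<longlonglongrightarrow> 0"
      proof (rule tendsto_sandwich[OF _ _ tendsto_const])
        show "(\<lambda>i. nE (SE (t - x) (B (u x)) - SE (t - grid i x) (B (u x))) + M * CB * norm (u x - s i x)) \<longlonglongrightarrow> 0"
          using tendsto_add[OF SE_tendsto_grid[OF B_mem x] tendsto_mult[OF tendsto_const[of "M * CB"] lim]] by simp
        show "eventually (\<lambda>i. 0 \<le> nE (SE (t - x) (B (u x)) - SE (t - grid i x) (B (s i x)))) sequentially"
          by (intro always_eventually allI nE_nonneg E_diff mem)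
        show "eventually (\<lambda>i. nE (SE (t - x) (B (u x)) - SE (t - grid i x) (B (s i x)))
          \<le> nE (SE (t - x) (B (u x)) - SE (t - grid i x) (B (u x))) + M * CB * norm (u x - s i x)) sequentially"
        proof (intro always_eventually allI)
          fix i
          have "SE (t - grid i x) (B (u x)) - SE (t - grid i x) (B (s i x)) = SE (t - grid i x) (B (u x - s i x))"
            using g by (simp add: B_diff E.S_diff B_mem)
          moreover have "nE (SE (t - grid i x) (B (u x - s i x))) \<le> M * (CB * norm (u x - s i x))"
            using M(1) order_trans[OF M(2)[OF g B_mem] mult_left_mono[OF CB(2)]] by simp
          ultimately have "nE (SE (t - grid i x) (B (u x)) - SE (t - grid i x) (B (s i x))) \<le> M * CB * norm (u x - s i x)"
            by (simp add: mult.assoc)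
          then show "nE (SE (t - x) (B (u x)) - SE (t - grid i x) (B (s i x)))
            \<le> nE (SE (t - x) (B (u x)) - SE (t - grid i x) (B (u x))) + M * CB * norm (u x - s i x)"
            using E.nV_triangle_diff[OF mem(1) mem(2)[of i "u x"] mem(2)[of i "s i x"]] by linarith
        qed
      qed
    qed
  qed
qed

lemma integrand_bound:
  obtains K where "0 \<le> K" "\<And>s v. 0 \<le> s \<Longrightarrow> s \<le> t \<Longrightarrow> nE (SE s (B v)) \<le> K * norm v"
proof -
  obtain M where M: "M \<ge> 1" "\<And>s f. 0 \<le> s \<Longrightarrow> s \<le> t \<Longrightarrow> f \<in> E \<Longrightarrow> nE (SE s f) \<le> M * nE f"
    using E.S_locally_bounded[where T = t] by blast
  show ?thesis
  proof (rule that[of "M * CB"])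
    show "nE (SE s (B v)) \<le> M * CB * norm v" if "0 \<le> s" "s \<le> t" for s v
      using M(1) order_trans[OF M(2)[OF that B_mem] mult_left_mono[OF CB(2)]] by (simp add: mult.assoc)
  qed (use M CB in auto)
qed

lemma
  assumes u: "L2 (lebs t) u"
  shows L_in_E: "L u t \<in> E"
    and L_integrable: "\<phi> \<in> X \<Longrightarrow> integrable (lebs t) (\<lambda>s. B (u s) (Sad (t - s) \<phi>))"
    and L_apply: "\<phi> \<in> X \<Longrightarrow> L u t \<phi> = (\<integral>s. B (u s) (Sad (t - s) \<phi>) \<partial>lebs t)"
proof -
  have um: "strongly_measurable UNIV norm (lebs t) u" using u by (simp add: L2_def)
  obtain K where K: "0 \<le> K" "\<And>s v. 0 \<le> s \<Longrightarrow> s \<le> t \<Longrightarrow> nE (SE s (B v)) \<le> K * norm v"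
    using integrand_bound[where t = t] by blast
  have "(\<integral>\<^sup>+s. ennreal (nE (SE (t - s) (B (u s)))) \<partial>lebs t) \<le> (\<integral>\<^sup>+s. ennreal K * ennreal (norm (u s)) \<partial>lebs t)"
    using K by (intro nn_integral_mono) (auto simp flip: ennreal_mult intro!: ennreal_leI)
  also have "\<dots> = ennreal K * (\<integral>\<^sup>+s. ennreal (norm (u s)) \<partial>lebs t)"
    by (intro nn_integral_cmult measurable_compose[OF strong_measurability.sm_norm_measurable[OF
          strong_measurability_norm[OF complete_measure_lebs] um] measurable_ennreal])
  also have "\<dots> < \<infinity>"
    using complete_measure.L2_imp_L1[OF complete_measure_lebs u emeasure_lebs] by (simp add: ennreal_mult_less_top)
  finally have fin: "(\<integral>\<^sup>+s. ennreal (nE (SE (t - s) (B (u s)))) \<partial>lebs t) < \<infinity>" .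
  note * = bochner_integral_on_E[OF complete_measure_lebs finite_measure_lebs integrand_strongly_measurable[OF um] fin]
  have eq: "SE (t - s) (B (u s)) \<phi> = B (u s) (Sad (t - s) \<phi>)" if "s \<in> space (lebs t)" "\<phi> \<in> X" for s \<phi>
    using that by (intro SE_apply B_mem) auto
  show "L u t \<in> E" using * by (simp add: input_map_def)
  show "\<phi> \<in> X \<Longrightarrow> integrable (lebs t) (\<lambda>s. B (u s) (Sad (t - s) \<phi>))"
    using *(2)[of \<phi>] eq[of _ \<phi>]
    by (subst Bochner_Integration.integrable_cong[OF refl, where g = "\<lambda>s. SE (t - s) (B (u s)) \<phi>"]) auto
  show "\<phi> \<in> X \<Longrightarrow> L u t \<phi> = (\<integral>s. B (u s) (Sad (t - s) \<phi>) \<partial>lebs t)"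
    unfolding input_map_def
    by (rule trans[OF *(3)], assumption, rule Bochner_Integration.integral_cong) (simp_all add: eq)
qed

text \<open>The value at a fixed time depends on the control only through its class on
  \<open>(0, t)\<close>. This causality allows the tail of a concatenated control to be
  ignored.\<close>

lemma L_cong:
  assumes u: "L2 (lebs t) u" and eq: "AE s in lebs t. u s = v s"
  shows "L u t = L v t"
proof (rule E_eqI)
  have v: "L2 (lebs t) v"
    using complete_measure.L2_AE_eq[OF complete_measure_lebs u eq] .
  show "L u t \<in> E" "L v t \<in> E" using u v by (auto intro: L_in_E)
  fix \<phi> assume \<phi>: "\<phi> \<in> X"
  show "L u t \<phi> = L v t \<phi>"
    unfolding L_apply[OF u \<phi>] L_apply[OF v \<phi>]
    using L_integrable[OF u \<phi>] L_integrable[OF v \<phi>] eq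
    by (intro integral_cong_AE) (auto elim: eventually_mono)
qed

lemma L_add:
  assumes u: "L2 (lebs t) u" and v: "L2 (lebs t) v"
  shows "L (\<lambda>s. u s + v s) t = L u t + L v t"
proof (rule E_eqI)
  have uv: "L2 (lebs t) (\<lambda>s. u s + v s)"
    using complete_measure.L2_add[OF complete_measure_lebs u v] .
  show "L (\<lambda>s. u s + v s) t \<in> E" "L u t + L v t \<in> E" using u v uv by (auto intro: L_in_E E_plus)
  fix \<phi> assume \<phi>: "\<phi> \<in> X"
  show "L (\<lambda>s. u s + v s) t \<phi> = (L u t + L v t) \<phi>"
    unfolding L_apply[OF uv \<phi>] plus_fun_apply L_apply[OF u \<phi>] L_apply[OF v \<phi>] B_add
    by (intro Bochner_Integration.integral_add L_integrable u v \<phi>)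
qed

lemma L_scaleC:
  assumes u: "L2 (lebs t) u"
  shows "L (\<lambda>s. c *\<^sub>C u s) t = c *\<^sub>C L u t"
proof (rule E_eqI)
  have cu: "L2 (lebs t) (\<lambda>s. c *\<^sub>C u s)"
    using complete_measure.L2_scaleC[OF complete_measure_lebs u] by blast
  show "L (\<lambda>s. c *\<^sub>C u s) t \<in> E" "c *\<^sub>C L u t \<in> E" using u cu by (auto intro: L_in_E E_scaleC_mem)
  fix \<phi> assume \<phi>: "\<phi> \<in> X"
  show "L (\<lambda>s. c *\<^sub>C u s) t \<phi> = (c *\<^sub>C L u t) \<phi>"
    unfolding scaleC_fun_def scaleC_complex_def L_apply[OF cu \<phi>] L_apply[OF u \<phi>]
    by (simp add: B_scaleC scaleC_fun_def scaleC_complex_def)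
qed

lemma S_strongly_measurable: "strongly_measurable UNIV norm (lebs T) (\<lambda>t. S t y)"
proof (rule strongly_measurable_normI)
  show "simple_function (lebs T) (\<lambda>t. S (grid i t) y)" for i
    by (rule simple_function_compose1[OF grid_simple])
  show "AE t in lebs T. (\<lambda>i. norm (S t y - S (grid i t) y)) \<longlonglongrightarrow> 0"
  proof (rule AE_I2)
    fix t assume "t \<in> space (lebs T)"
    then have t: "0 < t" "t < T" by auto
    have "((\<lambda>s. S s y) \<longlongrightarrow> S t y) (at t within {0..T})"
      using continuous_S[of T y] t by (auto simp: continuous_on_def)
    then have "continuous (at t within {0..T}) (\<lambda>s. S s y)"
      by (simp add: continuous_within)
    then have "(\<lambda>i. S (grid i t) y) \<longlonglongrightarrow> S t y"
      using t grid_tendsto grid_bounds(2)[where x = t] grid_bounds(3)[where x = t]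
      by (intro continuous_within_tendsto_compose'[where S = "{0..T}" and a = t and f = "\<lambda>s. S s y"])
        (auto intro: order_trans[OF grid_bounds(2)] less_imp_le)
    from tendsto_norm[OF tendsto_diff[OF tendsto_const[of "S t y"] this]]
    show "(\<lambda>i. norm (S t y - S (grid i t) y)) \<longlonglongrightarrow> 0" by simp
  qed
qed

lemma S_L2: "L2 (lebs T) (\<lambda>t. S t y)"
proof -
  obtain N where N: "N \<ge> 1" "\<And>s f. 0 \<le> s \<Longrightarrow> s \<le> T \<Longrightarrow> norm (S s f) \<le> N * norm f"
    using H.S_locally_bounded[where T = T] by auto
  have "sq_integral (lebs T) (\<lambda>t. S t y) \<le> (\<integral>\<^sup>+t. ennreal ((N * norm y)\<^sup>2) \<partial>lebs T)"
    unfolding sq_integral_def using N(2) by (intro nn_integral_mono ennreal_leI power_mono) auto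
  also have "\<dots> < \<infinity>"
    using emeasure_lebs[of T] by (simp add: ennreal_mult_less_top)
  finally show ?thesis using S_strongly_measurable by (simp add: L2_def)
qed

text \<open>Countably many bounded intervals exhaust the half-line; the continuity hypothesis on the
  input map speaks of bounded ones only.\<close>

lemma AE_halfline: "(AE t in lebesgue_on {0<..}. P t) \<longleftrightarrow> (\<forall>n::nat. AE t in lebs (real (Suc n)). P t)"
proof -
  have "(AE t in lebesgue_on {0<..}. P t) \<longleftrightarrow> (AE t in lebesgue. \<forall>n::nat. t \<in> {0<..<real (Suc n)} \<longrightarrow> P t)"
  proof -
    have "(t \<in> {0<..} \<longrightarrow> P t) \<longleftrightarrow> (\<forall>n::nat. t \<in> {0<..<real (Suc n)} \<longrightarrow> P t)" for t :: real
    proof -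
      obtain n :: nat where "t < real n" using reals_Archimedean2 by blast
      then have "t < real (Suc n)" by simp
      then show ?thesis by (auto simp del: of_nat_Suc)
    qed
    then show ?thesis by (subst AE_restrict_space_iff) auto
  qed
  also have "\<dots> \<longleftrightarrow> (\<forall>n::nat. AE t in lebs (real (Suc n)). P t)"
    unfolding AE_all_countable by (subst AE_restrict_space_iff) auto
  finally show ?thesis .
qed

lemma L2_loc_imp_L2: "L2_loc u \<Longrightarrow> L2 (lebs t) u"
  by (cases "t > 0") (auto simp: L2_loc_def L2_empty)

lemma L2_halfline_imp_loc: "L2 (lebesgue_on {0<..}) u \<Longrightarrow> L2_loc u"
  unfolding L2_loc_def by (auto intro!: L2_subset[of "{0<..<_}" "{0<..}" u])

lemma
  assumes "0 < T" "L2 (lebs T) u"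
  shows L_in_range_interval: "AE t in lebs T. L u t \<in> range emb"
    and inv_L_L2: "L2 (lebs T) (\<lambda>t. inv emb (L u t))"
proof -
  note * = input_continuous[unfolded input_map_continuous_def Let_def, rule_format, OF assms(1)]
  obtain C where "\<forall>u. L2 (lebs T) u \<longrightarrow> (AE t in lebs T. L u t \<in> range emb) \<and> L2 (lebs T) (\<lambda>t. inv emb (L u t)) \<and>
      sq_integral (lebs T) (\<lambda>t. inv emb (L u t)) \<le> ennreal (C\<^sup>2) * sq_integral (lebs T) u"
    using *[THEN conjunct2, THEN conjunct2] ..
  from this[rule_format, OF assms(2)]
  show "AE t in lebs T. L u t \<in> range emb" "L2 (lebs T) (\<lambda>t. inv emb (L u t))" by simp_all
qed

lemma L_in_range: assumes "L2_loc u" shows "AE t in lebesgue_on {0<..}. L u t \<in> range emb"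
  unfolding AE_halfline
  by (intro allI L_in_range_interval L2_loc_imp_L2 assms) simp

text \<open>The inverse of the embedding is meaningful only on its range, so reading an equation in
  \<open>E\<close> off \<open>sol\<close> needs a value in \<open>H\<close>.\<close>

lemma emb_sol: assumes "L u t \<in> range emb" shows "emb (sol y u t) = emb (S t y) + L u t"
proof -
  obtain x where x: "L u t = emb x" using assms by blast
  show ?thesis unfolding solution_def x emb_add[symmetric] inv_emb ..
qed

text \<open>Conversely, a candidate in \<open>H\<close> that solves the equation in \<open>E\<close>
  is the state; membership in the range is then witnessed by the candidate itself.\<close>

lemma sol_eqI: "emb z = emb (S t y) + L u t \<Longrightarrow> sol y u t = z"
  unfolding solution_def by (metis inv_emb)

lemma sol_L2:
  assumes u: "L2_loc u" shows "L2 (lebs T) (sol y u)"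
proof (cases "T > 0")
  case True
  then have i: "L2 (lebs T) (\<lambda>t. inv emb (L u t))" "AE t in lebs T. L u t \<in> range emb"
    using inv_L_L2 L_in_range_interval L2_loc_imp_L2[OF u, of T] by blast+
  have "AE t in lebs T. S t y + inv emb (L u t) = sol y u t"
    using i(2)
  proof eventually_elim
    fix t assume "L u t \<in> range emb"
    then obtain x where x: "L u t = emb x" by blast
    show "S t y + inv emb (L u t) = sol y u t"
      unfolding solution_def x emb_add[symmetric] inv_emb ..
  qed
  then show ?thesis
    by (rule complete_measure.L2_AE_eq[OF complete_measure_lebs
        complete_measure.L2_add[OF complete_measure_lebs S_L2 i(1)]])
qed (auto simp: L2_empty)

lemma sol_add:
  assumes "L2_loc u" "L2_loc v" "L u t \<in> range emb" "L v t \<in> range emb" "0 < t"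
  shows "sol (x + y) (\<lambda>s. u s + v s) t = sol x u t + sol y v t"
  using assms by (intro sol_eqI)
    (simp add: emb_add emb_sol H.S_add L_add[OF L2_loc_imp_L2 L2_loc_imp_L2])

lemma sol_scaleC:
  assumes "L2_loc u" "L u t \<in> range emb" "0 < t"
  shows "sol (c *\<^sub>C x) (\<lambda>s. c *\<^sub>C u s) t = c *\<^sub>C sol x u t"
  using assms by (intro sol_eqI)
    (simp add: emb_scaleC emb_sol H.S_scaleC L_scaleC[OF L2_loc_imp_L2] scaleC_add_right)

end

section \<open>Concatenation of controls and trajectories\<close>

definition concat_at :: "real \<Rightarrow> (real \<Rightarrow> 'b) \<Rightarrow> (real \<Rightarrow> 'b) \<Rightarrow> real \<Rightarrow> 'b"
  where "concat_at t u v s = (if s < t then u s else v (s - t))"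

lemma AE_lebesgue_neq: "AE x in lebesgue. x \<noteq> (a::real)"
  by (simp add: completion.AE_iff_null_sets)

text \<open>The abstract sets \<open>T\<close> and \<open>T'\<close> let one statement serve bounded
  intervals and the half-line. The time \<open>t\<close> itself is exempt from the condition on
  \<open>T'\<close>, as a single point is a null set.\<close>

lemma L2_concat_at:
  fixes u v :: "real \<Rightarrow> 'b::real_normed_vector"
  assumes T: "T \<in> sets lebesgue" "T \<subseteq> {0<..}" and T': "T' \<in> sets lebesgue"
    and TT': "\<And>r. r \<noteq> t \<Longrightarrow> r \<in> T' \<longleftrightarrow> (0 < r \<and> r < t) \<or> r - t \<in> T"
    and u: "L2 (lebesgue_on {0<..<t}) u" and v: "L2 (lebesgue_on T) v"
  shows "L2 (lebesgue_on T') (concat_at t u v)"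
    and "sq_integral (lebesgue_on T') (concat_at t u v) = sq_integral (lebesgue_on {0<..<t}) u + sq_integral (lebesgue_on T) v"
proof -
  have I: "{0<..<t} \<in> sets lebesgue" by simp
  let ?a = "\<lambda>r. indicator {0<..<t} r *\<^sub>R u r" and ?b = "\<lambda>r. indicator T r *\<^sub>R v r"
  have a: "L2 lebesgue ?a" and b: "L2 lebesgue ?b"
    using u v unfolding L2_restrict[OF I] L2_restrict[OF T(1)] .
  note b' = L2_shift[OF b, of t]
  have eq: "AE r in lebesgue. ?a r + ?b (r - t) = indicator T' r *\<^sub>R concat_at t u v r"
    using AE_lebesgue_neq[of t]
  proof eventually_elim
    fix r assume r: "r \<noteq> t"
    show "?a r + ?b (r - t) = indicator T' r *\<^sub>R concat_at t u v r"
      using TT'[OF r] T(2) r by (auto simp: indicator_def concat_at_def)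
  qed
  show "L2 (lebesgue_on T') (concat_at t u v)"
    unfolding L2_restrict[OF T'] by (rule completion.L2_AE_eq[OF completion.L2_add[OF a b'(1)] eq])
  have "sq_integral (lebesgue_on T') (concat_at t u v) = sq_integral lebesgue (\<lambda>r. ?a r + ?b (r - t))"
    unfolding sq_integral_restrict[OF T'] using sq_integral_cong_AE[OF eq] by simp
  also have "\<dots> = (\<integral>\<^sup>+r. ennreal ((norm (?a r))\<^sup>2) + ennreal ((norm (?b (r - t)))\<^sup>2) \<partial>lebesgue)"
    unfolding sq_integral_def
  proof (rule nn_integral_cong)
    fix r
    \<comment> \<open>The two pieces have disjoint supports, so squares of norms add without a cross
      term.\<close>
    have "?a r = 0 \<or> ?b (r - t) = 0" using T(2) by (auto simp: indicator_def)
    then show "ennreal ((norm (?a r + ?b (r - t)))\<^sup>2) = ennreal ((norm (?a r))\<^sup>2) + ennreal ((norm (?b (r - t)))\<^sup>2)"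
      by (elim disjE) (simp_all only: norm_zero, simp_all)
  qed
  also have "\<dots> = sq_integral lebesgue ?a + sq_integral lebesgue (\<lambda>r. ?b (r - t))"
    unfolding sq_integral_def
    by (intro nn_integral_add completion.sq_measurable completion.L2_sm a b')
  also have "\<dots> = sq_integral (lebesgue_on {0<..<t}) u + sq_integral (lebesgue_on T) v"
    unfolding b' sq_integral_restrict[OF I] sq_integral_restrict[OF T(1)] ..
  finally show "sq_integral (lebesgue_on T') (concat_at t u v) = sq_integral (lebesgue_on {0<..<t}) u + sq_integral (lebesgue_on T) v" .
qed

context control_system
begin

text \<open>The integral is split at \<open>t\<close>. On the first part \<open>Sad (s - r)\<close>
  factors through \<open>Sad (s - t)\<close>, which produces the earlier input map at a propagated
  test vector; the second part is a translate.\<close>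

lemma L_concat_at:
  assumes u: "L2 (lebs t) u" and v: "L2 (lebs (s - t)) v" and t: "0 < t" "t < s" and \<phi>: "\<phi> \<in> X"
  shows "L (concat_at t u v) s \<phi> = L u t (Sad (s - t) \<phi>) + L v (s - t) \<phi>"
proof -
  let ?w = "concat_at t u v"
  have w: "L2 (lebs s) ?w"
    using t by (intro L2_concat_at(1)[OF _ _ _ _ u v]) auto
  have \<psi>: "Sad (s - t) \<phi> \<in> X" using X_Sad[OF \<phi>, of "s - t"] t by simp
  define a where "a = (\<lambda>r. indicator {0<..<t} r *\<^sub>R B (u r) (Sad (t - r) (Sad (s - t) \<phi>)))"
  define b where "b = (\<lambda>r. indicator {0<..<s - t} r *\<^sub>R B (v r) (Sad (s - t - r) \<phi>))"
  define c where "c = (\<lambda>r. indicator {0<..<s} r *\<^sub>R B (?w r) (Sad (s - r) \<phi>))"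
  have a: "integrable lebesgue a" "L u t (Sad (s - t) \<phi>) = (\<integral>r. a r \<partial>lebesgue)"
    using L_integrable[OF u \<psi>] L_apply[OF u \<psi>] unfolding a_def
    by (simp_all add: integrable_restrict_space integral_restrict_space)
  have b: "integrable lebesgue b" "L v (s - t) \<phi> = (\<integral>r. b r \<partial>lebesgue)"
    using L_integrable[OF v \<phi>] L_apply[OF v \<phi>] unfolding b_def
    by (simp_all add: integrable_restrict_space integral_restrict_space)
  have c: "integrable lebesgue c" "L ?w s \<phi> = (\<integral>r. c r \<partial>lebesgue)"
    using L_integrable[OF w \<phi>] L_apply[OF w \<phi>] unfolding c_def
    by (simp_all add: integrable_restrict_space integral_restrict_space)
  have bs: "integrable lebesgue (\<lambda>r. b (r - t))"
    using b(1) integrable_distr[OF lebesgue_distr_shift(1)[of t], of b] by (simp add: lebesgue_distr_shift)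
  have "AE r in lebesgue. c r = a r + b (r - t)"
    using AE_lebesgue_neq[of t]
  proof eventually_elim
    fix r assume r: "r \<noteq> t"
    consider "r \<le> 0" | "0 < r" "r < t" | "t < r" "r < s" | "s \<le> r" using r by linarith
    then show "c r = a r + b (r - t)"
    proof cases
      case 2
      then have "Sad (s - r) \<phi> = Sad (t - r) (Sad (s - t) \<phi>)"
        using Sad_Sad[of "t - r" "s - t" \<phi>] t by simp
      then show ?thesis using 2 t by (simp add: a_def b_def c_def concat_at_def)
    qed (use t in \<open>auto simp: a_def b_def c_def concat_at_def\<close>)
  qed
  then have "(\<integral>r. c r \<partial>lebesgue) = (\<integral>r. a r + b (r - t) \<partial>lebesgue)"
    using c(1) a(1) bs by (intro integral_cong_AE) auto
  also have "\<dots> = (\<integral>r. a r \<partial>lebesgue) + (\<integral>r. b (r - t) \<partial>lebesgue)"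
    using a(1) bs by (rule Bochner_Integration.integral_add)
  also have "(\<integral>r. b (r - t) \<partial>lebesgue) = (\<integral>r. b r \<partial>lebesgue)"
    using b(1) by (intro integral_lebesgue_shift) auto
  finally show ?thesis using a b c by simp
qed

lemma sol_concat_at_before:
  assumes u: "L2_loc u" and "0 < s" "s \<le> t"
  shows "sol y (concat_at t u v) s = sol y u s"
proof -
  have "L u s = L (concat_at t u v) s"
    using assms by (intro L_cong L2_loc_imp_L2 AE_I2) (auto simp: concat_at_def)
  then show ?thesis by (simp add: solution_def)
qed

text \<open>The identity is proved in \<open>E\<close> and the same inverse embedding is applied to
  both sides, so membership in \<open>H\<close> enters at the junction \<open>t\<close> and not at
  the later time \<open>s\<close>.\<close>

lemma sol_concat_at_after:
  assumes u: "L2_loc u" and v: "L2_loc v" and t: "0 < t" "t < s" and range: "L u t \<in> range emb"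
  shows "sol y (concat_at t u v) s = sol (sol y u t) v (s - t)"
proof -
  let ?w = "concat_at t u v" and ?z = "sol y u t"
  have w: "L2 (lebs s) ?w"
    using t by (intro L2_concat_at(1)[OF _ _ _ _ L2_loc_imp_L2[OF u] L2_loc_imp_L2[OF v, of "s - t"]]) auto
  have "emb (S s y) + L ?w s = emb (S (s - t) ?z) + L v (s - t)"
  proof (rule E_eqI)
    fix \<phi> assume \<phi>: "\<phi> \<in> X"
    have \<psi>: "Sad (s - t) \<phi> \<in> X" using X_Sad[OF \<phi>, of "s - t"] t by simp
    have "emb (S (s - t) ?z) \<phi> = emb ?z (Sad (s - t) \<phi>)"
      using \<phi> \<psi> t by (simp add: emb_apply cinner_Sad)
    also have "\<dots> = emb (S t y) (Sad (s - t) \<phi>) + L u t (Sad (s - t) \<phi>)"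
      using emb_sol[OF range] by simp
    also have "emb (S t y) (Sad (s - t) \<phi>) = emb (S s y) \<phi>"
      using \<phi> \<psi> t H.S_S[of "s - t" t y] by (simp add: emb_apply flip: cinner_Sad)
    finally show "(emb (S s y) + L ?w s) \<phi> = (emb (S (s - t) ?z) + L v (s - t)) \<phi>"
      using L_concat_at[OF L2_loc_imp_L2[OF u] L2_loc_imp_L2[OF v] t \<phi>] by simp
  qed (auto intro!: E_plus emb_in_E L_in_E w L2_loc_imp_L2[OF v])
  then show ?thesis by (simp add: solution_def)
qed

abbreviation "\<U> \<equiv> controls D A S SE B"
abbreviation "energy u \<equiv> sq_integral (lebesgue_on {0<..}) u"

text \<open>Before \<open>t\<close> the new trajectory is the old one, and afterwards it is the
  admissible trajectory restarted from the state at \<open>t\<close>. The additivity of the energy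
  is what the dissipation inequality rests on.\<close>

lemma controls_concat_at:
  assumes u: "L2_loc u" and v: "v \<in> \<U> (sol y u t)" and t: "0 < t" and range: "L u t \<in> range emb"
  shows "concat_at t u v \<in> \<U> y" "energy (concat_at t u v) = sq_integral (lebs t) u + energy v"
proof -
  let ?w = "concat_at t u v"
  have v2: "L2 (lebesgue_on {0<..}) v" "L2 (lebesgue_on {0<..}) (sol (sol y u t) v)"
    using v by (auto simp: controls_def)
  have half: "r \<in> {0<..} \<longleftrightarrow> (0 < r \<and> r < t) \<or> r - t \<in> {0<..}" if "r \<noteq> t" for r
    using that t by auto
  note w = L2_concat_at[of "{0<..}" "{0<..}" t u v, OF _ order_refl _ half L2_loc_imp_L2[OF u] v2(1)]
  have T: "L2 (lebesgue_on {0<..}) (concat_at t (sol y u) (sol (sol y u t) v))"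
    using t by (intro L2_concat_at(1)[OF _ _ _ _ sol_L2[OF u] v2(2)]) auto
  have "AE s in lebesgue_on {0<..}. concat_at t (sol y u) (sol (sol y u t) v) s = sol y ?w s"
  proof -
    have "AE s in lebesgue. s \<in> {0<..} \<longrightarrow> concat_at t (sol y u) (sol (sol y u t) v) s = sol y ?w s"
      using AE_lebesgue_neq[of t]
    proof eventually_elim
      fix s assume "s \<noteq> t"
      then show "s \<in> {0<..} \<longrightarrow> concat_at t (sol y u) (sol (sol y u t) v) s = sol y ?w s"
        using sol_concat_at_before[OF u, of s t y v] sol_concat_at_after[OF u L2_halfline_imp_loc[OF v2(1)] t _ range, of s y]
        by (cases "s < t") (auto simp: concat_at_def)
    qed
    then show ?thesis by (subst AE_restrict_space_iff) auto
  qed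
  then have "L2 (lebesgue_on {0<..}) (sol y ?w)"
    by (rule complete_measure.L2_AE_eq[OF complete_measure_halfline T])
  then show "?w \<in> \<U> y" using w(1) by (simp add: controls_def)
  show "energy ?w = sq_integral (lebs t) u + energy v" using w(2) by simp
qed

lemma L2_eventually_zero:
  fixes f :: "real \<Rightarrow> 'b::real_normed_vector"
  assumes f: "\<And>T. L2 (lebs T) f" and zero: "AE t in lebesgue_on {T<..}. f t = 0" and "0 \<le> T"
  shows "L2 (lebesgue_on {0<..}) f" "energy f = sq_integral (lebs (T + 1)) f"
proof -
  have S: "{0::real<..} \<in> sets lebesgue" "{0<..<T + 1} \<in> sets lebesgue" "{T<..} \<in> sets lebesgue" for T :: real by auto
  \<comment> \<open>Going up to \<open>T + 1\<close> includes the endpoint \<open>T\<close>, at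
    which \<open>f\<close> is not known to vanish, and keeps the interval nonempty for
    \<open>T = 0\<close>.\<close>
  have eq: "AE t in lebesgue. indicator {0<..<T + 1} t *\<^sub>R f t = indicator {0<..} t *\<^sub>R f t"
    using zero[unfolded AE_restrict_space_iff[of "{T<..}" lebesgue, simplified]]
    by eventually_elim (use \<open>0 \<le> T\<close> in \<open>auto simp: indicator_def\<close>)
  show "L2 (lebesgue_on {0<..}) f"
    unfolding L2_restrict[OF S(1)]
    by (rule completion.L2_AE_eq[OF f[of "T + 1", unfolded L2_restrict[OF S(2)]] eq])
  show "energy f = sq_integral (lebs (T + 1)) f"
    unfolding sq_integral_restrict[OF S(1)] sq_integral_restrict[OF S(2)] using sq_integral_cong_AE[OF eq] by simp
qed

lemma steered_control:
  assumes "L2_loc u" "AE t in lebesgue_on {T<..}. u t = 0" "AE t in lebesgue_on {T<..}. sol y u t = 0" "0 \<le> T"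
  shows "u \<in> \<U> y"
  unfolding controls_def
  using L2_eventually_zero(1)[OF L2_loc_imp_L2[OF assms(1)] assms(2,4)]
    L2_eventually_zero(1)[OF sol_L2[OF assms(1)] assms(3,4)] by blast

lemma controls_add:
  assumes "u \<in> \<U> x" "v \<in> \<U> y" shows "(\<lambda>s. u s + v s) \<in> \<U> (x + y)"
proof -
  note c = complete_measure_halfline
  have uv: "L2 (lebesgue_on {0<..}) u" "L2 (lebesgue_on {0<..}) (sol x u)"
    "L2 (lebesgue_on {0<..}) v" "L2 (lebesgue_on {0<..}) (sol y v)"
    using assms by (auto simp: controls_def)
  note loc = L2_halfline_imp_loc[OF uv(1)] L2_halfline_imp_loc[OF uv(3)]
  have "AE t in lebesgue_on {0<..}. sol x u t + sol y v t = sol (x + y) (\<lambda>s. u s + v s) t"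
    using L_in_range[OF loc(1)] L_in_range[OF loc(2)] AE_space
    by eventually_elim (rule sol_add[OF loc, symmetric], auto)
  from complete_measure.L2_AE_eq[OF c complete_measure.L2_add[OF c uv(2,4)] this]
  show ?thesis
    using complete_measure.L2_add[OF c uv(1,3)] by (simp add: controls_def)
qed

lemma controls_scaleC:
  assumes "u \<in> \<U> x" shows "(\<lambda>s. c *\<^sub>C u s) \<in> \<U> (c *\<^sub>C x)"
proof -
  note c = complete_measure_halfline
  have u: "L2 (lebesgue_on {0<..}) u" "L2 (lebesgue_on {0<..}) (sol x u)"
    using assms by (auto simp: controls_def)
  note loc = L2_halfline_imp_loc[OF u(1)]
  have "AE t in lebesgue_on {0<..}. c *\<^sub>C sol x u t = sol (c *\<^sub>C x) (\<lambda>s. c *\<^sub>C u s) t"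
    using L_in_range[OF loc] AE_space
    by eventually_elim (rule sol_scaleC[OF loc, symmetric], auto)
  from complete_measure.L2_AE_eq[OF c complete_measure.L2_scaleC(1)[OF c u(2)] this]
  show ?thesis
    using complete_measure.L2_scaleC(1)[OF c u(1)] by (simp add: controls_def)
qed

end

section \<open>A uniform bound on the energy of controls\<close>

text \<open>Baire, followed by the successive approximation of the open mapping theorem.\<close>

theorem cs_closed_cover_contains_ball:
  fixes C :: "nat \<Rightarrow> 'a::banach set"
  assumes cover: "(\<Union>n. C n) = UNIV"
    and half_diff: "\<And>n p q. p \<in> C n \<Longrightarrow> q \<in> C n \<Longrightarrow> (1/2) *\<^sub>R (p - q) \<in> C n"
    and cs_closed: "\<And>n p x. (\<And>k::nat. p k \<in> C n) \<Longrightarrow> (\<lambda>m. \<Sum>k<m. (1/2)^Suc k *\<^sub>R p k) \<longlonglongrightarrow> x \<Longrightarrow> x \<in> C n"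
  shows "\<exists>n. \<exists>r>0. \<forall>x. norm x < r \<longrightarrow> x \<in> C n"
proof -
  have "(\<Union>n. C n) \<subseteq> (\<Union>n. closure (C n))"
    by (intro UN_mono closure_subset order_refl)
  then have "(\<Union>n. closure (C n)) = UNIV"
    unfolding cover by (rule top.extremum_uniqueI)
  then obtain n a where "a \<in> interior (closure (C n))"
    using closed_cover_interior[of "\<lambda>n. closure (C n)"] by auto
  then obtain r where r: "r > 0" "ball a r \<subseteq> closure (C n)"
    by (meson mem_interior)
  \<comment> \<open>Symmetry moves the ball from \<open>a\<close> to the origin: half the difference
    of points near \<open>a + x\<close> and \<open>a - x\<close> is near \<open>x\<close>.\<close>
  have approx: "\<exists>p\<in>C n. norm (x - p) < r / 2" if "norm x < r" for x
  proof -
    have "a + x \<in> closure (C n)" "a - x \<in> closure (C n)"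
      using that r(2) by (auto simp: subset_iff dist_norm)
    then obtain p q where pq: "p \<in> C n" "dist p (a + x) < r / 2" "q \<in> C n" "dist q (a - x) < r / 2"
      using r(1) unfolding closure_approachable by (meson half_gt_zero)
    have "x - (1/2) *\<^sub>R (p - q) = (1/2) *\<^sub>R ((a + x - p) - (a - x - q))"
      by (simp add: algebra_simps flip: scaleR_add_left)
    then have "norm (x - (1/2) *\<^sub>R (p - q)) = norm ((a + x - p) - (a - x - q)) / 2"
      by simp
    also have "\<dots> \<le> (norm (a + x - p) + norm (a - x - q)) / 2"
      by (intro divide_right_mono norm_triangle_ineq4) simp
    also have "\<dots> < r / 2" using pq by (simp add: dist_norm norm_minus_commute)
    finally show ?thesis using half_diff[OF pq(1,3)] by blast
  qed
  then obtain P where P: "\<And>x. norm x < r \<Longrightarrow> P x \<in> C n" "\<And>x. norm x < r \<Longrightarrow> norm (x - P x) < r / 2"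
    by metis
  have "x \<in> C n" if x: "norm x < r / 2" for x
  proof -
    \<comment> \<open>\<open>R k\<close> is the residual after \<open>k\<close> terms, rescaled by
      \<open>2 ^ (k + 1)\<close>. It starts at \<open>2 x\<close> since the first weight is
      \<open>1/2\<close>, which is why the radius shrinks to \<open>r / 2\<close>.\<close>
    define R where "R = (\<lambda>k. ((\<lambda>y. 2 *\<^sub>R (y - P y)) ^^ k) (2 *\<^sub>R x))"
    have R_Suc: "R (Suc k) = 2 *\<^sub>R (R k - P (R k))" for k by (simp add: R_def)
    have R_less: "norm (R k) < r" for k
    proof (induction k)
      case 0 then show ?case using x by (simp add: R_def)
    next
      case (Suc k) then show ?case using P(2)[OF Suc] by (simp add: R_Suc)
    qed
    have partial: "x - (\<Sum>k<m. (1/2)^Suc k *\<^sub>R P (R k)) = (1/2)^Suc m *\<^sub>R R m" for m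
    proof (induction m)
      case 0 then show ?case by (simp add: R_def)
    next
      case (Suc m)
      have "x - (\<Sum>k<Suc m. (1/2)^Suc k *\<^sub>R P (R k)) = (1/2)^Suc m *\<^sub>R (R m - P (R m))"
        using Suc by (simp add: algebra_simps)
      also have "\<dots> = (1/2)^Suc (Suc m) *\<^sub>R R (Suc m)" by (simp add: R_Suc)
      finally show ?case .
    qed
    have "(\<lambda>m. (1/2::real)^Suc m * r) \<longlonglongrightarrow> 0 * r"
      by (intro tendsto_mult tendsto_const LIMSEQ_Suc LIMSEQ_power_zero) simp
    then have lim0: "(\<lambda>m. (1/2::real)^Suc m * r) \<longlonglongrightarrow> 0" by simp
    have "norm (x - (\<Sum>k<m. (1/2)^Suc k *\<^sub>R P (R k))) \<le> (1/2)^Suc m * r" for m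
      unfolding partial using R_less[of m] by (simp add: mult_left_mono less_imp_le)
    from Lim_null_comparison[OF always_eventually[OF allI[OF this]] lim0]
    have "(\<lambda>m. x - (\<Sum>k<m. (1/2)^Suc k *\<^sub>R P (R k))) \<longlonglongrightarrow> 0" .
    from tendsto_diff[OF tendsto_const[of x] this]
    have "(\<lambda>m. \<Sum>k<m. (1/2)^Suc k *\<^sub>R P (R k)) \<longlonglongrightarrow> x" by simp
    then show ?thesis by (rule cs_closed[rotated]) (rule P(1)[OF R_less])
  qed
  then show ?thesis using r(1) by (intro exI[of _ n] exI[of _ "r/2"]) auto
qed

lemma AE_lebesgue_on_subset:
  assumes "AE t in lebesgue_on S. P t" "T \<subseteq> S" "S \<in> sets lebesgue" "T \<in> sets lebesgue"
  shows "AE t in lebesgue_on T. P t"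
  using assms by (subst AE_restrict_space_iff, simp, subst (asm) AE_restrict_space_iff, simp)
    (auto elim: eventually_mono)

lemma sq_integral_subset:
  fixes f :: "real \<Rightarrow> 'b::real_normed_vector"
  assumes "S \<in> sets lebesgue" "T \<in> sets lebesgue" "S \<subseteq> T"
  shows "sq_integral (lebesgue_on S) f \<le> sq_integral (lebesgue_on T) f"
  unfolding sq_integral_restrict[OF assms(1)] sq_integral_restrict[OF assms(2)]
  using assms(3) by (auto simp: sq_integral_def indicator_def intro!: nn_integral_mono)

lemma sum_half_powers: "(\<Sum>k<n. (1/2::real)^Suc k) \<le> 1"
proof -
  have "(\<Sum>k<n. (1/2::real)^Suc k) = 1 - (1/2)^n" by (induction n) (auto simp: field_simps)
  then show ?thesis by simp
qed

lemma suminf_half_powers_ennreal: "(\<Sum>k. ennreal ((1/2)^Suc k)) \<le> 1"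
proof (rule suminf_le_const)
  show "(\<Sum>k<n. ennreal ((1/2)^Suc k)) \<le> 1" for n
    using ennreal_leI[OF sum_half_powers[of n]] by (subst sum_ennreal) auto
qed simp

text \<open>Jensen's inequality keeps the energy of a convex series of controls bounded.\<close>

lemma half_power_series:
  fixes a :: "nat \<Rightarrow> 'a::banach"
  assumes sq: "summable (\<lambda>k. (1/2)^Suc k * (norm (a k))\<^sup>2)"
  shows "(\<lambda>n. \<Sum>k<n. (1/2)^Suc k *\<^sub>R a k) \<longlonglongrightarrow> (\<Sum>k. (1/2)^Suc k *\<^sub>R a k)"
    and "(norm (\<Sum>k<n. (1/2)^Suc k *\<^sub>R a k))\<^sup>2 \<le> (\<Sum>k. (1/2)^Suc k * (norm (a k))\<^sup>2)"
    and "(norm (\<Sum>k. (1/2)^Suc k *\<^sub>R a k))\<^sup>2 \<le> (\<Sum>k. (1/2)^Suc k * (norm (a k))\<^sup>2)"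
proof -
  have geo: "summable (\<lambda>k. (1/2::real)^Suc k)"
    by (subst summable_Suc_iff) (simp add: summable_geometric)
  have "summable (\<lambda>k. (1/2)^Suc k *\<^sub>R a k)"
  proof (rule summable_comparison_test'[OF summable_add[OF geo sq]])
    fix k
    have "norm (a k) \<le> 1 + (norm (a k))\<^sup>2"
      using sum_squares_bound[of "norm (a k)" 1] norm_ge_zero[of "a k"] by (simp, linarith)
    then have "(1/2)^Suc k * norm (a k) \<le> (1/2)^Suc k * (1 + (norm (a k))\<^sup>2)"
      by (intro mult_left_mono) auto
    then show "norm ((1/2)^Suc k *\<^sub>R a k) \<le> (1/2)^Suc k + (1/2)^Suc k * (norm (a k))\<^sup>2"
      by (simp add: distrib_left)
  qed
  then show lim: "(\<lambda>n. \<Sum>k<n. (1/2)^Suc k *\<^sub>R a k) \<longlonglongrightarrow> (\<Sum>k. (1/2)^Suc k *\<^sub>R a k)"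
    by (rule summable_LIMSEQ)
  have bound: "(norm (\<Sum>k<n. (1/2)^Suc k *\<^sub>R a k))\<^sup>2 \<le> (\<Sum>k. (1/2)^Suc k * (norm (a k))\<^sup>2)" for n
  proof -
    \<comment> \<open>Square roots of the weights split the sum for Cauchy-Schwarz; the leftover
      factor is the total weight, at most \<open>1\<close>.\<close>
    define w where "w = (\<lambda>k. sqrt ((1/2::real)^Suc k))"
    have w: "w k * w k = (1/2)^Suc k" for k unfolding w_def by (rule real_sqrt_mult_self[THEN trans]) simp
    have "norm (\<Sum>k<n. (1/2)^Suc k *\<^sub>R a k) \<le> (\<Sum>k<n. norm ((1/2)^Suc k *\<^sub>R a k))"
      by (rule norm_sum)
    also have "\<dots> = (\<Sum>k<n. w k * (w k * norm (a k)))"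
      unfolding mult.assoc[symmetric] w by simp
    finally have "(norm (\<Sum>k<n. (1/2)^Suc k *\<^sub>R a k))\<^sup>2 \<le> (\<Sum>k<n. w k * (w k * norm (a k)))\<^sup>2"
      by (intro power_mono) auto
    also have "\<dots> \<le> (\<Sum>k<n. (w k)\<^sup>2) * (\<Sum>k<n. (w k * norm (a k))\<^sup>2)"
      by (rule Cauchy_Schwarz_ineq_sum)
    also have "\<dots> = (\<Sum>k<n. (1/2)^Suc k) * (\<Sum>k<n. (1/2)^Suc k * (norm (a k))\<^sup>2)"
      by (simp only: power_mult_distrib power2_eq_square[of "w _"] w)
    also have "\<dots> \<le> 1 * (\<Sum>k<n. (1/2)^Suc k * (norm (a k))\<^sup>2)"
      by (intro mult_right_mono sum_half_powers sum_nonneg) auto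
    also have "\<dots> \<le> (\<Sum>k. (1/2)^Suc k * (norm (a k))\<^sup>2)"
      using sum_le_suminf[OF sq] by auto
    finally show ?thesis .
  qed
  then show "(norm (\<Sum>k<n. (1/2)^Suc k *\<^sub>R a k))\<^sup>2 \<le> (\<Sum>k. (1/2)^Suc k * (norm (a k))\<^sup>2)" .
  show "(norm (\<Sum>k. (1/2)^Suc k *\<^sub>R a k))\<^sup>2 \<le> (\<Sum>k. (1/2)^Suc k * (norm (a k))\<^sup>2)"
    by (rule LIMSEQ_le_const2[OF tendsto_power[OF tendsto_norm[OF lim]]]) (use bound in auto)
qed

section \<open>Steering to rest under convex series\<close>

context control_system
begin

text \<open>For a control that vanishes after \<open>T\<close>, local and global square
  integrability coincide; asking for the global one makes finiteness of the energy part of the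
  notion. The two vanishing conditions are kept together so that they pass jointly through linear
  combinations.\<close>

definition steers :: "real \<Rightarrow> (real \<Rightarrow> 'u) \<Rightarrow> 'h \<Rightarrow> bool"
  where "steers T u y \<longleftrightarrow> L2 (lebesgue_on {0<..}) u \<and> (AE t in lebesgue_on {T<..}. u t = 0 \<and> sol y u t = 0)"

lemma L_in_range_after: "L2_loc u \<Longrightarrow> 0 \<le> T \<Longrightarrow> AE t in lebesgue_on {T<..}. L u t \<in> range emb"
  using L_in_range by (rule AE_lebesgue_on_subset) auto

lemma steers_add:
  assumes "steers T u x" "steers T v y" "0 \<le> T" shows "steers T (\<lambda>s. u s + v s) (x + y)"
proof -
  have uv: "L2 (lebesgue_on {0<..}) u" "L2 (lebesgue_on {0<..}) v"
    and zero: "AE t in lebesgue_on {T<..}. u t = 0 \<and> sol x u t = 0" "AE t in lebesgue_on {T<..}. v t = 0 \<and> sol y v t = 0"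
    using assms by (auto simp: steers_def)
  note loc = L2_halfline_imp_loc[OF uv(1)] L2_halfline_imp_loc[OF uv(2)]
  have "AE t in lebesgue_on {T<..}. u t + v t = 0 \<and> sol (x + y) (\<lambda>s. u s + v s) t = 0"
    using L_in_range_after[OF loc(1) assms(3)] L_in_range_after[OF loc(2) assms(3)] zero AE_space
  proof eventually_elim
    fix t assume "L u t \<in> range emb" "L v t \<in> range emb" "u t = 0 \<and> sol x u t = 0"
      "v t = 0 \<and> sol y v t = 0" "t \<in> space (lebesgue_on {T<..})"
    then show "u t + v t = 0 \<and> sol (x + y) (\<lambda>s. u s + v s) t = 0"
      using sol_add[OF loc, of t x y] assms(3) by simp
  qed
  then show ?thesis
    using complete_measure.L2_add[OF complete_measure_halfline uv] by (simp add: steers_def)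
qed

lemma steers_scaleC:
  assumes "steers T u x" "0 \<le> T" shows "steers T (\<lambda>s. c *\<^sub>C u s) (c *\<^sub>C x)"
proof -
  have u: "L2 (lebesgue_on {0<..}) u" and zero: "AE t in lebesgue_on {T<..}. u t = 0 \<and> sol x u t = 0"
    using assms by (auto simp: steers_def)
  note loc = L2_halfline_imp_loc[OF u]
  have "AE t in lebesgue_on {T<..}. c *\<^sub>C u t = 0 \<and> sol (c *\<^sub>C x) (\<lambda>s. c *\<^sub>C u s) t = 0"
    using L_in_range_after[OF loc assms(2)] zero AE_space
  proof eventually_elim
    fix t assume "L u t \<in> range emb" "u t = 0 \<and> sol x u t = 0" "t \<in> space (lebesgue_on {T<..})"
    then show "c *\<^sub>C u t = 0 \<and> sol (c *\<^sub>C x) (\<lambda>s. c *\<^sub>C u s) t = 0"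
      using sol_scaleC[OF loc, of t c x] assms(2) by (simp add: scaleC_zero_right)
  qed
  then show ?thesis
    using complete_measure.L2_scaleC(1)[OF complete_measure_halfline u] by (simp add: steers_def)
qed

lemma steers_scaleR: "steers T u x \<Longrightarrow> 0 \<le> T \<Longrightarrow> steers T (\<lambda>s. r *\<^sub>R u s) (r *\<^sub>R x)"
  using steers_scaleC[of T u x "complex_of_real r"] by (simp add: scaleC_of_real)

lemma steers_sum:
  assumes "\<And>k::nat. steers T (u k) (x k)" "0 \<le> T"
  shows "steers T (\<lambda>s. \<Sum>k<n. r k *\<^sub>R u k s) (\<Sum>k<n. r k *\<^sub>R x k)"
proof (induction n)
  case 0
  show ?case using steers_scaleR[OF assms(1)[of 0] assms(2), of 0] by simp
next
  case (Suc n)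
  show ?case using steers_add[OF Suc steers_scaleR[OF assms(1)[of n] assms(2), of "r n"] assms(2)] by simp
qed

lemma steers_imp_control: assumes "steers T u y" "0 \<le> T" shows "u \<in> \<U> y"
proof -
  have u: "L2 (lebesgue_on {0<..}) u" and zero: "AE t in lebesgue_on {T<..}. u t = 0 \<and> sol y u t = 0"
    using assms by (auto simp: steers_def)
  have "AE t in lebesgue_on {T<..}. u t = 0" "AE t in lebesgue_on {T<..}. sol y u t = 0"
    using zero by (auto elim: eventually_mono)
  then show ?thesis by (rule steered_control[OF L2_halfline_imp_loc[OF u] _ _ assms(2)])
qed

text \<open>The controls are summed with the same weights. Their partial sums converge almost
  everywhere under an integrable majorant, so the tested input maps converge. At a late time where
  all partial sums are at rest, the limit equation in \<open>E\<close> is solved by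
  \<open>0\<close>, which also settles that the limit state lies in \<open>H\<close>.\<close>

lemma steers_series:
  assumes N: "0 \<le> N" and u: "\<And>k::nat. steers N (u k) (p k)" "\<And>k. energy (u k) \<le> ennreal c"
    and x: "(\<lambda>m. \<Sum>k<m. (1/2)^Suc k *\<^sub>R p k) \<longlonglongrightarrow> x"
  shows "\<exists>v. steers N v x \<and> energy v \<le> ennreal c"
proof -
  let ?w = "\<lambda>k. (1/2::real)^Suc k"
  let ?Hl = "lebesgue_on {0::real<..}"
  interpret Hl: complete_measure ?Hl by (rule complete_measure_halfline)
  have L2u: "L2 ?Hl (u k)" for k using u(1) by (simp add: steers_def)
  \<comment> \<open>Wherever it is finite, \<open>h\<close> bounds the squared norm of every partial
    sum and of the limit, by Jensen. Its integral is at most \<open>c\<close> because the total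
    weight is at most \<open>1\<close>.\<close>
  define h where "h = (\<lambda>s. \<Sum>k. ennreal (?w k * (norm (u k s))\<^sup>2))"
  have meas: "(\<lambda>s. ennreal (?w k * (norm (u k s))\<^sup>2)) \<in> borel_measurable ?Hl" for k
    using Hl.sq_measurable[OF Hl.L2_sm[OF L2u[of k]]] by (simp add: ennreal_mult' del: power_Suc)
  have h_meas: "h \<in> borel_measurable ?Hl"
    unfolding h_def by (intro borel_measurable_suminf_order meas)
  have h_int: "(\<integral>\<^sup>+s. h s \<partial>?Hl) \<le> ennreal c"
  proof -
    have "(\<integral>\<^sup>+s. h s \<partial>?Hl) = (\<Sum>k. \<integral>\<^sup>+s. ennreal (?w k * (norm (u k s))\<^sup>2) \<partial>?Hl)"
      unfolding h_def by (rule nn_integral_suminf[OF meas])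
    also have "\<dots> = (\<Sum>k. ennreal (?w k) * energy (u k))"
      unfolding sq_integral_def using Hl.sq_measurable[OF Hl.L2_sm[OF L2u]]
      by (subst nn_integral_cmult[symmetric]) (auto simp: ennreal_mult' simp del: power_Suc)
    also have "\<dots> \<le> (\<Sum>k. ennreal (?w k) * ennreal c)"
      by (intro suminf_le mult_left_mono u) auto
    also have "\<dots> = (\<Sum>k. ennreal (?w k)) * ennreal c" by simp
    also have "\<dots> \<le> 1 * ennreal c" by (intro mult_right_mono suminf_half_powers_ennreal) auto
    finally show ?thesis by simp
  qed
  then have h_fin: "(\<integral>\<^sup>+s. h s \<partial>?Hl) \<noteq> \<infinity>" using le_less_trans[OF _ ennreal_less_top] by fastforce
  define Z where "Z = (\<lambda>s. summable (\<lambda>k. ?w k * (norm (u k s))\<^sup>2))"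
  have Z: "AE s in ?Hl. Z s"
    using nn_integral_noteq_infinite[OF h_meas h_fin]
  proof eventually_elim
    fix s assume "h s \<noteq> \<infinity>"
    then show "Z s" unfolding h_def Z_def by (intro summable_suminf_not_top) (auto simp: top.not_eq_extremum)
  qed
  have h_Z: "h s = ennreal (\<Sum>k. ?w k * (norm (u k s))\<^sup>2)" if "Z s" for s
    using that unfolding h_def Z_def by (intro suminf_ennreal2) auto
  define U where "U = (\<lambda>n s. \<Sum>k<n. ?w k *\<^sub>R u k s)"
  define v where "v = (\<lambda>s. if Z s then (\<Sum>k. ?w k *\<^sub>R u k s) else 0)"
  have U_lim: "(\<lambda>n. U n s) \<longlonglongrightarrow> v s" if "Z s" for s
    using half_power_series(1)[of "\<lambda>k. u k s"] that by (simp add: U_def v_def Z_def)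
  have v_le: "ennreal ((norm (v s))\<^sup>2) \<le> h s" if "Z s" for s
    using half_power_series(3)[of "\<lambda>k. u k s"] that unfolding h_Z[OF that] by (intro ennreal_leI) (simp add: v_def Z_def)
  \<comment> \<open>From \<open>a \<le> 1 + a\<^sup>2\<close>; the resulting majorant for the
    unsquared norms is integrable on bounded intervals.\<close>
  have U_le: "norm (U n s) \<le> 1 + enn2real (h s)" if "Z s" for n s
  proof -
    have "(norm (U n s))\<^sup>2 \<le> enn2real (h s)"
      using half_power_series(2)[of "\<lambda>k. u k s" n] that suminf_nonneg[of "\<lambda>k. ?w k * (norm (u k s))\<^sup>2"]
      unfolding h_Z[OF that] by (simp add: U_def Z_def)
    then show ?thesis
      using sum_squares_bound[of "norm (U n s)" 1] norm_ge_zero[of "U n s"] by (simp, linarith)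
  qed
  have U_steers: "steers N (U n) (\<Sum>k<n. ?w k *\<^sub>R p k)" for n
    unfolding U_def by (rule steers_sum[OF u(1) N])
  then have U_L2: "L2 ?Hl (U n)" for n by (simp add: steers_def)
  have energy_v: "energy v \<le> ennreal c"
  proof -
    have "energy v \<le> (\<integral>\<^sup>+s. h s \<partial>?Hl)"
      unfolding sq_integral_def using Z v_le by (intro nn_integral_mono_AE) (auto elim: eventually_mono)
    then show ?thesis using h_int by (rule order_trans)
  qed
  have Z_lebs: "AE s in lebs T. Z s" for T
    using Z by (rule AE_lebesgue_on_subset) auto
  have v_loc: "L2_loc v"
    unfolding L2_loc_def L2_def
  proof (intro allI impI conjI)
    fix T :: real
    interpret T: strong_measurability "lebs T" UNIV "norm :: 'u \<Rightarrow> real"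
      by (rule strong_measurability_norm[OF complete_measure_lebs])
    show "strongly_measurable UNIV norm (lebs T) v"
    proof (rule T.sm_limit[OF finite_measure_lebs])
      show "T.sm (U n)" for n
        using L2_loc_imp_L2[OF L2_halfline_imp_loc[OF U_L2[of n]], of T] by (simp add: L2_def)
      show "AE s in lebs T. (\<lambda>n. norm (v s - U n s)) \<longlonglongrightarrow> 0"
        using Z_lebs
      proof eventually_elim
        fix s assume "Z s"
        from tendsto_norm[OF tendsto_diff[OF tendsto_const[of "v s"] U_lim[OF this]]]
        show "(\<lambda>n. norm (v s - U n s)) \<longlonglongrightarrow> 0" by simp
      qed
    qed simp
    have "sq_integral (lebs T) v \<le> energy v" by (rule sq_integral_subset) auto
    also have "\<dots> < \<infinity>" using le_less_trans[OF energy_v ennreal_less_top] by simp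
    finally show "sq_integral (lebs T) v < \<infinity>" .
  qed
  have v_zero: "AE t in lebesgue_on {N<..}. v t = 0"
  proof -
    have "AE t in lebesgue_on {N<..}. \<forall>k. u k t = 0"
      unfolding AE_all_countable using u(1) by (auto simp: steers_def elim: eventually_mono)
    then show ?thesis by eventually_elim (simp add: v_def)
  qed
  have v_L2: "L2 ?Hl v"
    by (rule L2_eventually_zero(1)[OF L2_loc_imp_L2[OF v_loc] v_zero N])
  have "AE t in lebesgue_on {N<..}. \<forall>n. sol (\<Sum>k<n. ?w k *\<^sub>R p k) (U n) t = 0"
    unfolding AE_all_countable using U_steers by (auto simp: steers_def elim: eventually_mono)
  moreover have "AE t in lebesgue_on {N<..}. \<forall>n. L (U n) t \<in> range emb"
    unfolding AE_all_countable by (intro allI L_in_range_after L2_halfline_imp_loc U_L2 N)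
  ultimately have "AE t in lebesgue_on {N<..}. sol x v t = 0"
    using AE_space
  proof eventually_elim
    fix t assume sol: "\<forall>n. sol (\<Sum>k<n. ?w k *\<^sub>R p k) (U n) t = 0" and range: "\<forall>n. L (U n) t \<in> range emb"
      and "t \<in> space (lebesgue_on {N<..})"
    then have t: "0 < t" using N by auto
    have "emb 0 = emb (S t x) + L v t"
    proof (rule E_eqI)
      fix \<phi> assume \<phi>: "\<phi> \<in> X"
      obtain K where K: "0 \<le> K" "\<And>s v. 0 \<le> s \<Longrightarrow> s \<le> t \<Longrightarrow> nE (SE s (B v)) \<le> K * norm v"
        using integrand_bound[where t = t] by blast
      have Bb: "cmod (B z (Sad (t - s) \<phi>)) \<le> K * gn \<phi> * norm z" if "s \<in> space (lebs t)" for s z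
      proof -
        have s: "0 \<le> t - s" "t - s \<le> t" using that by auto
        have "cmod (B z (Sad (t - s) \<phi>)) = cmod (SE (t - s) (B z) \<phi>)"
          using SE_apply[OF s(1) B_mem \<phi>] by simp
        also have "\<dots> \<le> nE (SE (t - s) (B z)) * gn \<phi>"
          by (intro nE_bound E.S_mem s B_mem \<phi>)
        also have "\<dots> \<le> (K * norm z) * gn \<phi>"
          by (intro mult_right_mono K s gn_nonneg)
        finally show ?thesis by (simp add: ac_simps)
      qed
      note U2 = L2_loc_imp_L2[OF L2_halfline_imp_loc[OF U_L2]] and v2 = L2_loc_imp_L2[OF v_loc]
      have h_lebs: "integrable (lebs t) (\<lambda>s. enn2real (h s))"
      proof (rule integrableI_bounded)
        have "h \<in> borel_measurable (lebs t)"
          using h_meas by (rule measurable_restrict_mono) auto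
        then show "(\<lambda>s. enn2real (h s)) \<in> borel_measurable (lebs t)" by measurable
        have "(\<integral>\<^sup>+s. ennreal (norm (enn2real (h s))) \<partial>lebs t) \<le> (\<integral>\<^sup>+s. h s \<partial>lebs t)"
          by (intro nn_integral_mono) (simp add: ennreal_enn2real_if)
        also have "\<dots> \<le> (\<integral>\<^sup>+s. h s \<partial>?Hl)"
          by (subst (1 2) nn_integral_restrict_space) (auto intro!: nn_integral_mono simp: indicator_def)
        finally show "(\<integral>\<^sup>+s. ennreal (norm (enn2real (h s))) \<partial>lebs t) < \<infinity>"
          using h_fin by (simp add: less_top[symmetric] top_unique) (metis top.extremum_unique)
      qed
      have "(\<lambda>n. L (U n) t \<phi>) \<longlonglongrightarrow> L v t \<phi>"
        unfolding L_apply[OF U2 \<phi>] L_apply[OF v2 \<phi>]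
      proof (rule integral_dominated_convergence[where w = "\<lambda>s. K * gn \<phi> * (1 + enn2real (h s))"])
        show "(\<lambda>s. B (v s) (Sad (t - s) \<phi>)) \<in> borel_measurable (lebs t)"
          "(\<lambda>s. B (U n s) (Sad (t - s) \<phi>)) \<in> borel_measurable (lebs t)" for n
          using L_integrable[OF U2 \<phi>] L_integrable[OF v2 \<phi>] by auto
        show "integrable (lebs t) (\<lambda>s. K * gn \<phi> * (1 + enn2real (h s)))"
          using h_lebs finite_measure.integrable_const[OF finite_measure_lebs, of t "1::real"]
          by (intro integrable_mult_right Bochner_Integration.integrable_add)
        show "AE s in lebs t. (\<lambda>n. B (U n s) (Sad (t - s) \<phi>)) \<longlonglongrightarrow> B (v s) (Sad (t - s) \<phi>)"
          using Z_lebs AE_space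
        proof eventually_elim
          fix s assume s: "Z s" "s \<in> space (lebs t)"
          have "(\<lambda>n. K * gn \<phi> * norm (U n s - v s)) \<longlonglongrightarrow> K * gn \<phi> * norm (v s - v s)"
            by (intro tendsto_mult tendsto_const tendsto_norm tendsto_diff U_lim s)
          then have lim0: "(\<lambda>n. K * gn \<phi> * norm (U n s - v s)) \<longlonglongrightarrow> 0" by simp
          have "norm (B (U n s) (Sad (t - s) \<phi>) - B (v s) (Sad (t - s) \<phi>)) \<le> K * gn \<phi> * norm (U n s - v s)" for n
            using Bb[OF s(2), of "U n s - v s"] by (simp add: B_diff)
          from Lim_null_comparison[OF always_eventually[OF allI[OF this]] lim0]
          have "(\<lambda>n. B (U n s) (Sad (t - s) \<phi>) - B (v s) (Sad (t - s) \<phi>)) \<longlonglongrightarrow> 0" .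
          then show "(\<lambda>n. B (U n s) (Sad (t - s) \<phi>)) \<longlonglongrightarrow> B (v s) (Sad (t - s) \<phi>)"
            by (rule LIM_zero_cancel)
        qed
        show "AE s in lebs t. norm (B (U n s) (Sad (t - s) \<phi>)) \<le> K * gn \<phi> * (1 + enn2real (h s))" for n
          using Z_lebs AE_space
        proof eventually_elim
          fix s assume s: "Z s" "s \<in> space (lebs t)"
          show "norm (B (U n s) (Sad (t - s) \<phi>)) \<le> K * gn \<phi> * (1 + enn2real (h s))"
            using order_trans[OF Bb[OF s(2), of "U n s"] mult_left_mono[OF U_le[OF s(1)]]] K(1) gn_nonneg by simp
        qed
      qed
      \<comment> \<open>Rest at time \<open>t\<close> determines the input map from the initial
        state, and the expression in the initial states converges by continuity of
        \<open>S t\<close>.\<close>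
      moreover have "L (U n) t \<phi> = - cinner (S t (\<Sum>k<n. ?w k *\<^sub>R p k)) \<phi>" for n
      proof -
        have "emb 0 = emb (S t (\<Sum>k<n. ?w k *\<^sub>R p k)) + L (U n) t"
          using emb_sol[OF range[rule_format, of n], of "\<Sum>k<n. ?w k *\<^sub>R p k"] sol[rule_format, of n] by (simp only:)
        from fun_cong[OF this, of \<phi>] show ?thesis
          by (simp add: emb_0 emb_apply[OF \<phi>] eq_neg_iff_add_eq_0 add.commute del: power_Suc)
      qed
      moreover have "(\<lambda>n. - cinner (S t (\<Sum>k<n. ?w k *\<^sub>R p k)) \<phi>) \<longlonglongrightarrow> - cinner (S t x) \<phi>"
        using t by (intro tendsto_minus cinner.tendsto tendsto_const bounded_linear.tendsto[OF bounded_linear_S] x) simp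
      ultimately have "L v t \<phi> = - cinner (S t x) \<phi>"
        using LIMSEQ_unique by (simp del: power_Suc)
      then show "emb 0 \<phi> = (emb (S t x) + L v t) \<phi>"
        by (simp add: emb_0 emb_apply[OF \<phi>])
    qed (auto intro!: emb_in_E E_plus L_in_E L2_loc_imp_L2[OF v_loc])
    then show "sol x v t = 0" by (rule sol_eqI)
  qed
  with v_zero have "AE t in lebesgue_on {N<..}. v t = 0 \<and> sol x v t = 0" by eventually_elim simp
  then show ?thesis using v_L2 energy_v by (auto simp: steers_def)
qed

end

locale null_controllable_system = control_system D A S SE B
  for D :: "'h::complex_hilbert set" and A S SE and B :: "'u::complex_hilbert \<Rightarrow> ('h \<Rightarrow> complex)" +
  assumes null: "null_controllable D A S SE B"
begin

text \<open>Once some \<open>C n\<close> contains a ball, every state is a multiple of a vector in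
  the ball, and scaling state and control together makes the energy quadratic in the norm.\<close>

theorem bounded_energy_control:
  "\<exists>C\<ge>0. \<forall>y. \<exists>u\<in>\<U> y. energy u \<le> ennreal (C * (norm y)\<^sup>2)"
proof -
  \<comment> \<open>The same \<open>n\<close> bounds the time and the \<open>L\<^sup>2\<close> norm
    of the control, so every steering time and energy fit into the set for some integer.\<close>
  define C where "C = (\<lambda>n::nat. {y. \<exists>u. steers (real n) u y \<and> energy u \<le> ennreal ((real n)\<^sup>2)})"
  have "\<exists>n. \<exists>r>0. \<forall>x. norm x < r \<longrightarrow> x \<in> C n"
  proof (rule cs_closed_cover_contains_ball)
    have "\<exists>n. y \<in> C n" for y
    proof -
      obtain T u where T: "0 \<le> T" and u: "L2_loc u" "AE t in lebesgue_on {T<..}. u t = 0"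
        "AE t in lebesgue_on {T<..}. sol y u t = 0"
        using null unfolding null_controllable_def steered_to_rest_def by blast
      have "L2 (lebesgue_on {0<..}) u"
        by (rule L2_eventually_zero(1)[OF L2_loc_imp_L2[OF u(1)] u(2) T])
      then have fin: "energy u < \<infinity>" by (simp add: L2_def)
      \<comment> \<open>The summand \<open>1\<close> forces \<open>n \<ge> 1\<close>, so that
        \<open>n \<le> n\<^sup>2\<close> and the energy is below the square.\<close>
      obtain n :: nat where n: "max T (enn2real (energy u) + 1) \<le> real n"
        using real_arch_simple by blast
      have "enn2real (energy u) \<le> (real n)\<^sup>2"
      proof -
        have "1 \<le> real n" using n enn2real_nonneg[of "energy u"] by linarith
        then have "real n * 1 \<le> real n * real n" by (intro mult_left_mono) auto
        then show ?thesis using n by (simp add: power2_eq_square)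
      qed
      then have "energy u \<le> ennreal ((real n)\<^sup>2)"
        using fin ennreal_leI by (metis ennreal_enn2real infinity_ennreal_def)
      moreover have "AE t in lebesgue_on {real n<..}. u t = 0 \<and> sol y u t = 0"
      proof (rule AE_lebesgue_on_subset)
        show "AE t in lebesgue_on {T<..}. u t = 0 \<and> sol y u t = 0"
          using u(2,3) by eventually_elim simp
      qed (use n in auto)
      ultimately have "y \<in> C n"
        using \<open>L2 (lebesgue_on {0<..}) u\<close> by (auto simp: C_def steers_def)
      then show ?thesis ..
    qed
    then show "(\<Union>n. C n) = UNIV" by auto
  next
    fix n p q assume "p \<in> C n" "q \<in> C n"
    then obtain u v where u: "steers (real n) u p" "energy u \<le> ennreal ((real n)\<^sup>2)"
      and v: "steers (real n) v q" "energy v \<le> ennreal ((real n)\<^sup>2)"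
      by (auto simp: C_def)
    let ?f = "\<lambda>s. (1/2) *\<^sub>R u s" and ?g = "\<lambda>s. (-1/2) *\<^sub>R v s"
    interpret Hl: complete_measure "lebesgue_on {0::real<..}" by (rule complete_measure_halfline)
    have s: "steers (real n) ?f ((1/2) *\<^sub>R p)" "steers (real n) ?g ((-1/2) *\<^sub>R q)"
      by (intro steers_scaleR u v; simp)+
    have sm: "strongly_measurable UNIV norm (lebesgue_on {0<..}) ?f" "strongly_measurable UNIV norm (lebesgue_on {0<..}) ?g"
      "strongly_measurable UNIV norm (lebesgue_on {0<..}) u" "strongly_measurable UNIV norm (lebesgue_on {0<..}) v"
      using s u v by (auto simp: steers_def L2_def)
    have e: "energy ?f = ennreal ((1/2)\<^sup>2) * energy u" "energy ?g = ennreal ((1/2)\<^sup>2) * energy v"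
      using sm by (intro Hl.sq_integral_scale; simp)+
    \<comment> \<open>The parallelogram law with the difference term dropped. Each halved control
      has a quarter of the energy, so the total is at most \<open>n\<^sup>2\<close> again.\<close>
    have "energy (\<lambda>s. ?f s + ?g s) \<le> 2 * energy ?f + 2 * energy ?g"
      unfolding Hl.sq_integral_parallelogram[OF sm(1,2), symmetric] by simp
    also have "\<dots> \<le> 2 * (ennreal ((1/2)\<^sup>2) * ennreal ((real n)\<^sup>2)) + 2 * (ennreal ((1/2)\<^sup>2) * ennreal ((real n)\<^sup>2))"
      unfolding e by (intro add_mono mult_left_mono u v) auto
    also have "\<dots> = ennreal ((real n)\<^sup>2)"
    proof -
      have "2 * (ennreal ((1/2)\<^sup>2) * ennreal ((real n)\<^sup>2)) = ennreal (2 * ((1/2)\<^sup>2 * (real n)\<^sup>2))"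
        by (simp only: ennreal_mult ennreal_numeral zero_le_power2 zero_le_numeral mult_nonneg_nonneg)
      then show ?thesis by (simp add: power2_eq_square flip: ennreal_plus)
    qed
    finally have "(1/2) *\<^sub>R p + (-1/2) *\<^sub>R q \<in> C n"
      using steers_add[OF s] unfolding C_def by (intro CollectI exI[of _ "\<lambda>s. ?f s + ?g s"]) simp
    then show "(1/2) *\<^sub>R (p - q) \<in> C n" by (simp add: scaleR_diff_right)
  next
    fix n and p :: "nat \<Rightarrow> 'h" and x
    assume p: "\<And>k. p k \<in> C n" and x: "(\<lambda>m. \<Sum>k<m. (1/2)^Suc k *\<^sub>R p k) \<longlonglongrightarrow> x"
    then obtain u where "\<And>k. steers (real n) (u k) (p k)" "\<And>k. energy (u k) \<le> ennreal ((real n)\<^sup>2)"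
      unfolding C_def by (auto simp del: power_Suc) metis
    from steers_series[OF _ this x] show "x \<in> C n" by (auto simp: C_def)
  qed
  then obtain n r where r: "r > 0" "\<And>x. norm x < r \<Longrightarrow> x \<in> C n" by blast
  have "\<exists>u\<in>\<U> y. energy u \<le> ennreal ((2 * real n / r)\<^sup>2 * (norm y)\<^sup>2)" for y
  proof (cases "y = 0")
    case True
    \<comment> \<open>The energy has to be exactly \<open>0\<close> here. The zero control
      qualifies, as the zero multiple of some steering control.\<close>
    obtain u where "steers (real n) u 0" using r(2)[of 0] r(1) by (auto simp: C_def)
    then have 0: "steers (real n) (\<lambda>s. 0) 0"
      using steers_scaleR[of "real n" u 0 0] by simp
    have "energy (\<lambda>s. 0 :: 'u) = 0" by (simp add: sq_integral_def)
    then show ?thesis using steers_imp_control[OF 0] True by auto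
  next
    case False
    \<comment> \<open>Brings \<open>y\<close> divided by \<open>c\<close> to norm
      \<open>r / 2\<close>, strictly inside the ball.\<close>
    define c where "c = 2 * norm y / r"
    have c: "c > 0" using False r by (simp add: c_def)
    have "norm ((1 / c) *\<^sub>R y) < r" using False r by (simp add: c_def)
    from r(2)[OF this] obtain u where u: "steers (real n) u ((1 / c) *\<^sub>R y)" "energy u \<le> ennreal ((real n)\<^sup>2)"
      unfolding C_def by blast
    have cu: "steers (real n) (\<lambda>s. c *\<^sub>R u s) y"
      using steers_scaleR[OF u(1), of c] c by simp
    have "energy (\<lambda>s. c *\<^sub>R u s) = ennreal (c\<^sup>2) * energy u"
      using u c by (intro complete_measure.sq_integral_scale[OF complete_measure_halfline]) (auto simp: steers_def L2_def)
    also have "\<dots> \<le> ennreal (c\<^sup>2) * ennreal ((real n)\<^sup>2)" by (intro mult_left_mono u) simp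
    also have "\<dots> = ennreal ((2 * real n / r)\<^sup>2 * (norm y)\<^sup>2)"
      by (simp add: c_def power_mult_distrib power_divide ac_simps flip: ennreal_mult)
    finally show ?thesis using steers_imp_control[OF cu] by auto
  qed
  then show ?thesis by (intro exI[of _ "(2 * real n / r)\<^sup>2"]) auto
qed

end

section \<open>The value function as a quadratic form\<close>

text \<open>After subtracting \<open>r * f 1\<close> the additive function vanishes on the integers,
  hence is periodic and bounded on the whole line, and a bounded additive function is zero.\<close>

lemma additive_bounded_imp_linear:
  fixes f :: "real \<Rightarrow> real"
  assumes add: "\<And>x y. f (x + y) = f x + f y" and bound: "\<And>x. \<bar>x\<bar> \<le> 1 \<Longrightarrow> \<bar>f x\<bar> \<le> K"
  shows "f r = r * f 1"
proof -
  define g where "g = (\<lambda>x. f x - x * f 1)"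
  have g_add: "g (x + y) = g x + g y" for x y by (simp add: g_def add algebra_simps)
  have g_0: "g 0 = 0" using g_add[of 0 0] by simp
  have g_mult: "g (real n * x) = real n * g x" for n x
    by (induction n) (simp_all add: g_0 g_add algebra_simps)
  have "g (- x) = - g x" for x using g_add[of x "- x"] g_0 by simp
  moreover have "g (real n) = 0" for n using g_mult[of n 1] by (simp add: g_def)
  ultimately have g_int: "g (of_int k) = 0" for k :: int
    by (cases k rule: int_cases2) (auto simp: g_0)
  have g_bound: "\<bar>g x\<bar> \<le> 2 * K" for x
  proof -
    have "g x = g (frac x)" using g_add[of "of_int \<lfloor>x\<rfloor>" "frac x"] g_int by (simp add: frac_def)
    moreover have "\<bar>f (frac x)\<bar> \<le> K" by (rule bound) (use frac_lt_1[of x] frac_ge_0[of x] in auto)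
    moreover have "\<bar>frac x * f 1\<bar> \<le> 1 * K"
      unfolding abs_mult using frac_lt_1[of x] frac_ge_0[of x] by (intro mult_mono bound) auto
    ultimately show ?thesis by (simp add: g_def)
  qed
  have "g r = 0"
  proof (rule ccontr)
    assume "g r \<noteq> 0"
    obtain n :: nat where "2 * K / \<bar>g r\<bar> < real n" using reals_Archimedean2 by blast
    then have "2 * K < \<bar>real n * g r\<bar>" using \<open>g r \<noteq> 0\<close> by (simp add: field_simps abs_mult)
    then show False using g_bound[of "real n * r"] by (simp add: g_mult)
  qed
  then show ?thesis by (simp add: g_def)
qed

text \<open>Real polarisation suffices: the parallelogram law makes \<open>b\<close> additive, the
  bound makes it real linear, and the invariance of \<open>Q\<close> under \<open>\<i>\<close> makes
  the representing operator commute with \<open>\<i>\<close>, hence complex linear.\<close>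

theorem bounded_quadratic_form_representation:
  fixes Q :: "'h::complex_hilbert \<Rightarrow> real"
  assumes par: "\<And>x y. Q (x + y) + Q (x - y) = 2 * Q x + 2 * Q y"
    and hom: "\<And>c x. Q (c *\<^sub>C x) = (cmod c)\<^sup>2 * Q x"
    and nonneg: "\<And>x. 0 \<le> Q x" and bound: "\<And>x. Q x \<le> C * (norm x)\<^sup>2" and C: "0 \<le> C"
  shows "\<exists>P. bounded_clinear_on UNIV norm UNIV norm P \<and> (\<forall>x y. cinner (P x) y = cinner x (P y)) \<and>
    (\<forall>x. Q x = Re (cinner x (P x)))"
proof -
  define b where "b = (\<lambda>x y. (Q (x + y) - Q (x - y)) / 4)"
  have Q_minus: "Q (- x) = Q x" for x using hom[of "-1" x] by (simp add: scaleC_minus1)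
  have Q_minus_commute: "Q (x - y) = Q (y - x)" for x y using Q_minus[of "x - y"] by simp
  have Q_0: "Q 0 = 0" using hom[of 0 0] by (simp add: scaleC_zero_left)
  have b_sym: "b x y = b y x" for x y by (simp add: b_def add.commute Q_minus_commute[of x])
  have b_self: "b x x = Q x" for x
    using hom[of 2 x] scaleC_of_real[of 2 x] by (simp add: b_def Q_0 scaleR_2)
  have b_0: "b 0 y = 0" for y by (simp add: b_def Q_minus)
  have b_minus: "b (- x) y = - b x y" for x y
  proof -
    have "Q (- x + y) = Q (x - y)" using Q_minus[of "x - y"] by simp
    moreover have "Q (- x - y) = Q (x + y)" using Q_minus[of "x + y"] by simp
    ultimately show ?thesis by (simp add: b_def field_simps)
  qed
  have b_mid: "b (x + x') y + b (x - x') y = 2 * b x y" for x x' y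
    using par[of "x + y" x'] par[of "x - y" x'] by (simp add: b_def field_simps)
  \<comment> \<open>Adding the preceding identity to the one with \<open>x\<close> and
    \<open>x'\<close> exchanged cancels the difference terms, since \<open>b\<close> is odd in its
    first argument.\<close>
  have b_add: "b (x + x') y = b x y + b x' y" for x x' y
    using b_mid[of x x' y] b_mid[of x' x y] b_minus[of "x - x'" y] by (simp add: add.commute)
  have b_bound0: "\<bar>b x y\<bar> \<le> C * (norm x + norm y)\<^sup>2" for x y
  proof -
    have *: "Q z \<le> C * (norm x + norm y)\<^sup>2" if "norm z \<le> norm x + norm y" for z
      using bound[of z] that C by (smt (verit) mult_left_mono norm_ge_zero power_mono)
    have "Q (x + y) \<le> C * (norm x + norm y)\<^sup>2" "Q (x - y) \<le> C * (norm x + norm y)\<^sup>2"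
      by (intro * norm_triangle_ineq norm_triangle_ineq4)+
    then show ?thesis using nonneg[of "x + y"] nonneg[of "x - y"] by (simp add: b_def)
  qed
  have b_scale: "b (r *\<^sub>R x) y = r * b x y" for r x y
  proof -
    have "b (r *\<^sub>R x) y = r * b (1 *\<^sub>R x) y"
    proof (rule additive_bounded_imp_linear[where f = "\<lambda>r. b (r *\<^sub>R x) y" and K = "C * (norm x + norm y)\<^sup>2"])
      show "b ((r + s) *\<^sub>R x) y = b (r *\<^sub>R x) y + b (s *\<^sub>R x) y" for r s
        by (simp add: scaleR_add_left b_add)
      fix r :: real assume "\<bar>r\<bar> \<le> 1"
      then have "norm (r *\<^sub>R x) \<le> norm x" using mult_right_mono[of "\<bar>r\<bar>" 1 "norm x"] by simp
      then have "C * (norm (r *\<^sub>R x) + norm y)\<^sup>2 \<le> C * (norm x + norm y)\<^sup>2"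
        by (intro mult_left_mono power_mono C) auto
      then show "\<bar>b (r *\<^sub>R x) y\<bar> \<le> C * (norm x + norm y)\<^sup>2"
        by (rule order_trans[OF b_bound0])
    qed
    then show ?thesis by simp
  qed
  have b_bound: "\<bar>b x y\<bar> \<le> 4 * C * norm y * norm x" for x y
  proof (cases "x = 0 \<or> y = 0")
    case True
    then show ?thesis using b_0[of y] b_0[of x] b_sym[of x 0] by auto
  next
    case False
    let ?x = "(1 / norm x) *\<^sub>R x" and ?y = "(1 / norm y) *\<^sub>R y"
    have "b x y = norm x * (norm y * b ?x ?y)"
      using False b_scale[of "1 / norm x" x ?y] b_scale[of "1 / norm y" y x] b_sym[of x] by simp
    \<comment> \<open>Two unit vectors give \<open>(1 + 1)\<^sup>2 = 4\<close>.\<close>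
    moreover have "\<bar>b ?x ?y\<bar> \<le> C * 4" using b_bound0[of ?x ?y] False by simp
    ultimately have "\<bar>b x y\<bar> \<le> norm x * (norm y * (C * 4))"
      by (simp add: abs_mult mult_left_mono)
    then show ?thesis by (simp add: ac_simps)
  qed
  have "\<exists>z. \<forall>x. b x y = inner x z" for y
    using riesz_closed_subspace[of UNIV "\<lambda>x. b x y" "4 * C * norm y"] b_add b_scale b_bound by simp
  then obtain P where P: "\<And>x y. b x y = inner x (P y)" by metis
  have P_eqI: "u = v" if "\<And>x. inner x u = inner x v" for u v :: 'h
    using that vector_eq_ldot by blast
  have b_rot: "b (\<i> *\<^sub>C x) (\<i> *\<^sub>C y) = b x y" for x y
    using hom[of \<i> "x + y"] hom[of \<i> "x - y"]
      linear_diff[OF bounded_linear.linear[OF bounded_linear_scaleC[of \<i>]], of x y]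
    by (simp add: b_def scaleC_add_right)
  have P_add: "P (x + y) = P x + P y" for x y
    by (rule P_eqI) (simp add: inner_add_right P[symmetric] b_sym[of _ "x + y"] b_add b_sym[of x] b_sym[of y])
  have P_scaleR: "P (r *\<^sub>R x) = r *\<^sub>R P x" for r x
    by (rule P_eqI) (simp add: P[symmetric] b_sym[of _ "r *\<^sub>R x"] b_scale b_sym[of x])
  have P_rot: "P (\<i> *\<^sub>C y) = \<i> *\<^sub>C P y" for y
  proof (rule P_eqI)
    fix x
    have "inner x (P (\<i> *\<^sub>C y)) = b (\<i> *\<^sub>C ((- \<i>) *\<^sub>C x)) (\<i> *\<^sub>C y)"
      by (simp add: P scaleC_scaleC scaleC_one)
    also have "\<dots> = inner ((- \<i>) *\<^sub>C x) (P y)" by (rule trans[OF b_rot P])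
    also have "\<dots> = inner x (\<i> *\<^sub>C P y)"
      by (simp add: inner_eq_Re_cinner cinner_scaleC_left cinner_scaleC_right)
    finally show "inner x (P (\<i> *\<^sub>C y)) = inner x (\<i> *\<^sub>C P y)" .
  qed
  have scaleC_split: "c *\<^sub>C x = Re c *\<^sub>R x + Im c *\<^sub>R (\<i> *\<^sub>C x)" for c and x :: 'h
  proof -
    have "c *\<^sub>C x = (complex_of_real (Re c) + complex_of_real (Im c) * \<i>) *\<^sub>C x"
      using complex_eq[of c] by (simp add: mult.commute)
    also have "\<dots> = Re c *\<^sub>R x + Im c *\<^sub>R (\<i> *\<^sub>C x)"
      by (simp only: scaleC_add_left scaleC_scaleC[symmetric] scaleC_of_real)
    finally show ?thesis .
  qed
  have P_scaleC: "P (c *\<^sub>C x) = c *\<^sub>C P x" for c x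
    unfolding scaleC_split[of c] by (simp add: P_add P_scaleR P_rot)
  have P_bound: "norm (P y) \<le> 4 * C * norm y" for y
  proof -
    have "norm (P y) * norm (P y) = b (P y) y"
      by (simp add: P power2_norm_eq_inner[symmetric] power2_eq_square)
    also have "\<dots> \<le> (4 * C * norm y) * norm (P y)" using b_bound[of "P y" y] by simp
    finally show ?thesis using C by (cases "norm (P y) = 0") (auto simp: mult_le_cancel_right)
  qed
  have sym: "Re (cinner (P x) y) = Re (cinner x (P y))" for x y
    using b_sym[of x y] unfolding P by (simp add: inner_commute[of y] flip: inner_eq_Re_cinner)
  have "cinner (P x) y = cinner x (P y)" for x y
  proof (rule complex_eqI[OF sym])
    show "Im (cinner (P x) y) = Im (cinner x (P y))"
      using sym[of "\<i> *\<^sub>C x" y] by (simp add: P_scaleC cinner_scaleC_left)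
  qed
  moreover have "Q x = Re (cinner x (P x))" for x
    using P[of x x] by (simp add: b_self flip: inner_eq_Re_cinner)
  moreover have "bounded_clinear_on UNIV norm UNIV norm P"
    using P_add P_scaleC P_bound unfolding bounded_clinear_on_def by blast
  ultimately show ?thesis by blast
qed

section \<open>The value function: homogeneity, parallelogram law and dissipation\<close>

context null_controllable_system
begin

abbreviation "cost u \<equiv> enn2real (energy u)"

text \<open>The value function with values in the reals. Nothing is lost: admissible controls have
  finite energy and, by the uniform bound, exist for every state.\<close>

definition Q :: "'h \<Rightarrow> real"
  where "Q y = (INF u\<in>\<U> y. cost u)"

lemma controls_L2: "u \<in> \<U> y \<Longrightarrow> L2 (lebesgue_on {0<..}) u"
  by (simp add: controls_def)

lemma energy_eq_cost: "u \<in> \<U> y \<Longrightarrow> energy u = ennreal (cost u)"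
  using controls_L2[of u y] by (simp add: L2_def)

lemma controls_nonempty: "\<U> y \<noteq> {}"
  using bounded_energy_control by blast

lemma bdd_below_cost: "bdd_below (cost ` \<U> y)"
  by (rule bdd_belowI2[of _ 0]) simp

lemma Q_le: "u \<in> \<U> y \<Longrightarrow> Q y \<le> cost u"
  unfolding Q_def by (rule cINF_lower[OF bdd_below_cost])

lemma Q_greatest: "(\<And>u. u \<in> \<U> y \<Longrightarrow> c \<le> cost u) \<Longrightarrow> c \<le> Q y"
  unfolding Q_def by (rule cINF_greatest[OF controls_nonempty])

lemma value_function_eq: "value_function D A S SE B y = ereal (Q y)"
proof -
  have "value_function D A S SE B y = (INF u\<in>\<U> y. ereal (cost u))"
    unfolding value_function_def
  proof (rule INF_cong[OF refl])
    fix u assume "u \<in> \<U> y"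
    then show "enn2ereal (energy u) = ereal (cost u)"
      by (subst energy_eq_cost) (simp_all add: enn2ereal_ennreal)
  qed
  also have "\<dots> = ereal (Q y)"
    unfolding Q_def using ereal_Inf'[OF bdd_below_cost, of y] controls_nonempty[of y] by (simp add: image_image)
  finally show ?thesis .
qed

lemma Q_nonneg: "0 \<le> Q y"
  by (rule Q_greatest) simp

lemma Q_bound: "\<exists>C\<ge>0. \<forall>y. Q y \<le> C * (norm y)\<^sup>2"
proof -
  obtain C where C: "C \<ge> 0" "\<And>y. \<exists>u\<in>\<U> y. energy u \<le> ennreal (C * (norm y)\<^sup>2)"
    using bounded_energy_control by blast
  have "Q y \<le> C * (norm y)\<^sup>2" for y
  proof -
    obtain u where u: "u \<in> \<U> y" "energy u \<le> ennreal (C * (norm y)\<^sup>2)" using C(2) by blast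
    then have "cost u \<le> C * (norm y)\<^sup>2"
      using enn2real_mono[OF u(2)] C(1) by simp
    then show ?thesis using Q_le[OF u(1)] by simp
  qed
  then show ?thesis using C(1) by blast
qed

lemma Q_scaleC_le: "Q (c *\<^sub>C x) \<le> (cmod c)\<^sup>2 * Q x"
proof (cases "c = 0")
  case True
  \<comment> \<open>Division by \<open>cmod c\<close> is impossible for \<open>c = 0\<close>; the
    quadratic bound gives \<open>Q 0 \<le> 0\<close> directly.\<close>
  obtain C where "\<And>y. Q y \<le> C * (norm y)\<^sup>2" using Q_bound by blast
  from this[of 0] show ?thesis using True by (simp add: scaleC_zero_left)
next
  case False
  have "Q (c *\<^sub>C x) / (cmod c)\<^sup>2 \<le> Q x"
  proof (rule Q_greatest)
    fix u assume u: "u \<in> \<U> x"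
    have "Q (c *\<^sub>C x) \<le> cost (\<lambda>s. c *\<^sub>C u s)" by (rule Q_le[OF controls_scaleC[OF u]])
    also have "\<dots> = (cmod c)\<^sup>2 * cost u"
      using complete_measure.L2_scaleC(2)[OF complete_measure_halfline controls_L2[OF u], of c]
      by (simp add: enn2real_mult)
    finally show "Q (c *\<^sub>C x) / (cmod c)\<^sup>2 \<le> cost u" using False by (simp add: divide_le_eq mult.commute)
  qed
  then show ?thesis using False by (simp add: divide_le_eq mult.commute)
qed

text \<open>The opposite inequality is the previous one with \<open>1 / c\<close> in place of
  \<open>c\<close>.\<close>

lemma Q_scaleC: "Q (c *\<^sub>C x) = (cmod c)\<^sup>2 * Q x"
proof (cases "c = 0")
  case True
  then show ?thesis using Q_scaleC_le[of c x] Q_nonneg[of "c *\<^sub>C x"] by simp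
next
  case False
  have "Q x \<le> (cmod (1 / c))\<^sup>2 * Q (c *\<^sub>C x)"
    using Q_scaleC_le[of "1 / c" "c *\<^sub>C x"] False by (simp add: scaleC_scaleC scaleC_one)
  then have "(cmod c)\<^sup>2 * Q x \<le> Q (c *\<^sub>C x)"
    using False by (simp add: norm_divide power_divide field_simps)
  then show ?thesis using Q_scaleC_le[of c x] by simp
qed

text \<open>Controls \<open>u\<close> and \<open>v\<close> for \<open>x\<close> and \<open>y\<close>
  provide \<open>u + v\<close> and \<open>u - v\<close> for the sum and the difference, and the
  energies obey the parallelogram law. The infimum is then taken over \<open>u\<close> and over
  \<open>v\<close> in turn.\<close>

lemma Q_parallelogram_le: "Q (x + y) + Q (x - y) \<le> 2 * Q x + 2 * Q y"
proof -
  have *: "Q (x + y) + Q (x - y) \<le> 2 * cost u + 2 * cost v" if u: "u \<in> \<U> x" and v: "v \<in> \<U> y" for u v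
  proof -
    have p: "(\<lambda>s. u s + v s) \<in> \<U> (x + y)" by (rule controls_add[OF u v])
    have m: "(\<lambda>s. u s - v s) \<in> \<U> (x - y)"
      using controls_add[OF u controls_scaleC[OF v, of "-1"]] by (simp add: scaleC_minus1)
    have "energy (\<lambda>s. u s + v s) + energy (\<lambda>s. u s - v s) = 2 * energy u + 2 * energy v"
      using controls_L2[OF u] controls_L2[OF v]
      by (intro complete_measure.sq_integral_parallelogram[OF complete_measure_halfline]) (auto simp: L2_def)
    moreover have "ennreal (cost (\<lambda>s. u s + v s) + cost (\<lambda>s. u s - v s)) = energy (\<lambda>s. u s + v s) + energy (\<lambda>s. u s - v s)"
      by (simp add: ennreal_plus flip: energy_eq_cost[OF p] energy_eq_cost[OF m])
    moreover have "ennreal (2 * cost u + 2 * cost v) = 2 * energy u + 2 * energy v"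
      by (simp add: ennreal_plus ennreal_mult flip: energy_eq_cost[OF u] energy_eq_cost[OF v])
    ultimately have "ennreal (cost (\<lambda>s. u s + v s) + cost (\<lambda>s. u s - v s)) = ennreal (2 * cost u + 2 * cost v)"
      by (simp only:)
    then have "cost (\<lambda>s. u s + v s) + cost (\<lambda>s. u s - v s) = 2 * cost u + 2 * cost v"
      by (subst (asm) ennreal_inj) simp_all
    then show ?thesis using Q_le[OF p] Q_le[OF m] by simp
  qed
  have "(Q (x + y) + Q (x - y) - 2 * cost v) / 2 \<le> Q x" if "v \<in> \<U> y" for v
    using *[OF _ that] by (intro Q_greatest) force
  then have "(Q (x + y) + Q (x - y) - 2 * Q x) / 2 \<le> Q y"
    by (intro Q_greatest) force
  then show ?thesis by simp
qed

text \<open>Applied to \<open>x + y\<close> and \<open>x - y\<close>, the inequality speaks of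
  \<open>2 x\<close> and \<open>2 y\<close>, and homogeneity turns it into its own reverse.\<close>

lemma Q_parallelogram: "Q (x + y) + Q (x - y) = 2 * Q x + 2 * Q y"
proof (rule antisym[OF Q_parallelogram_le])
  have "Q (z + z) = 4 * Q z" for z
    using Q_scaleC[of 2 z] scaleC_of_real[of 2 z] by (simp add: scaleR_2)
  then show "2 * Q x + 2 * Q y \<le> Q (x + y) + Q (x - y)"
    using Q_parallelogram_le[of "x + y" "x - y"] by (simp add: algebra_simps)
qed

theorem dissipation:
  assumes u: "L2_loc u" and t: "0 < t" and range: "L u t \<in> range emb"
  shows "0 \<le> Q (sol y u t) - Q y + (\<integral>s. (norm (u s))\<^sup>2 \<partial>lebs t)"
proof -
  have u2: "L2 (lebs t) u" by (rule L2_loc_imp_L2[OF u])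
  have "(\<lambda>s. norm (u s)) \<in> borel_measurable (lebs t)"
    using u2 by (intro strong_measurability.sm_norm_measurable[OF strong_measurability_norm[OF complete_measure_lebs]])
      (simp add: L2_def)
  then have int: "(\<integral>s. (norm (u s))\<^sup>2 \<partial>lebs t) = enn2real (sq_integral (lebs t) u)"
    unfolding sq_integral_def by (intro integral_eq_nn_integral borel_measurable_power) auto
  \<comment> \<open>Written as a lower bound for an infimum: every admissible control from the state
    at \<open>t\<close>, preceded by \<open>u\<close>, competes among the controls from
    \<open>y\<close>.\<close>
  have "Q y - enn2real (sq_integral (lebs t) u) \<le> Q (sol y u t)"
  proof (rule Q_greatest)
    fix v assume v: "v \<in> \<U> (sol y u t)"
    note w = controls_concat_at[OF u v t range]
    have "cost (concat_at t u v) = enn2real (sq_integral (lebs t) u) + cost v"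
      unfolding w(2) using u2 controls_L2[OF v] by (intro enn2real_plus) (auto simp: L2_def)
    then show "Q y - enn2real (sq_integral (lebs t) u) \<le> cost v"
      using Q_le[OF w(1)] by simp
  qed
  then show ?thesis unfolding int by simp
qed

end

theorem theorem2p6:
  fixes A :: "'h::complex_hilbert \<Rightarrow> 'h" and D :: "'h set"
    and S :: "real \<Rightarrow> 'h \<Rightarrow> 'h"
    and SE :: "real \<Rightarrow> ('h \<Rightarrow> complex) \<Rightarrow> ('h \<Rightarrow> complex)"
    and B :: "'u::complex_hilbert \<Rightarrow> ('h \<Rightarrow> complex)"
  assumes "generates UNIV norm D A S"
    and "generates (extrap_space D A) (extrap_norm D A) (range (embed_H D A)) (extrap_op D A) SE"
    and "bounded_clinear_on UNIV norm (extrap_space D A) (extrap_norm D A) B"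
    and "input_map_continuous D A SE B"
    and "null_controllable D A S SE B"
  shows "\<exists>P :: 'h \<Rightarrow> 'h.
    bounded_clinear_on UNIV norm UNIV norm P \<and> P = adj UNIV P \<and>
    (\<forall>y0. value_function D A S SE B y0 = ereal (Re (cinner y0 (P y0)))) \<and>
    (\<forall>y0 u. L2_loc u \<longrightarrow>
      (AE t in lebesgue_on {0..}.
        Re (cinner (P (solution D A S SE B y0 u t)) (solution D A S SE B y0 u t))
          - Re (cinner (P y0) y0)
          + (\<integral>s. (norm (u s))\<^sup>2 \<partial>lebesgue_on {0<..<t}) \<ge> 0))"
proof -
  interpret null_controllable_system D A S SE B
    using assms by unfold_locales
  obtain C where "C \<ge> 0" "\<And>y. Q y \<le> C * (norm y)\<^sup>2" using Q_bound by blast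
  then obtain P where P: "bounded_clinear_on UNIV norm UNIV norm P"
    and sym: "\<And>x y. cinner (P x) y = cinner x (P y)" and Q: "\<And>x. Q x = Re (cinner x (P x))"
    using bounded_quadratic_form_representation[of Q C] Q_parallelogram Q_scaleC Q_nonneg by blast
  have "adj UNIV P y = P y" for y
    unfolding adj_def
    by (intro the_equality) (auto simp: sym intro: cinner_eqI_right)
  then have "P = adj UNIV P" by auto
  moreover have "AE t in lebesgue_on {0..}. 0 \<le> Re (cinner (P (sol y u t)) (sol y u t)) - Re (cinner (P y) y)
      + (\<integral>s. (norm (u s))\<^sup>2 \<partial>lebesgue_on {0<..<t})" if u: "L2_loc u" for y u
  proof -
    have "AE t in lebesgue. t \<in> {0<..} \<longrightarrow> L u t \<in> range emb"
      using L_in_range[OF u] by (subst (asm) AE_restrict_space_iff) auto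
    \<comment> \<open>The time \<open>0\<close> is discarded as a null set, because concatenation
      needs a positive time.\<close>
    then have "AE t in lebesgue. t \<in> {0..} \<longrightarrow> 0 \<le> Re (cinner (P (sol y u t)) (sol y u t)) - Re (cinner (P y) y)
      + (\<integral>s. (norm (u s))\<^sup>2 \<partial>lebesgue_on {0<..<t})"
      using AE_lebesgue_neq[of 0]
    proof eventually_elim
      fix t assume "t \<in> {0<..} \<longrightarrow> L u t \<in> range emb" "t \<noteq> (0::real)"
      then show "t \<in> {0..} \<longrightarrow> 0 \<le> Re (cinner (P (sol y u t)) (sol y u t)) - Re (cinner (P y) y)
        + (\<integral>s. (norm (u s))\<^sup>2 \<partial>lebesgue_on {0<..<t})"
        using dissipation[OF u, of t y] by (auto simp: Q sym)
    qed
    then show ?thesis by (subst AE_restrict_space_iff) auto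
  qed
  ultimately show ?thesis
    using P value_function_eq Q by (intro exI[of _ P]) auto
qed

end
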